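(* Let $\Bbbk$ be an algebraically closed field of characteristic $0$, $n$ an even positive integer, $\mu\in\Bbbk$, and $H=(A(n,2,\mu,-1))^*$. For all $i,j,p,q\in\mathbb{Z}$ and $k,t\in\mathbb{Z}_{+}=\{0,1,2,\dots\}$, the following isomorphisms hold in $\mathcal{D}^b(H)$: (1) $N_i[p]\otimes N_j[q]\cong N_{i+j}[p+q-2]$; (2) $M_{i,i-k}[p]\otimes N_j[q]\cong N_j[q]\otimes M_{i,i-k}[p]\cong M_{i+j,\,i-k+j}[p+q-2]$; (3) $M_{i,i-k}[p]\otimes M_{j,j-t}[q]\cong M_{i+j+1,\,i+j+1-\min\{k,t\}}[p+q]\oplus M_{i+j-\max\{k,t\},\,i+j-k-t}[p+q-\max\{k,t\}]$.
   Context: $A(n,2,\mu,-1)$ is the Hopf algebra generated as an algebra by $g,x$ with relations $g^n=1$, $x^2=\mu(1-g^2)$, $xg=-gx$, with $\Delta(g)=g\otimes g$, $\varepsilon(g)=1$, $\Delta(x)=x\otimes 1+g\otimes x$, $\varepsilon(x)=0$; it has basis $\{g^ix^j\mid 0\le i\le n-1,\ 0\le j\le 1\}$. $H$ is its dual Hopf algebra (product dual to $\Delta$, coproduct dual to multiplication), with dual basis $\{p_{g^ix^j}\}$; write $e_i=p_{g^i}$ and $a_i=p_{g^ix}$, with indices read modulo $n$. As an algebra, $H\cong \Bbbk\mathbb{Z}_n^a/J^2$, where $\mathbb{Z}_n$ here is the cyclic quiver with vertices $e_0,\dots,e_{n-1}$ and arrows $a_i:e_i\to e_{i+1}$, $\Bbbk\mathbb{Z}_n^a$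 is its path algebra (paths are read from right to left, so $a_i=e_{i+1}a_ie_i$), and $J$ is the ideal generated by the arrows. $\mathcal{D}^b(H)$ is the bounded derived category of finitely generated left $H$-modules. $P_i=He_i=\operatorname{span}\{e_i,a_i\}$. The arrow $a_i$ also denotes the left $H$-module map $P_{i+1}\to P_i$, $u\mapsto ua_i$, with kernel $\ker(a_i)=\operatorname{span}\{a_{i+1}\}\subseteq P_{i+1}$, and $\eta_{i+1}:\ker(a_i)\to P_{i+1}$ is the inclusion. For $i\in\mathbb{Z}$ and $j\in\mathbb{Z}_+$ define the complexes $$M_{i,i-j}=\ 0\to P_i\xrightarrow{a_{i-1}}P_{i-1}\xrightarrow{a_{i-2}}\cdots\xrightarrow{a_{i-j}}P_{i-j}\to 0,\qquad N_i=\ 0\to \ker(a_i)\xrightarrow{\eta_{i+1}}P_{i+1}\xrightarrow{a_i}P_i\to 0,$$ whose leftmost non-zero displayed terms lie in degree $0$ (so $M_{i,i}$ is $P_i$ in degree $0$); the indices of the $P$'s and $a$'s are taken modulo $n$, and $M_{i,i-j}$ has $j+1$ terms. The shift is $(X^\bullet[1])^m=X^{m+1}$ with $d_{X[1]}=-d_X$. The tensor product on $\mathcal{D}^b(H)$ is $(X^\bullet\otimes Y^\bullet)^m=\bigoplus_{r+s=m}X^r\otimes Y^s$ (tensor over $\Bbbk$, with $H$ acting through its coproduct), with differential $d|_{X^r\otimes Y^s}=d_X^r\otimes\mathrm{id}+(-1)^r\,\mathrm{id}\otimes d_Y^s$. *)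

theory Defs
  imports "HOL-Computational_Algebra.Polynomial" "HOL-Library.Function_Algebras"
begin

section \<open>Ambient vector space\<close>

text \<open>
  All vector spaces are subspaces of the space of functions on the following infinite set of labels.
  \<^term>\<open>Gx i j\<close> stands for the basis element \<open>g\<^sup>i x\<^sup>j\<close>; \<^term>\<open>Pr a b\<close> and \<^term>\<open>Tag r a\<close> are labels
  for tensor products and for direct sums. Every finite-dimensional \<open>H\<close>-module is isomorphic to one
  whose underlying space is such a subspace.
\<close>

datatype lab = Gx int nat | Pr lab lab | Tag int lab

type_synonym 'k fvec = "lab \<Rightarrow> 'k"

definition scl :: "'k::field \<Rightarrow> 'k fvec \<Rightarrow> 'k fvec" where
  "scl c v = (\<lambda>l. c * v l)"

interpretation fvec: vector_space "scl :: 'k::field \<Rightarrow> 'k fvec \<Rightarrow> 'k fvec"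
  by unfold_locales (auto simp: scl_def fun_eq_iff algebra_simps)

definition bv :: "lab \<Rightarrow> 'k::field fvec" where
  "bv b = (\<lambda>l. if l = b then 1 else 0)"

text \<open>The elementary tensor \<open>v \<otimes> w\<close>; \<open>V \<otimes> W\<close> is realised as the span of these.\<close>

definition pten :: "'k::field fvec \<Rightarrow> 'k fvec \<Rightarrow> 'k fvec" where
  "pten v w = (\<lambda>l. case l of Pr a b \<Rightarrow> v a * w b | _ \<Rightarrow> 0)"

text \<open>
  \<open>f \<otimes> g\<close> on \<open>V \<otimes> W\<close>, for linear maps \<open>f\<close> on \<open>V\<close> and \<open>g\<close> on \<open>W\<close>, computed slice by slice:
  for \<open>z \<in> V \<otimes> W\<close> every slice \<open>z(a', -)\<close> lies in \<open>W\<close>, and the slices of \<open>(id \<otimes> g) z\<close> in the first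
  variable lie in \<open>V\<close>. See \<open>tmap_pten\<close> and \<open>tmap_linear\<close> below.
\<close>

definition tmap :: "('k::field fvec \<Rightarrow> 'k fvec) \<Rightarrow> ('k fvec \<Rightarrow> 'k fvec) \<Rightarrow> 'k fvec \<Rightarrow> 'k fvec" where
  "tmap f g z = (\<lambda>l. case l of Pr a b \<Rightarrow> f (\<lambda>a'. g (\<lambda>b'. z (Pr a' b')) b) a | _ \<Rightarrow> 0)"

definition linear_on :: "'k::field fvec set \<Rightarrow> ('k fvec \<Rightarrow> 'k fvec) \<Rightarrow> bool" where
  "linear_on V f \<longleftrightarrow> (\<forall>v\<in>V. \<forall>w\<in>V. f (v + w) = f v + f w) \<and> (\<forall>c. \<forall>v\<in>V. f (scl c v) = scl c (f v))"

definition tspace :: "'k::field fvec set \<Rightarrow> 'k fvec set \<Rightarrow> 'k fvec set" where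
  "tspace V W = fvec.span {pten v w |v w. v \<in> V \<and> w \<in> W}"

lemma tmap_pten:
  assumes "linear_on V f" "linear_on W g" "v \<in> V" "w \<in> W"
  shows "tmap f g (pten v w) = pten (f v) (g w)"
proof -
  have g: "g (\<lambda>b'. c * w b') b = c * g w b" for b c
    using assms unfolding linear_on_def scl_def by metis
  have f: "f (\<lambda>a'. v a' * c) a = f v a * c" for c a
    using assms(1,3) unfolding linear_on_def scl_def by (simp add: mult.commute[of _ c])
  show ?thesis
    by (auto simp: tmap_def pten_def fun_eq_iff f g split: lab.splits)
qed

lemma tspace_slice:
  assumes W: "fvec.subspace W" and z: "z \<in> tspace V W"
  shows "(\<lambda>b. z (Pr a b)) \<in> W"
  using z unfolding tspace_def
proof (induction rule: fvec.span_induct)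
  case base
  show ?case
    using W unfolding fvec.subspace_def by (auto simp: plus_fun_def zero_fun_def scl_def)
next
  case (step z)
  then show ?case
    using W unfolding fvec.subspace_def by (auto simp: pten_def scl_def)
qed

lemma tmap_linear:
  assumes V: "fvec.subspace V" and W: "fvec.subspace W"
    and f: "linear_on V f" and g: "linear_on W g"
  shows "linear_on (tspace V W) (tmap f g)"
proof -
  let ?s = "\<lambda>z b a. g (\<lambda>b'. z (Pr a b')) b"
  have gadd: "?s (z + z') b = ?s z b + ?s z' b" if "z \<in> tspace V W" "z' \<in> tspace V W" for z z' b
    using g tspace_slice[OF W that(1)] tspace_slice[OF W that(2)]
    unfolding linear_on_def by (auto simp: plus_fun_def fun_eq_iff)
  have gscl: "?s (scl c z) b = scl c (?s z b)" if "z \<in> tspace V W" for c z b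
    using g tspace_slice[OF W that]
    unfolding linear_on_def by (auto simp: scl_def fun_eq_iff)
  have sV: "?s z b \<in> V" if z: "z \<in> tspace V W" for z b
  proof -
    have "z \<in> tspace V W \<and> ?s z b \<in> V"
      using z[unfolded tspace_def]
    proof (induction rule: fvec.span_induct_alt)
      case base
      have 0: "0 \<in> tspace V W"
        unfolding tspace_def by (rule fvec.span_zero)
      have "?s 0 b = 0"
        using gscl[OF 0, of 0 b] by (simp add: scl_def fun_eq_iff)
      then have "?s 0 b \<in> V"
        using V unfolding fvec.subspace_def by simp
      with 0 show ?case by (rule conjI)
    next
      case (step c x y)
      then obtain v w where x: "x = pten v w" "v \<in> V" "w \<in> W" by auto
      have xT: "x \<in> tspace V W"
        using x unfolding tspace_def by (auto intro!: fvec.span_base)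
      have cT: "scl c x \<in> tspace V W"
        using xT unfolding tspace_def by (rule fvec.span_scale)
      have "?s x b = scl (g w b) v"
        using g x unfolding linear_on_def
        by (auto simp: pten_def fun_eq_iff scl_def mult.commute)
      then have "?s x b \<in> V"
        using V x unfolding fvec.subspace_def by auto
      then have "?s (scl c x + y) b \<in> V"
        using gadd[OF cT, of y] gscl[OF xT] step V unfolding fvec.subspace_def by auto
      moreover have "scl c x + y \<in> tspace V W"
        using cT step unfolding tspace_def by (auto intro: fvec.span_add)
      ultimately show ?case by blast
    qed
    then show ?thesis by blast
  qed
  show ?thesis
    unfolding linear_on_def
  proof (intro conjI ballI allI)
    fix z z' assume z: "z \<in> tspace V W" "z' \<in> tspace V W"
    have "f (?s (z + z') b) a = f (?s z b) a + f (?s z' b) a" for a b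
      using f sV[OF z(1), of b] sV[OF z(2), of b] unfolding gadd[OF z] linear_on_def by simp
    then show "tmap f g (z + z') = tmap f g z + tmap f g z'"
      unfolding tmap_def by (auto simp: fun_eq_iff split: lab.splits)
  next
    fix c z assume z: "z \<in> tspace V W"
    have "f (?s (scl c z) b) a = c * f (?s z b) a" for a b
      using f sV[OF z] unfolding gscl[OF z] linear_on_def by (simp add: scl_def)
    then show "tmap f g (scl c z) = scl c (tmap f g z)"
      unfolding tmap_def scl_def[of c "case_lab _ _ _"]
      by (auto simp: fun_eq_iff scl_def split: lab.splits)
  qed
qed


section \<open>The Hopf algebra \<open>A(n,2,\<mu>,-1)\<close> and its dual \<open>H\<close>\<close>

definition basis :: "nat \<Rightarrow> lab set" where
  "basis n = {Gx i j |i j. 0 \<le> i \<and> i < int n \<and> j < 2}"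

text \<open>
  The product of two basis elements of \<open>A(n,2,\<mu>,-1)\<close>, obtained by reordering with \<open>x g = - g x\<close> and
  reducing with \<open>g\<^sup>n = 1\<close> and \<open>x\<^sup>2 = \<mu> (1 - g\<^sup>2)\<close>.
\<close>

fun mulb :: "nat \<Rightarrow> 'k::field \<Rightarrow> lab \<Rightarrow> lab \<Rightarrow> 'k fvec" where
  "mulb n \<mu> (Gx i s) (Gx j t) =
     (if s + t < 2 then scl ((- 1) ^ (s * nat j)) (bv (Gx ((i + j) mod int n) (s + t)))
      else scl ((- 1) ^ nat j * \<mu>) (bv (Gx ((i + j) mod int n) 0) - bv (Gx ((i + j + 2) mod int n) 0)))"
| "mulb n \<mu> _ _ = 0"

text \<open>
  The coproduct on basis elements, from \<open>\<Delta>(g\<^sup>i x) = (g \<otimes> g)\<^sup>i (x \<otimes> 1 + g \<otimes> x)\<close>.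
\<close>

fun comulb :: "nat \<Rightarrow> lab \<Rightarrow> 'k::field fvec" where
  "comulb n (Gx i j) =
     (if j = 0 then pten (bv (Gx i 0)) (bv (Gx i 0))
      else pten (bv (Gx i 1)) (bv (Gx i 0)) + pten (bv (Gx ((i + 1) mod int n) 0)) (bv (Gx i 1)))"
| "comulb n _ = 0"

definition mulA :: "nat \<Rightarrow> 'k::field \<Rightarrow> 'k fvec \<Rightarrow> 'k fvec \<Rightarrow> 'k fvec" where
  "mulA n \<mu> u v = (\<Sum>b\<in>basis n. \<Sum>b'\<in>basis n. scl (u b * v b') (mulb n \<mu> b b'))"

definition comulA :: "nat \<Rightarrow> 'k::field fvec \<Rightarrow> 'k fvec" where
  "comulA n u = (\<Sum>b\<in>basis n. scl (u b) (comulb n b))"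

text \<open>The product of \<open>A \<otimes> A\<close>.\<close>

definition mulAA :: "nat \<Rightarrow> 'k::field \<Rightarrow> 'k fvec \<Rightarrow> 'k fvec \<Rightarrow> 'k fvec" where
  "mulAA n \<mu> z z' = (\<Sum>b\<in>basis n. \<Sum>b'\<in>basis n. \<Sum>a\<in>basis n. \<Sum>a'\<in>basis n.
     scl (z (Pr a b) * z' (Pr a' b')) (pten (mulb n \<mu> a a') (mulb n \<mu> b b')))"

text \<open>
  The following lemmas confirm that these structure constants define an associative unital algebra,
  that \<open>g\<close> and \<open>x\<close> satisfy the defining relations and generate it, and that \<open>\<Delta>\<close> is multiplicative
  with the prescribed values on \<open>g\<close> and \<open>x\<close>.
\<close>

lemma sum_fun_apply: "(\<Sum>x\<in>S. f x) l = (\<Sum>x\<in>S. f x l)"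
  for f :: "'b \<Rightarrow> 'c \<Rightarrow> 'k::comm_monoid_add"
  by (induction S rule: infinite_finite_induct) auto

lemma finite_basis [simp]: "finite (basis n)"
proof -
  have "basis n = (\<lambda>(i, j). Gx i j) ` ({0..<int n} \<times> {..<2})"
    by (auto simp: basis_def)
  then show ?thesis by simp
qed

lemma Gx_basis [simp]: "Gx i j \<in> basis n \<longleftrightarrow> 0 \<le> i \<and> i < int n \<and> j < 2"
  by (auto simp: basis_def)

lemma mulA_linear:
  "mulA n \<mu> (u + u') v = mulA n \<mu> u v + mulA n \<mu> u' v"
  "mulA n \<mu> (u - u') v = mulA n \<mu> u v - mulA n \<mu> u' v"
  "mulA n \<mu> (scl c u) v = scl c (mulA n \<mu> u v)"
  "mulA n \<mu> u (v + v') = mulA n \<mu> u v + mulA n \<mu> u v'"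
  "mulA n \<mu> u (v - v') = mulA n \<mu> u v - mulA n \<mu> u v'"
  "mulA n \<mu> u (scl c v) = scl c (mulA n \<mu> u v)"
  by (simp_all add: mulA_def fun_eq_iff sum_fun_apply scl_def algebra_simps
      sum.distrib sum_subtractf sum_distrib_left)

lemma mulA_bv:
  assumes "b \<in> basis n" "b' \<in> basis n"
  shows "mulA n (\<mu> :: 'k::field) (bv b) (bv b') = mulb n \<mu> b b'"
proof -
  have d: "(if P then 1 else 0) * z = (if P then z else 0)" for P and z :: 'k
    by simp
  have 1: "(\<Sum>c\<in>basis n. bv b c * F c) = F b" if "b \<in> basis n" for b and F :: "lab \<Rightarrow> 'k"
    using that by (simp add: bv_def d)
  have "(\<Sum>c\<in>basis n. \<Sum>c'\<in>basis n. bv b c * bv b' c' * f c c') =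
      (\<Sum>c\<in>basis n. bv b c * (\<Sum>c'\<in>basis n. bv b' c' * f c c'))" for f :: "lab \<Rightarrow> lab \<Rightarrow> 'k"
    by (simp add: sum_distrib_left mult.assoc)
  then have "(\<Sum>c\<in>basis n. \<Sum>c'\<in>basis n. bv b c * bv b' c' * f c c') = f b b'"
    for f :: "lab \<Rightarrow> lab \<Rightarrow> 'k"
    using assms by (simp add: 1)
  then show ?thesis
    unfolding mulA_def scl_def by (simp add: fun_eq_iff sum_fun_apply)
qed

lemma mulA_Gx:
  assumes "0 \<le> i" "i < int n" "0 \<le> j" "j < int n" "s < 2" "t < 2"
  shows "mulA n \<mu> (bv (Gx i s)) (bv (Gx j t)) = mulb n \<mu> (Gx i s) (Gx j t)"
  using assms by (intro mulA_bv) auto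

lemma minus_one_power_nat_mod:
  assumes "even n" "n > 0" "0 \<le> i"
  shows "(- 1) ^ nat (i mod int n) = ((- 1) ^ nat i :: 'k::field)"
  using assms by (simp add: minus_one_power_iff even_nat_iff dvd_mod_iff)

lemma mulA_assoc_basis:
  assumes n: "even n" "n > 0" and b: "b1 \<in> basis n" "b2 \<in> basis n" "b3 \<in> basis n"
  shows "mulA n \<mu> (mulA n \<mu> (bv b1) (bv b2)) (bv b3) = mulA n \<mu> (bv b1) (mulA n \<mu> (bv b2) (bv b3))"
proof -
  obtain i1 i2 i3 s1 s2 s3 where
    eq: "b1 = Gx i1 s1" "b2 = Gx i2 s2" "b3 = Gx i3 s3"
    and i: "0 \<le> i1" "i1 < int n" "0 \<le> i2" "i2 < int n" "0 \<le> i3" "i3 < int n"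
    and "s1 < 2" "s2 < 2" "s3 < 2"
    using b unfolding basis_def by auto
  then have s: "s1 = 0 \<or> s1 = 1" "s2 = 0 \<or> s2 = 1" "s3 = 0 \<or> s3 = 1" by auto
  have m: "0 \<le> z mod int n" "z mod int n < int n" for z
    using n by auto
  have ac: "(x + (y + z mod int n)) mod int n = (x + (y + z)) mod int n" for x y z
    by (metis add.assoc mod_add_right_eq)
  show ?thesis
    using s i n
    by (elim disjE)
      (simp_all add: eq mulA_Gx mulA_linear m minus_one_power_nat_mod nat_add_distrib power_add
        mod_simps ac_simps ac fvec.scale_right_diff_distrib)
qed

lemma mulA_one:
  assumes "n > 0" "b \<in> basis n"
  shows "mulA n \<mu> (bv (Gx 0 0)) (bv b) = bv b" "mulA n \<mu> (bv b) (bv (Gx 0 0)) = bv b"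
  using assms by (auto simp: basis_def mulA_Gx mod_pos_pos_trivial)

lemma mulA_relations:
  assumes n: "even n" "n > 0"
  defines "g \<equiv> bv (Gx 1 0)" and "x \<equiv> bv (Gx 0 1)"
  shows "(mulA n \<mu> g ^^ k) (bv (Gx 0 0)) = bv (Gx (int k mod int n) 0)"
    and "0 \<le> i \<Longrightarrow> i < int n \<Longrightarrow> mulA n \<mu> (bv (Gx i 0)) x = bv (Gx i 1)"
    and "mulA n \<mu> x x = scl \<mu> (bv (Gx 0 0) - mulA n \<mu> g g)"
    and "mulA n \<mu> x g = scl (- 1) (mulA n \<mu> g x)"
proof -
  have n2: "1 < int n" using n by (auto elim!: evenE)
  show "(mulA n \<mu> g ^^ k) (bv (Gx 0 0)) = bv (Gx (int k mod int n) 0)"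
    using n2 by (induction k) (simp_all add: g_def mulA_Gx mod_simps)
  show "0 \<le> i \<Longrightarrow> i < int n \<Longrightarrow> mulA n \<mu> (bv (Gx i 0)) x = bv (Gx i 1)"
    using n2 by (simp add: x_def mulA_Gx)
  show "mulA n \<mu> x x = scl \<mu> (bv (Gx 0 0) - mulA n \<mu> g g)"
    using n2 by (simp add: x_def g_def mulA_Gx)
  show "mulA n \<mu> x g = scl (- 1) (mulA n \<mu> g x)"
    using n2 by (simp add: x_def g_def mulA_Gx)
qed

lemma pten_linear:
  "pten (u + u') v = pten u v + pten u' v"
  "pten (u - u') v = pten u v - pten u' v"
  "pten (- u) v = - pten u v"
  "pten (scl c u) v = scl c (pten u v)"
  "pten u (v + v') = pten u v + pten u v'"
  "pten u (v - v') = pten u v - pten u v'"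
  "pten u (- v) = - pten u v"
  "pten u (scl c v) = scl c (pten u v)"
  by (auto simp: pten_def fun_eq_iff scl_def algebra_simps split: lab.splits)

lemma comulA_linear:
  "comulA n (u + v) = comulA n u + comulA n v"
  "comulA n (u - v) = comulA n u - comulA n v"
  "comulA n (scl c u) = scl c (comulA n u)"
  by (simp_all add: comulA_def fun_eq_iff sum_fun_apply scl_def algebra_simps
      sum.distrib sum_subtractf sum_distrib_left)

lemma comulA_bv:
  assumes "b \<in> basis n"
  shows "comulA n (bv b) = (comulb n b :: 'k::field fvec)"
proof -
  have d: "(if P then 1 else 0) * z = (if P then z else 0)" for P and z :: 'k
    by simp
  show ?thesis
    using assms unfolding comulA_def scl_def by (simp add: fun_eq_iff sum_fun_apply bv_def d)
qed

lemma mulAA_linear: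
  "mulAA n \<mu> (u + u') v = mulAA n \<mu> u v + mulAA n \<mu> u' v"
  "mulAA n \<mu> u (v + v') = mulAA n \<mu> u v + mulAA n \<mu> u v'"
  by (simp_all add: mulAA_def fun_eq_iff sum_fun_apply scl_def algebra_simps sum.distrib)

lemma pten_sum:
  "pten (\<Sum>x\<in>S. f x) v = (\<Sum>x\<in>S. pten (f x) v)"
  "pten u (\<Sum>x\<in>S. f x) = (\<Sum>x\<in>S. pten u (f x))"
  by (induction S rule: infinite_finite_induct)
    (auto simp: pten_linear, auto simp: pten_def fun_eq_iff split: lab.splits)

lemma mulAA_pten:
  "mulAA n \<mu> (pten u v) (pten u' v') = pten (mulA n \<mu> u u') (mulA n \<mu> v v')"
proof -
  show ?thesis
    unfolding mulAA_def mulA_def pten_sum pten_linear fvec.scale_sum_right fvec.scale_scale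
    by (intro sum.cong refl) (simp add: pten_def mult_ac)
qed

lemma comulA_mult_basis:
  assumes n: "even n" "n > 0" and b: "b1 \<in> basis n" "b2 \<in> basis n"
  shows "comulA n (mulA n \<mu> (bv b1) (bv b2)) = mulAA n \<mu> (comulA n (bv b1)) (comulA n (bv b2))"
proof -
  obtain i1 i2 s1 s2 where
    eq: "b1 = Gx i1 s1" "b2 = Gx i2 s2"
    and i: "0 \<le> i1" "i1 < int n" "0 \<le> i2" "i2 < int n"
    and "s1 < 2" "s2 < 2"
    using b unfolding basis_def by auto
  then have s: "s1 = 0 \<or> s1 = 1" "s2 = 0 \<or> s2 = 1" by auto
  have m: "0 \<le> z mod int n" "z mod int n < int n" for z
    using n by auto
  have ac: "(x + (y + z mod int n)) mod int n = (x + (y + z)) mod int n" for x y z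
    by (metis add.assoc mod_add_right_eq)
  show ?thesis
    using s i n
    by (elim disjE)
      (simp_all add: eq mulA_Gx mulA_linear comulA_linear comulA_bv mulAA_linear mulAA_pten pten_linear
        m minus_one_power_nat_mod nat_add_distrib power_add mod_simps ac_simps ac
        fvec.scale_right_diff_distrib fvec.scale_right_distrib)
qed

text \<open>
  An element \<open>h\<close> of \<open>H = A\<^sup>*\<close> is the functional with values \<open>h b\<close> at the basis elements \<open>b\<close>; thus
  \<^term>\<open>bv b\<close>, for \<open>b\<close> in the basis of \<open>A\<close>, is the dual basis element \<open>p\<^sub>b\<close>.
\<close>

definition Hset :: "nat \<Rightarrow> 'k::field fvec set" where
  "Hset n = {h. \<forall>l. l \<notin> basis n \<longrightarrow> h l = 0}"

definition mulH :: "nat \<Rightarrow> 'k::field fvec \<Rightarrow> 'k fvec \<Rightarrow> 'k fvec" where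
  "mulH n h h' = (\<lambda>c. if c \<in> basis n
     then (\<Sum>b\<in>basis n. \<Sum>b'\<in>basis n. h b * h' b' * comulb n c (Pr b b')) else 0)"

text \<open>The unit of \<open>H\<close> is the counit of \<open>A\<close>.\<close>

definition oneH :: "nat \<Rightarrow> 'k::field fvec" where
  "oneH n = (\<Sum>i\<in>{0..<int n}. bv (Gx i 0))"

text \<open>
  The coefficient of \<open>p\<^sub>b \<otimes> p\<^sub>b\<^sub>'\<close> in \<open>\<Delta>(h)\<close>, that is, the value of \<open>h\<close> at the product \<open>b b'\<close> in \<open>A\<close>.
\<close>

definition comulH :: "nat \<Rightarrow> 'k::field \<Rightarrow> 'k fvec \<Rightarrow> lab \<Rightarrow> lab \<Rightarrow> 'k" where
  "comulH n \<mu> h b b' = (\<Sum>c\<in>basis n. mulb n \<mu> b b' c * h c)"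

definition idem :: "nat \<Rightarrow> int \<Rightarrow> 'k::field fvec" where
  "idem n i = bv (Gx (i mod int n) 0)"

definition arrow :: "nat \<Rightarrow> int \<Rightarrow> 'k::field fvec" where
  "arrow n i = bv (Gx (i mod int n) 1)"


lemma mulH_bv:
  assumes "b \<in> basis n" "b' \<in> basis n"
  shows "mulH n (bv b) (bv b') = (\<lambda>c. if c \<in> basis n then comulb n c (Pr b b') else 0 :: 'k::field)"
proof -
  have d: "(if P then 1 else 0) * z = (if P then z else 0)" for P and z :: 'k
    by simp
  have 1: "(\<Sum>c\<in>basis n. bv b c * F c) = F b" if "b \<in> basis n" for b and F :: "lab \<Rightarrow> 'k"
    using that by (simp add: bv_def d)
  have "(\<Sum>c\<in>basis n. \<Sum>c'\<in>basis n. bv b c * bv b' c' * f c c') =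
      (\<Sum>c\<in>basis n. bv b c * (\<Sum>c'\<in>basis n. bv b' c' * f c c'))" for f :: "lab \<Rightarrow> lab \<Rightarrow> 'k"
    by (simp add: sum_distrib_left mult.assoc)
  then have "(\<Sum>c\<in>basis n. \<Sum>c'\<in>basis n. bv b c * bv b' c' * f c c') = f b b'"
    for f :: "lab \<Rightarrow> lab \<Rightarrow> 'k"
    using assms by (simp add: 1)
  then show ?thesis
    unfolding mulH_def by (simp add: fun_eq_iff)
qed

text \<open>The relations in \<open>H\<close> of the path algebra of the cyclic quiver modulo the square of the arrow ideal.\<close>

lemma mulH_relations:
  assumes "n > 0"
  shows "mulH n (idem n i) (idem n j) = (if i mod int n = j mod int n then idem n i else 0)"
    and "mulH n (idem n i) (arrow n j) = (if i mod int n = (j + 1) mod int n then arrow n j else 0)"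
    and "mulH n (arrow n i) (idem n j) = (if i mod int n = j mod int n then arrow n i else 0)"
    and "mulH n (arrow n i) (arrow n j) = 0"
proof -
  have m: "0 \<le> z mod int n" "z mod int n < int n" for z
    using assms by auto
  have bas: "Gx (z mod int n) 0 \<in> basis n" "Gx (z mod int n) 1 \<in> basis n" for z
    using m by auto
  note prod = idem_def arrow_def mulH_bv[OF bas(1) bas(1)] mulH_bv[OF bas(1) bas(2)]
    mulH_bv[OF bas(2) bas(1)] mulH_bv[OF bas(2) bas(2)]
  show "mulH n (idem n i) (idem n j) = (if i mod int n = j mod int n then idem n i else 0)"
    unfolding prod by (auto simp: fun_eq_iff basis_def pten_def bv_def m split: if_splits)
  show "mulH n (idem n i) (arrow n j) = (if i mod int n = (j + 1) mod int n then arrow n j else 0)"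
    unfolding prod by (auto simp: fun_eq_iff basis_def pten_def bv_def m mod_simps split: if_splits)
  show "mulH n (arrow n i) (idem n j) = (if i mod int n = j mod int n then arrow n i else 0)"
    unfolding prod by (auto simp: fun_eq_iff basis_def pten_def bv_def m split: if_splits)
  show "mulH n (arrow n i) (arrow n j) = 0"
    unfolding prod by (auto simp: fun_eq_iff basis_def pten_def bv_def m split: if_splits)
qed


section \<open>Modules and complexes\<close>

record 'k hmod =
  carr :: "'k fvec set"
  act :: "'k fvec \<Rightarrow> 'k fvec \<Rightarrow> 'k fvec"

definition hmodule :: "nat \<Rightarrow> 'k::field hmod \<Rightarrow> bool" where
  "hmodule n M \<longleftrightarrow> fvec.subspace (carr M) \<and>
     (\<forall>h\<in>Hset n. act M h ` carr M \<subseteq> carr M \<and> linear_on (carr M) (act M h)) \<and>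
     (\<forall>v\<in>carr M. linear_on (Hset n) (\<lambda>h. act M h v)) \<and>
     (\<forall>v\<in>carr M. act M (oneH n) v = v) \<and>
     (\<forall>h\<in>Hset n. \<forall>h'\<in>Hset n. \<forall>v\<in>carr M. act M (mulH n h h') v = act M h (act M h' v))"

definition fin_gen :: "nat \<Rightarrow> 'k::field hmod \<Rightarrow> bool" where
  "fin_gen n M \<longleftrightarrow> (\<exists>S. finite S \<and> S \<subseteq> carr M \<and>
     carr M = {\<Sum>s\<in>S. act M (c s) s |c. \<forall>s\<in>S. c s \<in> Hset n})"

definition hmod_hom :: "nat \<Rightarrow> 'k::field hmod \<Rightarrow> 'k hmod \<Rightarrow> ('k fvec \<Rightarrow> 'k fvec) \<Rightarrow> bool" where
  "hmod_hom n M N f \<longleftrightarrow> f ` carr M \<subseteq> carr N \<and>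
     (\<forall>v\<in>carr M. \<forall>w\<in>carr M. f (v + w) = f v + f w) \<and>
     (\<forall>h\<in>Hset n. \<forall>v\<in>carr M. f (act M h v) = act N h (f v))"

definition zero_mod :: "'k::field hmod" where
  "zero_mod = \<lparr>carr = {0}, act = (\<lambda>h v. 0)\<rparr>"

text \<open>\<open>V \<otimes> W\<close> over the ground field, with \<open>H\<close> acting through its coproduct.\<close>

definition ten_mod :: "nat \<Rightarrow> 'k::field \<Rightarrow> 'k hmod \<Rightarrow> 'k hmod \<Rightarrow> 'k hmod" where
  "ten_mod n \<mu> V W = \<lparr>carr = tspace (carr V) (carr W),
     act = (\<lambda>h z. \<Sum>b\<in>basis n. \<Sum>b'\<in>basis n.
       scl (comulH n \<mu> h b b') (tmap (act V (bv b)) (act W (bv b')) z))\<rparr>"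

text \<open>The component in the \<open>r\<close>-th summand, and the element with given components.\<close>

definition cmp :: "int \<Rightarrow> 'k fvec \<Rightarrow> 'k fvec" where
  "cmp r v = (\<lambda>l. v (Tag r l))"

definition glue :: "(int \<Rightarrow> 'k::field fvec) \<Rightarrow> 'k fvec" where
  "glue u = (\<lambda>l. case l of Tag r l' \<Rightarrow> u r l' | _ \<Rightarrow> 0)"

definition dsum :: "int set \<Rightarrow> (int \<Rightarrow> 'k::field hmod) \<Rightarrow> 'k hmod" where
  "dsum I M = \<lparr>carr = {glue u |u. (\<forall>r\<in>I. u r \<in> carr (M r)) \<and> (\<forall>r. r \<notin> I \<longrightarrow> u r = 0) \<and> finite {r. u r \<noteq> 0}},
     act = (\<lambda>h v. glue (\<lambda>r. if r \<in> I then act (M r) h (cmp r v) else 0))\<rparr>"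

record 'k cpx =
  ob :: "int \<Rightarrow> 'k hmod"
  diff :: "int \<Rightarrow> 'k fvec \<Rightarrow> 'k fvec"

text \<open>Bounded complexes of finitely generated left \<open>H\<close>-modules.\<close>

definition bcomplex :: "nat \<Rightarrow> 'k::field cpx \<Rightarrow> bool" where
  "bcomplex n X \<longleftrightarrow>
     (\<forall>m. hmodule n (ob X m) \<and> fin_gen n (ob X m)) \<and>
     (\<forall>m. hmod_hom n (ob X m) (ob X (m + 1)) (diff X m)) \<and>
     (\<forall>m. \<forall>v\<in>carr (ob X m). diff X (m + 1) (diff X m v) = 0) \<and>
     (\<exists>l u. \<forall>m. m < l \<or> u < m \<longrightarrow> carr (ob X m) = {0})"

definition chain_map :: "nat \<Rightarrow> 'k::field cpx \<Rightarrow> 'k cpx \<Rightarrow> (int \<Rightarrow> 'k fvec \<Rightarrow> 'k fvec) \<Rightarrow> bool" where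
  "chain_map n X Y f \<longleftrightarrow> (\<forall>m. hmod_hom n (ob X m) (ob Y m) (f m)) \<and>
     (\<forall>m. \<forall>v\<in>carr (ob X m). f (m + 1) (diff X m v) = diff Y m (f m v))"

definition cocycles :: "'k::field cpx \<Rightarrow> int \<Rightarrow> 'k fvec set" where
  "cocycles X m = {v \<in> carr (ob X m). diff X m v = 0}"

definition coboundaries :: "'k::field cpx \<Rightarrow> int \<Rightarrow> 'k fvec set" where
  "coboundaries X m = diff X (m - 1) ` carr (ob X (m - 1))"

definition coh_rel :: "'k::field cpx \<Rightarrow> int \<Rightarrow> ('k fvec \<times> 'k fvec) set" where
  "coh_rel X m = {(u, v). u \<in> cocycles X m \<and> v \<in> cocycles X m \<and> u - v \<in> coboundaries X m}"

definition cohomology :: "'k::field cpx \<Rightarrow> int \<Rightarrow> 'k fvec set set" where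
  "cohomology X m = cocycles X m // coh_rel X m"

definition coh_map :: "'k::field cpx \<Rightarrow> (int \<Rightarrow> 'k fvec \<Rightarrow> 'k fvec) \<Rightarrow> int \<Rightarrow> 'k fvec set \<Rightarrow> 'k fvec set" where
  "coh_map Y f m C = (\<Union>v\<in>C. coh_rel Y m `` {f m v})"

definition quasi_iso :: "nat \<Rightarrow> 'k::field cpx \<Rightarrow> 'k cpx \<Rightarrow> (int \<Rightarrow> 'k fvec \<Rightarrow> 'k fvec) \<Rightarrow> bool" where
  "quasi_iso n X Y f \<longleftrightarrow> chain_map n X Y f \<and>
     (\<forall>m. bij_betw (coh_map Y f m) (cohomology X m) (cohomology Y m))"

definition shift :: "int \<Rightarrow> 'k::field cpx \<Rightarrow> 'k cpx" where
  "shift p X = \<lparr>ob = (\<lambda>m. ob X (m + p)), diff = (\<lambda>m v. scl ((- 1) powi p) (diff X (m + p) v))\<rparr>"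

text \<open>
  In degree \<open>m\<close> the summand of index \<open>r\<close> is \<open>X\<^sup>r \<otimes> Y\<^sup>m\<^sup>-\<^sup>r\<close>. The component of \<open>d z\<close> in
  \<open>X\<^sup>r \<otimes> Y\<^sup>m\<^sup>+\<^sup>1\<^sup>-\<^sup>r\<close> comes from the components of \<open>z\<close> of index \<open>r - 1\<close> and \<open>r\<close>.
\<close>

definition ten :: "nat \<Rightarrow> 'k::field \<Rightarrow> 'k cpx \<Rightarrow> 'k cpx \<Rightarrow> 'k cpx" where
  "ten n \<mu> X Y = \<lparr>ob = (\<lambda>m. dsum UNIV (\<lambda>r. ten_mod n \<mu> (ob X r) (ob Y (m - r)))),
     diff = (\<lambda>m z. glue (\<lambda>r. tmap (diff X (r - 1)) id (cmp (r - 1) z)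
                           + scl ((- 1) powi r) (tmap id (diff Y (m - r)) (cmp r z))))\<rparr>"

definition oplus :: "'k::field cpx \<Rightarrow> 'k cpx \<Rightarrow> 'k cpx" where
  "oplus X Y = \<lparr>ob = (\<lambda>m. dsum {0, 1} (\<lambda>r. ob (if r = 0 then X else Y) m)),
     diff = (\<lambda>m z. glue (\<lambda>r. if r = 0 then diff X m (cmp 0 z)
                             else if r = 1 then diff Y m (cmp 1 z) else 0))\<rparr>"


section \<open>The bounded derived category\<close>

text \<open>
  The bounded derived category is the localization of the category of bounded complexes of finitely
  generated modules at the quasi-isomorphisms. A morphism in the localization is represented
  by a word, a composable sequence of chain maps and formal inverses of quasi-isomorphisms, read
  from left to right: \<^term>\<open>Mor X Y f\<close> is a letter from \<open>X\<close> to \<open>Y\<close>, and \<^term>\<open>Inv X Y s\<close>, the formal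
  inverse of \<open>s : X \<rightarrow> Y\<close>, is a letter from \<open>Y\<close> to \<open>X\<close>. Two words represent the same morphism iff
  they are related by \<open>loc_eq\<close>; composition is concatenation.
\<close>

datatype 'k letter =
    Mor "'k cpx" "'k cpx" "int \<Rightarrow> 'k fvec \<Rightarrow> 'k fvec"
  | Inv "'k cpx" "'k cpx" "int \<Rightarrow> 'k fvec \<Rightarrow> 'k fvec"

inductive word :: "nat \<Rightarrow> 'k::field cpx \<Rightarrow> 'k letter list \<Rightarrow> 'k cpx \<Rightarrow> bool" for n where
  word_nil: "bcomplex n X \<Longrightarrow> word n X [] X"
| word_mor: "bcomplex n X \<Longrightarrow> chain_map n X Y f \<Longrightarrow> word n Y w Z \<Longrightarrow> word n X (Mor X Y f # w) Z"
| word_inv: "bcomplex n Y \<Longrightarrow> quasi_iso n X Y s \<Longrightarrow> word n X w Z \<Longrightarrow> word n Y (Inv X Y s # w) Z"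

inductive loc_eq :: "nat \<Rightarrow> 'k::field cpx \<Rightarrow> 'k cpx \<Rightarrow> 'k letter list \<Rightarrow> 'k letter list \<Rightarrow> bool" for n where
  loc_refl: "word n X w Y \<Longrightarrow> loc_eq n X Y w w"
| loc_sym: "loc_eq n X Y w w' \<Longrightarrow> loc_eq n X Y w' w"
| loc_trans: "loc_eq n X Y w w' \<Longrightarrow> loc_eq n X Y w' w'' \<Longrightarrow> loc_eq n X Y w w''"
| loc_cong: "word n X u X' \<Longrightarrow> loc_eq n X' Y' w w' \<Longrightarrow> word n Y' v Y \<Longrightarrow>
    loc_eq n X Y (u @ w @ v) (u @ w' @ v)"
| loc_id: "bcomplex n X \<Longrightarrow> \<forall>m. \<forall>v\<in>carr (ob X m). f m v = v \<Longrightarrow> chain_map n X X f \<Longrightarrow>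
    loc_eq n X X [Mor X X f] []"
| loc_comp: "bcomplex n X \<Longrightarrow> bcomplex n Y \<Longrightarrow> bcomplex n Z \<Longrightarrow>
    chain_map n X Y f \<Longrightarrow> chain_map n Y Z g \<Longrightarrow> chain_map n X Z h \<Longrightarrow>
    \<forall>m. \<forall>v\<in>carr (ob X m). h m v = g m (f m v) \<Longrightarrow>
    loc_eq n X Z [Mor X Y f, Mor Y Z g] [Mor X Z h]"
| loc_inv_right: "bcomplex n X \<Longrightarrow> bcomplex n Y \<Longrightarrow> quasi_iso n X Y s \<Longrightarrow>
    loc_eq n X X [Mor X Y s, Inv X Y s] []"
| loc_inv_left: "bcomplex n X \<Longrightarrow> bcomplex n Y \<Longrightarrow> quasi_iso n X Y s \<Longrightarrow>
    loc_eq n Y Y [Inv X Y s, Mor X Y s] []"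

text \<open>Isomorphism of two objects: existence of mutually inverse morphisms.\<close>

definition Db_iso :: "nat \<Rightarrow> 'k::field cpx \<Rightarrow> 'k cpx \<Rightarrow> bool" where
  "Db_iso n X Y \<longleftrightarrow> (\<exists>u v. word n X u Y \<and> word n Y v X \<and>
     loc_eq n X X (u @ v) [] \<and> loc_eq n Y Y (v @ u) [])"


section \<open>The complexes \<open>M\<^sub>i\<^sub>,\<^sub>l\<close> and \<open>N\<^sub>i\<close>\<close>

definition Pmod :: "nat \<Rightarrow> int \<Rightarrow> 'k::field hmod" where
  "Pmod n i = \<lparr>carr = {mulH n h (idem n i) |h. h \<in> Hset n}, act = mulH n\<rparr>"

text \<open>The map \<open>u \<mapsto> u a\<^sub>i\<close> from \<open>P\<^sub>i\<^sub>+\<^sub>1\<close> to \<open>P\<^sub>i\<close>, and its kernel.\<close>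

definition amap :: "nat \<Rightarrow> int \<Rightarrow> 'k::field fvec \<Rightarrow> 'k fvec" where
  "amap n i u = mulH n u (arrow n i)"

definition kera :: "nat \<Rightarrow> int \<Rightarrow> 'k::field hmod" where
  "kera n i = \<lparr>carr = {u \<in> carr (Pmod n (i + 1)). amap n i u = 0}, act = mulH n\<rparr>"

text \<open>The term in degree \<open>m\<close> of \<open>M\<^sub>i\<^sub>,\<^sub>l\<close>, where \<open>l \<le> i\<close>, is \<open>P\<^sub>i\<^sub>-\<^sub>m\<close> for \<open>0 \<le> m \<le> i - l\<close>.\<close>

definition Mcpx :: "nat \<Rightarrow> int \<Rightarrow> int \<Rightarrow> 'k::field cpx" where
  "Mcpx n i l = \<lparr>ob = (\<lambda>m. if 0 \<le> m \<and> m \<le> i - l then Pmod n (i - m) else zero_mod),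
     diff = (\<lambda>m. if 0 \<le> m \<and> m < i - l then amap n (i - m - 1) else (\<lambda>u. 0))\<rparr>"

definition Ncpx :: "nat \<Rightarrow> int \<Rightarrow> 'k::field cpx" where
  "Ncpx n i = \<lparr>ob = (\<lambda>m. if m = 0 then kera n i else if m = 1 then Pmod n (i + 1)
                         else if m = 2 then Pmod n i else zero_mod),
     diff = (\<lambda>m. if m = 0 then (\<lambda>u. u) else if m = 1 then amap n i else (\<lambda>u. 0))\<rparr>"

end

theory Submission
  imports Defs
begin

text \<open>
  An \<open>H\<close>-module is a \<open>\<int>/n\<close>-graded space with an operator \<open>a\<close> of degree \<open>1\<close> and square \<open>0\<close>. Conjugation by
  \<open>1 + \<mu> D\<close>, where \<open>D (v \<otimes> w) = \<plusminus> a v \<otimes> a w\<close>, identifies the tensor product with the one for \<open>\<mu> = 0\<close>, which is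
  that of graded complexes; hence it is symmetric up to signs. The complex \<open>N\<^sub>j\<close> is a resolution of the simple
  module \<open>S\<^sub>j\<close> placed in degree \<open>2\<close>, and tensoring with \<open>S\<^sub>j\<close> only shifts the grading, which gives (1) and (2).
  For (3) let \<open>t \<le> k\<close> by symmetry, and let \<open>e\<^sub>m, a\<^sub>m\<close> be the basis of the degree \<open>m\<close> term of \<open>M = M\<^sub>i\<^sub>,\<^sub>i\<^sub>-\<^sub>k\<close>.
  The differential maps \<open>e\<^sub>m\<close> to \<open>a\<^sub>m\<^sub>+\<^sub>1\<close>, so up to homotopy \<open>M \<otimes> M'\<close> is an extension of \<open>e\<^sub>k \<otimes> M'\<close> by
  \<open>a\<^sub>0 \<otimes> M'\<close>, and it splits.
\<close>

section \<open>Coordinate subspaces\<close>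

text \<open>The relation \<open>x^2 = \<mu>(1 - g^2)\<close> makes e_c act on a tensor product by
  more than the projection to weight c: it adds \<open>\<mu>\<close> times the commutator of that
  projection with D, which raises the weight by 2. Conjugation by 1 + \<open>\<mu>\<close> D removes
  exactly this term, because D squares to zero and its composites with a vanish on both sides. What
  remains of the twisting is signs, caused by \<open>x g = - g x\<close>. As n is even, a weight
  modulo n has a parity, and weights can be lifted to integers that simply add up.

  The projection of N_j onto S_j is H-linear, but its section through e_j is not, because a e_j is
  nonzero; the same happens in (3). The comparison maps there are therefore quasi-isomorphisms, each
  checked with an H-linear chain map in one direction and a merely linear one in the other.

  The indices and shifts in (3) are those of the two cohomology classes of M: a_0 has weight i + 1
  and degree 0, e_k has weight i - k and degree k.\<close>

definition sp :: "lab set \<Rightarrow> 'k::field fvec set" where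
  "sp S = {v. \<forall>l. l \<notin> S \<longrightarrow> v l = 0}"

lemma sp_subspace: "fvec.subspace (sp S)"
  by (auto simp: fvec.subspace_def sp_def scl_def)

lemma bv_sp: "b \<in> S \<Longrightarrow> bv b \<in> sp S"
  by (auto simp: sp_def bv_def)

lemma sp_expand:
  assumes "finite S" "v \<in> sp S"
  shows "v = (\<Sum>b\<in>S. scl (v b) (bv b))"
proof
  fix l
  have "(\<Sum>b\<in>S. scl (v b) (bv b)) l = (\<Sum>b\<in>S. if l = b then v b else 0)"
    unfolding sum_fun_apply by (rule sum.cong) (auto simp: scl_def bv_def)
  also have "\<dots> = v l"
    using assms by (auto simp: sp_def)
  finally show "v l = (\<Sum>b\<in>S. scl (v b) (bv b)) l" by simp
qed

text \<open>Every module that occurs has a basis of labels. For such modules the span of the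
  elementary tensors is again a coordinate subspace, so everything about tensor products can be
  checked entrywise at the labels \<open>Pr a b\<close>.\<close>

lemma tspace_sp:
  assumes "finite S" "finite S'"
  shows "tspace (sp S) (sp S') = (sp {Pr a b |a b. a \<in> S \<and> b \<in> S'} :: 'k::field fvec set)"
proof
  show "tspace (sp S) (sp S') \<subseteq> (sp {Pr a b |a b. a \<in> S \<and> b \<in> S'} :: 'k fvec set)"
    unfolding tspace_def
    by (rule fvec.span_minimal[OF _ sp_subspace])
      (force simp: sp_def pten_def split: lab.splits)
next
  let ?P = "{Pr a b |a b. a \<in> S \<and> b \<in> S'}"
  have fin: "finite ?P"
    using assms by (intro finite_image_set2) auto
  show "(sp ?P :: 'k fvec set) \<subseteq> tspace (sp S) (sp S')"
  proof
    fix z :: "'k fvec"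
    assume z: "z \<in> sp ?P"
    have "bv l \<in> (tspace (sp S) (sp S') :: 'k fvec set)" if lP: "l \<in> ?P" for l
    proof -
      obtain a b where l: "l = Pr a b" "a \<in> S" "b \<in> S'" using lP by blast
      have "bv l = pten (bv a) (bv b :: 'k fvec)"
        by (auto simp: l bv_def pten_def fun_eq_iff split: lab.splits)
      then show ?thesis
        using bv_sp[OF l(2)] bv_sp[OF l(3)] unfolding tspace_def
        by (auto intro!: fvec.span_base)
    qed
    then have "(\<Sum>b\<in>?P. scl (z b) (bv b)) \<in> tspace (sp S) (sp S')"
      unfolding tspace_def by (intro fvec.span_sum fvec.span_scale) auto
    then show "z \<in> tspace (sp S) (sp S')"
      using sp_expand[OF fin z] by simp
  qed
qed

section \<open>Isomorphisms in the derived category\<close>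

lemma word_append: "word n X u Y \<Longrightarrow> word n Y v Z \<Longrightarrow> word n X (u @ v) Z"
  by (induction rule: word.induct) (auto intro: word.intros)

lemma Db_iso_sym: "Db_iso n X Y \<Longrightarrow> Db_iso n Y X"
  unfolding Db_iso_def by blast

lemma Db_iso_trans:
  assumes "Db_iso n X Y" "Db_iso n Y Z"
  shows "Db_iso n X Z"
proof -
  \<comment> \<open>The inner pair of mutually inverse words cancels first, by congruence. Stated
    for arbitrary words, this gives both composites.\<close>
  have key: "loc_eq n A A ((u @ u') @ (v' @ v)) []"
    if "word n A u B" "word n B v A" "loc_eq n A A (u @ v) []" "loc_eq n B B (u' @ v') []"
    for A B u u' v v'
    using loc_trans[OF loc_cong[OF that(1) that(4) that(2)]] that(3) by simp
  obtain u v where u: "word n X u Y" "word n Y v X"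
      "loc_eq n X X (u @ v) []" "loc_eq n Y Y (v @ u) []"
    using assms(1) unfolding Db_iso_def by blast
  obtain u' v' where v: "word n Y u' Z" "word n Z v' Y"
      "loc_eq n Y Y (u' @ v') []" "loc_eq n Z Z (v' @ u') []"
    using assms(2) unfolding Db_iso_def by blast
  have "word n X (u @ u') Z" "word n Z (v' @ v) X"
    using u v by (auto intro: word_append)
  then show ?thesis
    unfolding Db_iso_def
    using key[OF u(1,2,3) v(3)] key[OF v(2,1,4) u(4)] by blast
qed

lemma quasi_iso_Db_iso:
  assumes "bcomplex n X" "bcomplex n Y" "quasi_iso n X Y f"
  shows "Db_iso n X Y"
proof -
  have "word n X [Mor X Y f] Y" "word n Y [Inv X Y f] X"
    using assms by (auto intro!: word.intros simp: quasi_iso_def)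
  then show ?thesis
    unfolding Db_iso_def
    using loc_inv_right[OF assms] loc_inv_left[OF assms] by fastforce
qed

section \<open>Cohomology and a criterion for quasi-isomorphisms\<close>

lemma bcomplex_carr_closed:
  assumes "bcomplex n X"
  shows "0 \<in> carr (ob X m)"
    and "v \<in> carr (ob X m) \<Longrightarrow> w \<in> carr (ob X m) \<Longrightarrow> v + w \<in> carr (ob X m)"
    and "v \<in> carr (ob X m) \<Longrightarrow> w \<in> carr (ob X m) \<Longrightarrow> v - w \<in> carr (ob X m)"
proof -
  have V: "fvec.subspace (carr (ob X m))"
    using assms unfolding bcomplex_def hmodule_def by blast
  show "0 \<in> carr (ob X m)"
    and "v \<in> carr (ob X m) \<Longrightarrow> w \<in> carr (ob X m) \<Longrightarrow> v + w \<in> carr (ob X m)"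
    and "v \<in> carr (ob X m) \<Longrightarrow> w \<in> carr (ob X m) \<Longrightarrow> v - w \<in> carr (ob X m)"
    by (fact fvec.subspace_0[OF V] fvec.subspace_add[OF V] fvec.subspace_diff[OF V])+
qed

lemma additive_on_diff:
  fixes f :: "'k::field fvec \<Rightarrow> 'k fvec"
  assumes V: "fvec.subspace V" and f: "\<forall>v\<in>V. \<forall>w\<in>V. f (v + w) = f v + f w"
  shows "f 0 = 0" and "v \<in> V \<Longrightarrow> w \<in> V \<Longrightarrow> f (v - w) = f v - f w"
proof -
  have "0 \<in> V" using V by (rule fvec.subspace_0)
  with f have "f (0 + 0) = f 0 + f 0" by blast
  then show "f 0 = 0" by simp
  assume "v \<in> V" "w \<in> V"
  then have "v - w \<in> V" using V by (intro fvec.subspace_diff)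
  with f \<open>w \<in> V\<close> have "f (v - w + w) = f (v - w) + f w" by blast
  then show "f (v - w) = f v - f w" by (simp add: algebra_simps)
qed

lemma diff_additive:
  assumes "bcomplex n X"
  shows "diff X m 0 = 0"
    and "v \<in> carr (ob X m) \<Longrightarrow> w \<in> carr (ob X m) \<Longrightarrow> diff X m (v + w) = diff X m v + diff X m w"
    and "v \<in> carr (ob X m) \<Longrightarrow> w \<in> carr (ob X m) \<Longrightarrow> diff X m (v - w) = diff X m v - diff X m w"
proof -
  have V: "fvec.subspace (carr (ob X m))"
    using assms unfolding bcomplex_def hmodule_def by blast
  have f: "\<forall>v\<in>carr (ob X m). \<forall>w\<in>carr (ob X m). diff X m (v + w) = diff X m v + diff X m w"
    using assms unfolding bcomplex_def hmod_hom_def by blast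
  show "v \<in> carr (ob X m) \<Longrightarrow> w \<in> carr (ob X m) \<Longrightarrow> diff X m (v + w) = diff X m v + diff X m w"
    using f by blast
  show "diff X m 0 = 0"
    and "v \<in> carr (ob X m) \<Longrightarrow> w \<in> carr (ob X m) \<Longrightarrow> diff X m (v - w) = diff X m v - diff X m w"
    using additive_on_diff[OF V f] by blast+
qed

lemma coboundaries_closed:
  assumes "bcomplex n X"
  shows "0 \<in> coboundaries X m"
    and "u \<in> coboundaries X m \<Longrightarrow> v \<in> coboundaries X m \<Longrightarrow> u + v \<in> coboundaries X m"
    and "u \<in> coboundaries X m \<Longrightarrow> v \<in> coboundaries X m \<Longrightarrow> u - v \<in> coboundaries X m"
proof -
  note c = bcomplex_carr_closed[OF assms, where m = "m - 1"] and d = diff_additive[OF assms, where m = "m - 1"]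
  show "0 \<in> coboundaries X m"
    unfolding coboundaries_def using c(1) imageI[OF c(1), of "diff X (m - 1)"] unfolding d(1) by simp
  assume "u \<in> coboundaries X m" "v \<in> coboundaries X m"
  then obtain u' v' where u: "u = diff X (m - 1) u'" "u' \<in> carr (ob X (m - 1))"
    and v: "v = diff X (m - 1) v'" "v' \<in> carr (ob X (m - 1))"
    unfolding coboundaries_def by blast
  show "u + v \<in> coboundaries X m"
    unfolding coboundaries_def u(1) v(1) d(2)[OF u(2) v(2), symmetric]
    by (rule imageI) (rule c(2)[OF u(2) v(2)])
  show "u - v \<in> coboundaries X m"
    unfolding coboundaries_def u(1) v(1) d(3)[OF u(2) v(2), symmetric]
    by (rule imageI) (rule c(3)[OF u(2) v(2)])
qed

lemma coh_rel_equiv: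
  assumes "bcomplex n X"
  shows "equiv (cocycles X m) (coh_rel X m)"
proof (rule equivI)
  note b = coboundaries_closed[OF assms]
  show "coh_rel X m \<subseteq> cocycles X m \<times> cocycles X m"
    by (auto simp: coh_rel_def)
  show "refl_on (cocycles X m) (coh_rel X m)"
    using b(1) by (auto simp: coh_rel_def refl_on_def)
  show "sym (coh_rel X m)"
  proof (rule symI)
    fix u v assume "(u, v) \<in> coh_rel X m"
    then show "(v, u) \<in> coh_rel X m"
      using b(3)[OF b(1), of "u - v"] by (simp add: coh_rel_def)
  qed
  show "trans (coh_rel X m)"
  proof (rule transI)
    fix u v w assume "(u, v) \<in> coh_rel X m" "(v, w) \<in> coh_rel X m"
    then show "(u, w) \<in> coh_rel X m"
      using b(2)[of "u - v" _ "v - w"] by (simp add: coh_rel_def)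
  qed
qed

text \<open>The comparison map \<open>g\<close> need not be \<open>H\<close>-linear.\<close>

lemma quasi_isoI:
  assumes X: "bcomplex n X" and Y: "bcomplex n Y" and f: "chain_map n X Y f"
    and g: "\<And>m v. v \<in> carr (ob Y m) \<Longrightarrow> g m v \<in> carr (ob X m)"
    and g0: "\<And>m. g m 0 = 0"
    and gd: "\<And>m v. v \<in> carr (ob Y m) \<Longrightarrow> g (m + 1) (diff Y m v) = diff X m (g m v)"
    and gf: "\<And>m v. v \<in> cocycles X m \<Longrightarrow> v - g m (f m v) \<in> coboundaries X m"
    and fg: "\<And>m v. v \<in> cocycles Y m \<Longrightarrow> v - f m (g m v) \<in> coboundaries Y m"
  shows "quasi_iso n X Y f"
  unfolding quasi_iso_def
proof (intro conjI allI f)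
  fix m
  note EX = coh_rel_equiv[OF X, of m] and EY = coh_rel_equiv[OF Y, of m]
  have fc: "f m v \<in> carr (ob Y m)" if "v \<in> carr (ob X m)" for m v
    using f that unfolding chain_map_def hmod_hom_def by blast
  have fadd: "\<forall>v\<in>carr (ob X m). \<forall>w\<in>carr (ob X m). f m (v + w) = f m v + f m w" for m
    using f unfolding chain_map_def hmod_hom_def by blast
  have fd: "f (m + 1) (diff X m v) = diff Y m (f m v)" if "v \<in> carr (ob X m)" for m v
    using f that unfolding chain_map_def by blast
  have V: "fvec.subspace (carr (ob X m))" for m
    using X unfolding bcomplex_def hmodule_def by blast
  note f0 = additive_on_diff(1)[OF V fadd] and fdiff = additive_on_diff(2)[OF V fadd]
  have f_coc: "f m v \<in> cocycles Y m" if "v \<in> cocycles X m" for v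
    using that fc[of v m] fd[of v m] f0 unfolding cocycles_def by simp
  have g_coc: "g m v \<in> cocycles X m" if "v \<in> cocycles Y m" for v
    using that g[of v m] gd[of v m] g0[of "m + 1"] unfolding cocycles_def by simp
  have f_cob: "f m v \<in> coboundaries Y m" if v: "v \<in> coboundaries X m" for v
  proof -
    obtain w where w: "v = diff X (m - 1) w" "w \<in> carr (ob X (m - 1))"
      using v unfolding coboundaries_def by blast
    then show ?thesis
      using fd[OF w(2)] fc[OF w(2)] unfolding coboundaries_def by simp
  qed
  have g_cob: "g m v \<in> coboundaries X m" if v: "v \<in> coboundaries Y m" for v
  proof -
    obtain w where w: "v = diff Y (m - 1) w" "w \<in> carr (ob Y (m - 1))"
      using v unfolding coboundaries_def by blast
    then show ?thesis
      using gd[OF w(2)] g[OF w(2)] unfolding coboundaries_def by simp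
  qed
  \<comment> \<open>\<open>g\<close> is applied to the single element \<open>f m (u - v)\<close>: if
    that is a coboundary, so is its image under \<open>g\<close>, which differs from u - v by a
    coboundary.\<close>
  have rel: "(f m u, f m v) \<in> coh_rel Y m \<longleftrightarrow> (u, v) \<in> coh_rel X m"
    if u: "u \<in> cocycles X m" and v: "v \<in> cocycles X m" for u v
  proof -
    have uv: "u \<in> carr (ob X m)" "v \<in> carr (ob X m)"
      using u v by (auto simp: cocycles_def)
    have uvc: "u - v \<in> cocycles X m"
      using u v diff_additive(3)[OF X uv] bcomplex_carr_closed(3)[OF X uv]
      by (simp add: cocycles_def)
    have "u - v \<in> coboundaries X m" if "f m (u - v) \<in> coboundaries Y m"
      using coboundaries_closed(2)[OF X gf[OF uvc] g_cob[OF that]] by simp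
    then show ?thesis
      using f_cob[of "u - v"] fdiff[OF uv] f_coc[OF u] f_coc[OF v] u v
      unfolding coh_rel_def by auto
  qed
  have cls: "coh_map Y f m (coh_rel X m `` {u}) = coh_rel Y m `` {f m u}"
    if u: "u \<in> cocycles X m" for u
  proof -
    have "coh_rel Y m `` {f m v} = coh_rel Y m `` {f m u}" if "v \<in> coh_rel X m `` {u}" for v
    proof -
      have uv: "(u, v) \<in> coh_rel X m" "v \<in> cocycles X m"
        using that by (auto simp: coh_rel_def)
      then have "(f m u, f m v) \<in> coh_rel Y m"
        using rel[OF u] by blast
      then show ?thesis
        using equiv_class_eq[OF EY] by blast
    qed
    moreover have "u \<in> coh_rel X m `` {u}"
      using equiv_class_self[OF EX u] .
    ultimately show ?thesis
      unfolding coh_map_def by blast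
  qed
  show "bij_betw (coh_map Y f m) (cohomology X m) (cohomology Y m)"
    unfolding bij_betw_def
  proof
    show "inj_on (coh_map Y f m) (cohomology X m)"
    proof (rule inj_onI)
      fix C D assume CD: "C \<in> cohomology X m" "D \<in> cohomology X m"
        and eq: "coh_map Y f m C = coh_map Y f m D"
      obtain u v where u: "u \<in> cocycles X m" "C = coh_rel X m `` {u}"
        and v: "v \<in> cocycles X m" "D = coh_rel X m `` {v}"
        using CD unfolding cohomology_def quotient_def by blast
      have "coh_rel Y m `` {f m u} = coh_rel Y m `` {f m v}"
        using eq u v cls by simp
      then have "(f m u, f m v) \<in> coh_rel Y m"
        using eq_equiv_class[OF _ EY f_coc[OF v(1)]] by blast
      then have "(u, v) \<in> coh_rel X m"
        using rel u v by blast
      then show "C = D"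
        using equiv_class_eq[OF EX] u v by blast
    qed
    show "coh_map Y f m ` cohomology X m = cohomology Y m"
    proof
      show "coh_map Y f m ` cohomology X m \<subseteq> cohomology Y m"
      proof
        fix C assume "C \<in> coh_map Y f m ` cohomology X m"
        then obtain u where u: "u \<in> cocycles X m" "C = coh_map Y f m (coh_rel X m `` {u})"
          unfolding cohomology_def quotient_def by blast
        then show "C \<in> cohomology Y m"
          unfolding cohomology_def using cls[OF u(1)] f_coc[OF u(1)] by (auto intro: quotientI)
      qed
      show "cohomology Y m \<subseteq> coh_map Y f m ` cohomology X m"
      proof
        fix D assume "D \<in> cohomology Y m"
        then obtain v where v: "v \<in> cocycles Y m" "D = coh_rel Y m `` {v}"
          unfolding cohomology_def quotient_def by blast
        have "(v, f m (g m v)) \<in> coh_rel Y m"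
          using fg[OF v(1)] f_coc[OF g_coc[OF v(1)]] v(1) unfolding coh_rel_def by blast
        then have "D = coh_map Y f m (coh_rel X m `` {g m v})"
          using equiv_class_eq[OF EY] v cls[OF g_coc[OF v(1)]] by simp
        moreover have "coh_rel X m `` {g m v} \<in> cohomology X m"
          unfolding cohomology_def using g_coc[OF v(1)] by (rule quotientI)
        ultimately show "D \<in> coh_map Y f m ` cohomology X m" by blast
      qed
    qed
  qed
qed

section \<open>Complexes as graded spaces with two operators\<close>

definition sg :: "int \<Rightarrow> 'k::field" where
  "sg z = (if even z then 1 else - 1)"

lemma powi_minus_one: "(- 1 :: 'k::field) powi z = sg z"
  by (auto simp: power_int_def sg_def minus_one_power_iff even_nat_iff)

text \<open>
  A finite-dimensional complex of \<open>H\<close>-modules as one vector space with a cohomological degree \<open>bcd\<close>,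
  an integral weight \<open>bwd\<close>, the operator \<open>ba\<close> of the sum of the arrows and the differential \<open>bd\<close>;
  \<open>e\<^sub>i\<close> acts as the projection to the weights congruent to \<open>i\<close> modulo \<open>n\<close>.
\<close>

record 'k bic =
  bB :: "lab set"
  bcd :: "lab \<Rightarrow> int"
  bwd :: "lab \<Rightarrow> int"
  ba :: "'k fvec \<Rightarrow> 'k fvec"
  bd :: "'k fvec \<Rightarrow> 'k fvec"

definition gr :: "'k::field bic \<Rightarrow> int \<Rightarrow> 'k fvec set" where
  "gr X m = sp {l \<in> bB X. bcd X l = m}"

text \<open>Homogeneity of \<open>ba\<close> and \<open>bd\<close> is stated as commutation with
  multiplication by an arbitrary function c of the weight, the argument being shifted by one for
  \<open>ba\<close>. With c read off from the coordinates of an element of H, this is directly the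
  compatibility with \<open>bact\<close>.\<close>

definition wf_bic :: "'k::field bic \<Rightarrow> bool" where
  "wf_bic X \<longleftrightarrow> finite (bB X) \<and>
     (\<forall>v w. ba X (v + w) = ba X v + ba X w) \<and> (\<forall>c v. ba X (scl c v) = scl c (ba X v)) \<and>
     (\<forall>v w. bd X (v + w) = bd X v + bd X w) \<and> (\<forall>c v. bd X (scl c v) = scl c (bd X v)) \<and>
     (\<forall>m. \<forall>v\<in>gr X m. ba X v \<in> gr X m \<and> bd X v \<in> gr X (m + 1)) \<and>
     (\<forall>c v. ba X (\<lambda>l. c (bwd X l) * v l) = (\<lambda>l. c (bwd X l - 1) * ba X v l)) \<and>
     (\<forall>c v. bd X (\<lambda>l. c (bwd X l) * v l) = (\<lambda>l. c (bwd X l) * bd X v l)) \<and>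
     (\<forall>v. ba X (ba X v) = 0) \<and> (\<forall>v. bd X (bd X v) = 0) \<and>
     (\<forall>v. ba X (bd X v) = bd X (ba X v))"

text \<open>An element h is expanded in the dual basis: an entry of weight w is reached by e_w and
  by the arrow a_(w-1), which ends at w.\<close>

definition bact :: "nat \<Rightarrow> 'k::field bic \<Rightarrow> 'k fvec \<Rightarrow> 'k fvec \<Rightarrow> 'k fvec" where
  "bact n X h v = (\<lambda>l. h (Gx (bwd X l mod int n) 0) * v l + h (Gx ((bwd X l - 1) mod int n) 1) * ba X v l)"

definition realize :: "nat \<Rightarrow> 'k::field bic \<Rightarrow> 'k cpx" where
  "realize n X = \<lparr>ob = (\<lambda>m. \<lparr>carr = gr X m, act = bact n X\<rparr>), diff = (\<lambda>m. bd X)\<rparr>"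

section \<open>Realization of graded spaces as complexes of \<open>H\<close>-modules\<close>

lemma sum_basis_pick:
  assumes "b0 \<in> basis n" "\<And>b. b \<in> basis n \<Longrightarrow> b \<noteq> b0 \<Longrightarrow> f b = 0"
  shows "(\<Sum>b\<in>basis n. f b) = (f b0 :: 'b::comm_monoid_add)"
  using assms by (subst sum.remove[of _ b0]) auto

text \<open>The entry at g^c is dual to the grouplike coproduct of g^c, the entry at g^c x to the
  two-term coproduct of g^c x, and the double sum in \<open>mulH\<close> collapses accordingly. The
  position is written \<open>c mod int n\<close> so that integral weights can be inserted for
  c.\<close>

lemma mulH_coord:
  assumes n: "n > 0"
  shows "mulH n h v (Gx (c mod int n) 0) = h (Gx (c mod int n) 0) * v (Gx (c mod int n) 0)"
    and "mulH n h v (Gx (c mod int n) 1) =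
      h (Gx (c mod int n) 1) * v (Gx (c mod int n) 0) + h (Gx ((c + 1) mod int n) 0) * v (Gx (c mod int n) 1)"
    and "l \<notin> basis n \<Longrightarrow> mulH n h v l = 0"
proof -
  have m: "0 \<le> z mod int n" "z mod int n < int n" for z
    using n by auto
  have bas: "Gx (z mod int n) 0 \<in> basis n" "Gx (z mod int n) 1 \<in> basis n" for z
    using m by auto
  let ?c = "c mod int n"
  have "mulH n h v (Gx ?c 0) = (\<Sum>b\<in>basis n. \<Sum>b'\<in>basis n. h b * v b' * comulb n (Gx ?c 0) (Pr b b'))"
    using m by (simp add: mulH_def)
  also have "\<dots> = (\<Sum>b'\<in>basis n. h (Gx ?c 0) * v b' * comulb n (Gx ?c 0) (Pr (Gx ?c 0) b'))"
    by (rule sum_basis_pick[OF bas(1)]) (auto simp: pten_def bv_def)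
  also have "\<dots> = h (Gx ?c 0) * v (Gx ?c 0) * comulb n (Gx ?c 0) (Pr (Gx ?c 0) (Gx ?c 0))"
    by (rule sum_basis_pick[OF bas(1)]) (auto simp: pten_def bv_def)
  finally show "mulH n h v (Gx ?c 0) = h (Gx ?c 0) * v (Gx ?c 0)"
    by (simp add: pten_def bv_def)
  have pair: "(\<Sum>b\<in>basis n. \<Sum>b'\<in>basis n. h b * v b' * pten (bv l1) (bv l2) (Pr b b')) = h l1 * v l2"
    if l: "l1 \<in> basis n" "l2 \<in> basis n" for l1 l2
  proof -
    have "(\<Sum>b\<in>basis n. \<Sum>b'\<in>basis n. h b * v b' * pten (bv l1) (bv l2) (Pr b b')) =
      (\<Sum>b'\<in>basis n. h l1 * v b' * pten (bv l1) (bv l2) (Pr l1 b'))"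
      by (rule sum_basis_pick[OF l(1)]) (auto simp: pten_def bv_def)
    also have "\<dots> = h l1 * v l2 * pten (bv l1) (bv l2) (Pr l1 l2)"
      by (rule sum_basis_pick[OF l(2)]) (auto simp: pten_def bv_def)
    finally show ?thesis by (simp add: pten_def bv_def)
  qed
  have "mulH n h v (Gx ?c 1) = (\<Sum>b\<in>basis n. \<Sum>b'\<in>basis n. h b * v b' * comulb n (Gx ?c 1) (Pr b b'))"
    using m by (simp add: mulH_def)
  also have "\<dots> = (\<Sum>b\<in>basis n. \<Sum>b'\<in>basis n. h b * v b' * pten (bv (Gx ?c 1)) (bv (Gx ?c 0)) (Pr b b')) +
     (\<Sum>b\<in>basis n. \<Sum>b'\<in>basis n. h b * v b' * pten (bv (Gx ((c + 1) mod int n) 0)) (bv (Gx ?c 1)) (Pr b b'))"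
    by (simp add: sum.distrib[symmetric] distrib_left mod_simps)
  also have "\<dots> = h (Gx ?c 1) * v (Gx ?c 0) + h (Gx ((c + 1) mod int n) 0) * v (Gx ?c 1)"
    unfolding pair[OF bas(2) bas(1)] pair[OF bas(1) bas(2)] ..
  finally show "mulH n h v (Gx ?c 1) = h (Gx ?c 1) * v (Gx ?c 0) + h (Gx ((c + 1) mod int n) 0) * v (Gx ?c 1)" .
  show "l \<notin> basis n \<Longrightarrow> mulH n h v l = 0"
    by (simp add: mulH_def)
qed

lemma oneH_coord:
  assumes "n > 0"
  shows "oneH n (Gx (c mod int n) 0) = 1" "oneH n (Gx c 1) = 0"
proof -
  have m: "0 \<le> c mod int n" "c mod int n < int n"
    using assms by auto
  have "oneH n (Gx (c mod int n) 0) = (\<Sum>i\<in>{0..<int n}. if c mod int n = i then 1 else 0)"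
    unfolding oneH_def sum_fun_apply by (rule sum.cong) (auto simp: bv_def)
  then show "oneH n (Gx (c mod int n) 0) = 1" using m by simp
  show "oneH n (Gx c 1) = 0"
    unfolding oneH_def sum_fun_apply by (rule sum.neutral) (auto simp: bv_def)
qed

lemma Hset_alt: "Hset n = sp (basis n)"
  by (simp add: Hset_def sp_def)

text \<open>The basis vectors generate, the ground field acting through the multiples of
  \<open>oneH n\<close>.\<close>

lemma fin_gen_sp:
  fixes M :: "'k::field hmod"
  assumes n: "n > 0" and M: "hmodule n M" and S: "carr M = sp S" "finite S"
  shows "fin_gen n M"
proof -
  let ?b = "bv :: lab \<Rightarrow> 'k fvec"
  have V: "fvec.subspace (carr M)"
    and act: "\<And>h v. h \<in> Hset n \<Longrightarrow> v \<in> carr M \<Longrightarrow> act M h v \<in> carr M"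
    and one: "\<And>v. v \<in> carr M \<Longrightarrow> act M (oneH n) v = v"
    and lin: "\<And>v. v \<in> carr M \<Longrightarrow> linear_on (Hset n) (\<lambda>h. act M h v)"
    using M unfolding hmodule_def by blast+
  have oneH: "oneH n \<in> Hset n"
    unfolding oneH_def Hset_alt by (intro fvec.subspace_sum[OF sp_subspace] bv_sp) auto
  have inj: "inj_on (bv :: lab \<Rightarrow> 'k fvec) S"
    by (auto simp: inj_on_def bv_def fun_eq_iff split: if_splits) 
  have c: "scl c (oneH n) \<in> Hset n" and sclone: "v \<in> carr M \<Longrightarrow> act M (scl c (oneH n)) v = scl c v" for c v
    using oneH lin[of v] one[of v] unfolding linear_on_def
    by (auto simp: Hset_alt intro: fvec.subspace_scale[OF sp_subspace])
  show ?thesis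
    unfolding fin_gen_def
  proof (intro exI[of _ "?b ` S"] conjI)
    show "finite (?b ` S)" using S by simp
    show sub: "?b ` S \<subseteq> carr M" using S by (auto intro: bv_sp)
    show "carr M = {\<Sum>s\<in>?b ` S. act M (c s) s |c. \<forall>s\<in>?b ` S. c s \<in> Hset n}"
    proof
      show "{\<Sum>s\<in>?b ` S. act M (c s) s |c. \<forall>s\<in>?b ` S. c s \<in> Hset n} \<subseteq> carr M"
        using sub act by (auto intro!: fvec.subspace_sum[OF V])
      show "carr M \<subseteq> {\<Sum>s\<in>?b ` S. act M (c s) s |c. \<forall>s\<in>?b ` S. c s \<in> Hset n}"
      proof
        fix v assume v: "v \<in> carr M"
        \<comment> \<open>The sum in \<open>fin_gen\<close> runs over vectors, so the coefficient of
          a vector has to be looked up through its label.\<close>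
        let ?c = "\<lambda>s. scl (v (inv_into S ?b s)) (oneH n)"
        have "v = (\<Sum>b\<in>S. scl (v b) (bv b))"
          using sp_expand[OF S(2)] v S(1) by simp
        also have "\<dots> = (\<Sum>b\<in>S. act M (?c (?b b)) (?b b))"
          using sub by (intro sum.cong refl) (auto simp: inv_into_f_f[OF inj] sclone)
        also have "\<dots> = (\<Sum>s\<in>?b ` S. act M (?c s) s)"
          by (simp add: sum.reindex[OF inj])
        finally show "v \<in> {\<Sum>s\<in>?b ` S. act M (c s) s |c. \<forall>s\<in>?b ` S. c s \<in> Hset n}"
          using c by (intro CollectI exI[of _ ?c] conjI) auto
      qed
    qed
  qed
qed

lemma gr_subspace: "fvec.subspace (gr X m)"
  unfolding gr_def by (rule sp_subspace)

lemma gr_mult: "v \<in> gr X m \<Longrightarrow> (\<lambda>l. c l * v l) \<in> gr X m"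
  by (auto simp: gr_def sp_def)

lemma bact_split:
  "bact n X h v = (\<lambda>l. h (Gx (bwd X l mod int n) 0) * v l) + (\<lambda>l. h (Gx ((bwd X l - 1) mod int n) 1) * ba X v l)"
  by (simp add: bact_def fun_eq_iff)

lemma bact_gr:
  assumes "wf_bic X" "v \<in> gr X m"
  shows "bact n X h v \<in> gr X m"
  unfolding bact_split using assms
  by (intro fvec.subspace_add[OF gr_subspace] gr_mult) (auto simp: wf_bic_def)

lemma hmodule_realize:
  fixes X :: "'k::field bic"
  assumes n: "n > 0" and X: "wf_bic X"
  shows "hmodule n \<lparr>carr = gr X m, act = bact n X\<rparr>"
proof -
  have add: "\<And>v w. ba X (v + w) = ba X v + ba X w" and scl: "\<And>c v. ba X (scl c v) = scl c (ba X v)"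
    and wt: "\<And>c v. ba X (\<lambda>l. c (bwd X l) * v l) = (\<lambda>l. c (bwd X l - 1) * ba X v l)"
    and aa: "\<And>v. ba X (ba X v) = 0"
    using X unfolding wf_bic_def by blast+
  \<comment> \<open>The product of the two arrow parts disappears on the right because
    \<open>ba X\<close> squares to zero, and on the left because arrows multiply to zero in H. The
    remaining three terms are those of \<open>mulH_coord\<close>.\<close>
  have "bact n X (mulH n h h') v = bact n X h (bact n X h' v)" for h h' v
  proof
    fix l
    have "ba X (bact n X h' v) l = h' (Gx ((bwd X l - 1) mod int n) 0) * ba X v l"
      unfolding bact_split add
      using wt[of "\<lambda>i. h' (Gx (i mod int n) 0)" v] wt[of "\<lambda>i. h' (Gx ((i - 1) mod int n) 1)" "ba X v"]
      by (simp add: aa)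
    then show "bact n X (mulH n h h') v l = bact n X h (bact n X h' v) l"
      using mulH_coord(1)[OF n, of h h' "bwd X l"] mulH_coord(2)[OF n, of h h' "bwd X l - 1"]
      by (simp add: bact_def algebra_simps)
  qed
  moreover have "bact n X (oneH n) v = v" for v
    by (simp add: bact_def oneH_coord(1)[OF n] oneH_coord(2)[OF n, unfolded One_nat_def])
  moreover have "linear_on V (bact n X h)" for V h
    unfolding linear_on_def bact_def add scl by (simp add: fun_eq_iff scl_def algebra_simps)
  moreover have "linear_on V (\<lambda>h. bact n X h v)" for V v
    unfolding linear_on_def bact_def by (simp add: fun_eq_iff scl_def algebra_simps)
  ultimately show ?thesis
    using bact_gr[OF X] unfolding hmodule_def
    by (auto simp: gr_subspace)
qed

lemma bcomplex_realize:
  fixes X :: "'k::field bic"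
  assumes n: "n > 0" and X: "wf_bic X"
  shows "bcomplex n (realize n X)"
proof -
  have fin: "finite (bB X)"
    and add: "\<And>v w. bd X (v + w) = bd X v + bd X w"
    and wt: "\<And>c v. bd X (\<lambda>l. c (bwd X l) * v l) = (\<lambda>l. c (bwd X l) * bd X v l)"
    and dd: "\<And>v. bd X (bd X v) = 0"
    and ad: "\<And>v. ba X (bd X v) = bd X (ba X v)"
    and gr: "\<And>m v. v \<in> gr X m \<Longrightarrow> bd X v \<in> gr X (m + 1)"
    using X unfolding wf_bic_def by blast+
  have hm: "hmodule n (ob (realize n X) m)" for m
    using hmodule_realize[OF n X] by (simp add: realize_def)
  have fg: "fin_gen n (ob (realize n X) m)" for m
    by (rule fin_gen_sp[OF n hm, of _ "{l \<in> bB X. bcd X l = m}"]) (auto simp: realize_def gr_def fin)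
  have da: "bd X (bact n X h v) = bact n X h (bd X v)" for h v
    unfolding bact_split add
    using wt[of "\<lambda>i. h (Gx (i mod int n) 0)" v] wt[of "\<lambda>i. h (Gx ((i - 1) mod int n) 1)" "ba X v"]
    by (simp add: ad)
  have "\<exists>l u. \<forall>m. m < l \<or> u < m \<longrightarrow> gr X m = {0}"
  proof (intro exI allI impI)
    fix m assume m: "m < Min (insert 0 (bcd X ` bB X)) \<or> Max (insert 0 (bcd X ` bB X)) < m"
    have "bcd X l \<noteq> m" if "l \<in> bB X" for l
      using m fin that by (auto simp: not_le[symmetric])
    then show "gr X m = {0}"
      by (auto simp: gr_def sp_def)
  qed
  then show ?thesis
    unfolding bcomplex_def using hm fg
    by (auto simp: realize_def hmod_hom_def add da dd gr)
qed

text \<open>\<open>f\<close> respects weights and arrows, of which \<open>bact\<close> is composed,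
  and so it is H-linear. \<open>g\<close> only serves to invert \<open>f\<close> on
  cohomology.\<close>

lemma Db_iso_realizeI:
  fixes X Y :: "'k::field bic"
  assumes n: "n > 0" and X: "wf_bic X" and Y: "wf_bic Y"
    and f: "\<And>m v. v \<in> gr X m \<Longrightarrow> f v \<in> gr Y m"
    and fadd: "\<And>v w. f (v + w) = f v + f w"
    and fwt: "\<And>m c v. v \<in> gr X m \<Longrightarrow> f (\<lambda>l. c (bwd X l) * v l) = (\<lambda>l. c (bwd Y l) * f v l)"
    and fa: "\<And>m v. v \<in> gr X m \<Longrightarrow> f (ba X v) = ba Y (f v)"
    and fd: "\<And>m v. v \<in> gr X m \<Longrightarrow> f (bd X v) = bd Y (f v)"
    and g: "\<And>m v. v \<in> gr Y m \<Longrightarrow> g v \<in> gr X m"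
    and g0: "g 0 = 0"
    and gd: "\<And>m v. v \<in> gr Y m \<Longrightarrow> g (bd Y v) = bd X (g v)"
    and gf: "\<And>m v. v \<in> gr X m \<Longrightarrow> bd X v = 0 \<Longrightarrow> \<exists>w\<in>gr X (m - 1). v - g (f v) = bd X w"
    and fg: "\<And>m v. v \<in> gr Y m \<Longrightarrow> bd Y v = 0 \<Longrightarrow> \<exists>w\<in>gr Y (m - 1). v - f (g v) = bd Y w"
  shows "Db_iso n (realize n X) (realize n Y)"
proof (rule quasi_iso_Db_iso[OF bcomplex_realize[OF n X] bcomplex_realize[OF n Y]])
  have faX: "ba X v \<in> gr X m" if "v \<in> gr X m" for m v
    using X that unfolding wf_bic_def by blast
  have fact: "f (bact n X h v) = bact n Y h (f v)" if v: "v \<in> gr X m" for m h v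
    unfolding bact_split fadd
    using fwt[OF v, of "\<lambda>i. h (Gx (i mod int n) 0)"]
      fwt[OF faX[OF v], of "\<lambda>i. h (Gx ((i - 1) mod int n) 1)"]
    by (simp add: fa[OF v])
  show "quasi_iso n (realize n X) (realize n Y) (\<lambda>m. f)"
  proof (rule quasi_isoI[OF bcomplex_realize[OF n X] bcomplex_realize[OF n Y], where g = "\<lambda>m. g"])
    show "chain_map n (realize n X) (realize n Y) (\<lambda>m. f)"
      unfolding chain_map_def hmod_hom_def realize_def by (auto simp: f fadd fact fd)
    show "v - g (f v) \<in> coboundaries (realize n X) m" if "v \<in> cocycles (realize n X) m" for m v
      using gf[of v m] that by (auto simp: realize_def cocycles_def coboundaries_def)
    show "v - f (g v) \<in> coboundaries (realize n Y) m" if "v \<in> cocycles (realize n Y) m" for m v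
      using fg[of v m] that by (auto simp: realize_def cocycles_def coboundaries_def)
  qed (auto simp: realize_def g g0 gd)
qed

section \<open>Monomial models\<close>

text \<open>The exponents in the structure constants of A are residues modulo n. With n even they
  may be replaced by any integral lift.\<close>

lemma sg_mod:
  assumes "even n" "n > 0"
  shows "(- 1) ^ nat (z mod int n) = (sg z :: 'k::field)"
  using assms by (simp add: sg_def minus_one_power_iff even_nat_iff dvd_mod_iff)

lemma sg_simps:
  "sg (a + b) = (sg a * sg b :: 'k::field)"
  "sg (a - b) = (sg a * sg b :: 'k::field)"
  "sg (- a) = (sg a :: 'k::field)"
  "sg a * sg a = (1 :: 'k::field)"
  "sg a * (sg a * c) = (c :: 'k::field)"
  "sg 0 = (1 :: 'k::field)" "sg 1 = (- 1 :: 'k::field)"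
  by (auto simp: sg_def)

text \<open>
  Bicomplexes with a basis on which both differentials are monomial, given in coordinates:
  \<open>(a v) l = mca l * v (mpa l)\<close> and \<open>(d v) l = mcf l * v (mpd l)\<close>.
\<close>

record 'k mono =
  mB :: "lab set"
  mcd :: "lab \<Rightarrow> int"
  mwd :: "lab \<Rightarrow> int"
  mca :: "lab \<Rightarrow> 'k"
  mpa :: "lab \<Rightarrow> lab"
  mcf :: "lab \<Rightarrow> 'k"
  mpd :: "lab \<Rightarrow> lab"

text \<open>The maps \<open>mpa\<close> and \<open>mpd\<close> point backwards, from an entry to the
  basis vector that contributes to it. The vanishing of \<open>mca\<close> and \<open>mcf\<close> at
  these predecessors says that no two steps can be composed, so that a a, d d, a d and d a are all
  zero. This holds for the complexes M and N, where both operators lead into the socle of a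
  term.\<close>

definition wf_mono :: "'k::field mono \<Rightarrow> bool" where
  "wf_mono X \<longleftrightarrow> finite (mB X) \<and>
     (\<forall>l. mca X l \<noteq> 0 \<longrightarrow> l \<in> mB X \<and> mpa X l \<in> mB X \<and> mwd X (mpa X l) = mwd X l - 1 \<and>
        mcd X (mpa X l) = mcd X l \<and> mca X (mpa X l) = 0 \<and> mcf X (mpa X l) = 0) \<and>
     (\<forall>l. mcf X l \<noteq> 0 \<longrightarrow> l \<in> mB X \<and> mpd X l \<in> mB X \<and> mwd X (mpd X l) = mwd X l \<and>
        mcd X (mpd X l) = mcd X l - 1 \<and> mca X (mpd X l) = 0 \<and> mcf X (mpd X l) = 0)"

lemma wf_monoD:
  assumes "wf_mono X"
  shows "finite (mB X)"
    and "mca X l \<noteq> 0 \<Longrightarrow> l \<in> mB X \<and> mpa X l \<in> mB X \<and> mwd X (mpa X l) = mwd X l - 1 \<and>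
        mcd X (mpa X l) = mcd X l \<and> mca X (mpa X l) = 0 \<and> mcf X (mpa X l) = 0"
    and "mcf X l \<noteq> 0 \<Longrightarrow> l \<in> mB X \<and> mpd X l \<in> mB X \<and> mwd X (mpd X l) = mwd X l \<and>
        mcd X (mpd X l) = mcd X l - 1 \<and> mca X (mpd X l) = 0 \<and> mcf X (mpd X l) = 0"
  using assms unfolding wf_mono_def by blast+

definition of_mono :: "'k::field mono \<Rightarrow> 'k bic" where
  "of_mono X = \<lparr>bB = mB X, bcd = mcd X, bwd = mwd X,
     ba = (\<lambda>v l. mca X l * v (mpa X l)), bd = (\<lambda>v l. mcf X l * v (mpd X l))\<rparr>"

lemma gr_of_mono:
  "v \<in> gr (of_mono X) m \<longleftrightarrow> (\<forall>l. v l \<noteq> 0 \<longrightarrow> l \<in> mB X \<and> mcd X l = m)"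
  by (auto simp: gr_def sp_def of_mono_def)

lemma wf_of_mono:
  assumes "wf_mono X"
  shows "wf_bic (of_mono X)"
proof -
  let ?T = "of_mono X"
  note d = wf_monoD[OF assms]
  have gr: "v \<in> gr ?T m \<longleftrightarrow> (\<forall>l. v l \<noteq> 0 \<longrightarrow> l \<in> mB X \<and> mcd X l = m)" for v m
    by (rule gr_of_mono)
  have gra: "ba ?T v \<in> gr ?T m" if v: "v \<in> gr ?T m" for v m
    unfolding gr
  proof (intro allI impI)
    fix l assume "ba ?T v l \<noteq> 0"
    then show "l \<in> mB X \<and> mcd X l = m"
      using v d(2)[of l] unfolding gr by (fastforce simp: of_mono_def)
  qed
  have grd: "bd ?T v \<in> gr ?T (m + 1)" if v: "v \<in> gr ?T m" for v m
    unfolding gr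
  proof (intro allI impI)
    fix l assume "bd ?T v l \<noteq> 0"
    then show "l \<in> mB X \<and> mcd X l = m + 1"
      using v d(3)[of l] unfolding gr by (fastforce simp: of_mono_def)
  qed
  have wta: "ba ?T (\<lambda>l. c (bwd ?T l) * v l) = (\<lambda>l. c (bwd ?T l - 1) * ba ?T v l)" for c v
  proof
    fix l
    show "ba ?T (\<lambda>l. c (bwd ?T l) * v l) l = c (bwd ?T l - 1) * ba ?T v l"
      using d(2)[of l] by (cases "mca X l = 0") (auto simp: of_mono_def)
  qed
  have wtd: "bd ?T (\<lambda>l. c (bwd ?T l) * v l) = (\<lambda>l. c (bwd ?T l) * bd ?T v l)" for c v
  proof
    fix l
    show "bd ?T (\<lambda>l. c (bwd ?T l) * v l) l = c (bwd ?T l) * bd ?T v l"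
      using d(3)[of l] by (cases "mcf X l = 0") (auto simp: of_mono_def)
  qed
  have comp: "ba ?T (ba ?T v) = 0 \<and> bd ?T (bd ?T v) = 0 \<and> ba ?T (bd ?T v) = bd ?T (ba ?T v)" for v
  proof (intro conjI ext)
    fix l
    show "ba ?T (ba ?T v) l = 0 l" "bd ?T (bd ?T v) l = 0 l" "ba ?T (bd ?T v) l = bd ?T (ba ?T v) l"
      using d(2)[of l] d(3)[of l]
      by (cases "mca X l = 0"; cases "mcf X l = 0"; simp add: of_mono_def)+
  qed
  have "ba ?T (v + w) = ba ?T v + ba ?T w" "bd ?T (v + w) = bd ?T v + bd ?T w"
    "ba ?T (scl c v) = scl c (ba ?T v)" "bd ?T (scl c v) = scl c (bd ?T v)" for c v w
    by (simp_all add: of_mono_def fun_eq_iff scl_def algebra_simps)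
  moreover have "finite (bB ?T)"
    using d(1) by (simp add: of_mono_def)
  ultimately show ?thesis
    unfolding wf_bic_def using gra grd wta wtd comp by blast
qed

text \<open>The operators for \<open>\<mu> = 0\<close>. In the arrow part the sign belongs to the
  weight of the second factor, since moving x past g^j gives (-1)^j; in the differential it is the
  Koszul sign of the first factor.\<close>

definition tenb :: "'k::field mono \<Rightarrow> 'k mono \<Rightarrow> 'k bic" where
  "tenb X Y = \<lparr>bB = {Pr x y |x y. x \<in> mB X \<and> y \<in> mB Y},
     bcd = (\<lambda>l. case l of Pr x y \<Rightarrow> mcd X x + mcd Y y | _ \<Rightarrow> 0),
     bwd = (\<lambda>l. case l of Pr x y \<Rightarrow> mwd X x + mwd Y y | _ \<Rightarrow> 0),
     ba = (\<lambda>z l. case l of Pr x y \<Rightarrow>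
       mca Y y * z (Pr x (mpa Y y)) + sg (mwd Y y) * (mca X x * z (Pr (mpa X x) y)) | _ \<Rightarrow> 0),
     bd = (\<lambda>z l. case l of Pr x y \<Rightarrow>
       mcf X x * z (Pr (mpd X x) y) + sg (mcd X x) * (mcf Y y * z (Pr x (mpd Y y))) | _ \<Rightarrow> 0)\<rparr>"

lemma tenb_simps:
  "bB (tenb X Y) = {Pr x y |x y. x \<in> mB X \<and> y \<in> mB Y}"
  "bcd (tenb X Y) (Pr x y) = mcd X x + mcd Y y"
  "bwd (tenb X Y) (Pr x y) = mwd X x + mwd Y y"
  "ba (tenb X Y) z (Pr x y) = mca Y y * z (Pr x (mpa Y y)) + sg (mwd Y y) * (mca X x * z (Pr (mpa X x) y))"
  "bd (tenb X Y) z (Pr x y) = mcf X x * z (Pr (mpd X x) y) + sg (mcd X x) * (mcf Y y * z (Pr x (mpd Y y)))"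
  "ba (tenb X Y) z (Gx i j) = 0" "ba (tenb X Y) z (Tag r l) = 0"
  "bd (tenb X Y) z (Gx i j) = 0" "bd (tenb X Y) z (Tag r l) = 0"
  by (simp_all add: tenb_def)

lemma lab_fun_eqI:
  assumes "\<And>x y. f (Pr x y) = g (Pr x y)" "\<And>i j. f (Gx i j) = g (Gx i j)" "\<And>r l. f (Tag r l) = g (Tag r l)"
  shows "f = g"
proof
  fix l show "f l = g l" using assms by (cases l) auto
qed

lemma gr_tenb:
  "z \<in> gr (tenb X Y) m \<longleftrightarrow>
    (\<forall>x y. z (Pr x y) \<noteq> 0 \<longrightarrow> x \<in> mB X \<and> y \<in> mB Y \<and> mcd X x + mcd Y y = m) \<and>
    (\<forall>i j. z (Gx i j) = 0) \<and> (\<forall>r l. z (Tag r l) = 0)" (is "?L \<longleftrightarrow> ?R")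
proof
  assume ?L
  then have *: "z l \<noteq> 0 \<Longrightarrow> l \<in> bB (tenb X Y) \<and> bcd (tenb X Y) l = m" for l
    unfolding gr_def sp_def by blast
  show ?R
    using *[of "Pr _ _", simplified tenb_simps] *[of "Gx _ _", simplified tenb_simps]
      *[of "Tag _ _", simplified tenb_simps] by fastforce
next
  assume R: ?R
  show ?L unfolding gr_def sp_def
  proof (intro CollectI allI impI)
    fix l assume "l \<notin> {l \<in> bB (tenb X Y). bcd (tenb X Y) l = m}"
    then show "z l = 0" using R by (cases l) (auto simp: tenb_simps)
  qed
qed

lemma wf_mono_sg:
  assumes "wf_mono (X :: 'k::field mono)"
  shows "mca X l \<noteq> 0 \<Longrightarrow> sg (mwd X (mpa X l)) = (- sg (mwd X l) :: 'k)"
    and "mca X l \<noteq> 0 \<Longrightarrow> sg (mcd X (mpa X l)) = (sg (mcd X l) :: 'k)"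
    and "mcf X l \<noteq> 0 \<Longrightarrow> sg (mwd X (mpd X l)) = (sg (mwd X l) :: 'k)"
    and "mcf X l \<noteq> 0 \<Longrightarrow> sg (mcd X (mpd X l)) = (- sg (mcd X l) :: 'k)"
  using wf_monoD[OF assms] by (auto simp: sg_simps)

lemma wf_tenb:
  fixes X Y :: "'k::field mono"
  assumes X: "wf_mono X" and Y: "wf_mono Y"
  shows "wf_bic (tenb X Y)"
proof -
  let ?T = "tenb X Y"
  note dX = wf_monoD[OF X] and dY = wf_monoD[OF Y]
  note sX = wf_mono_sg[OF X] and sY = wf_mono_sg[OF Y]
  have ba_add: "ba ?T (v + w) = ba ?T v + ba ?T w" for v w
    by (rule lab_fun_eqI) (auto simp: tenb_simps algebra_simps)
  have bd_add: "bd ?T (v + w) = bd ?T v + bd ?T w" for v w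
    by (rule lab_fun_eqI) (auto simp: tenb_simps algebra_simps)
  have ba_scl: "ba ?T (scl c v) = scl c (ba ?T v)" for c v
    by (rule lab_fun_eqI) (auto simp: tenb_simps scl_def algebra_simps)
  have bd_scl: "bd ?T (scl c v) = scl c (bd ?T v)" for c v
    by (rule lab_fun_eqI) (auto simp: tenb_simps scl_def algebra_simps)
  have fin: "finite (bB ?T)"
    unfolding tenb_simps using dX(1) dY(1) by (intro finite_image_set2) auto
  have gra: "ba ?T z \<in> gr ?T m" if z: "z \<in> gr ?T m" for z m
    unfolding gr_tenb
  proof (intro conjI allI impI)
    fix x y assume "ba ?T z (Pr x y) \<noteq> 0"
    then consider "mca X x \<noteq> 0" "z (Pr (mpa X x) y) \<noteq> 0" | "mca Y y \<noteq> 0" "z (Pr x (mpa Y y)) \<noteq> 0"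
      by (fastforce simp: tenb_simps)
    then have "x \<in> mB X \<and> y \<in> mB Y \<and> mcd X x + mcd Y y = m"
    proof cases
      case 1
      then show ?thesis using z dX(2)[of x] unfolding gr_tenb by fastforce
    next
      case 2
      then show ?thesis using z dY(2)[of y] unfolding gr_tenb by fastforce
    qed
    then show "x \<in> mB X" "y \<in> mB Y" "mcd X x + mcd Y y = m" by blast+
  qed (simp_all add: tenb_simps)
  have grd: "bd ?T z \<in> gr ?T (m + 1)" if z: "z \<in> gr ?T m" for z m
    unfolding gr_tenb
  proof (intro conjI allI impI)
    fix x y assume "bd ?T z (Pr x y) \<noteq> 0"
    then consider "mcf X x \<noteq> 0" "z (Pr (mpd X x) y) \<noteq> 0" | "mcf Y y \<noteq> 0" "z (Pr x (mpd Y y)) \<noteq> 0"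
      by (fastforce simp: tenb_simps)
    then have "x \<in> mB X \<and> y \<in> mB Y \<and> mcd X x + mcd Y y = m + 1"
    proof cases
      case 1
      then show ?thesis using z dX(3)[of x] unfolding gr_tenb by fastforce
    next
      case 2
      then show ?thesis using z dY(3)[of y] unfolding gr_tenb by fastforce
    qed
    then show "x \<in> mB X" "y \<in> mB Y" "mcd X x + mcd Y y = m + 1" by blast+
  qed (simp_all add: tenb_simps)
  have wta: "ba ?T (\<lambda>l. c (bwd ?T l) * v l) = (\<lambda>l. c (bwd ?T l - 1) * ba ?T v l)" for c v
  proof (rule lab_fun_eqI)
    fix x y
    show "ba ?T (\<lambda>l. c (bwd ?T l) * v l) (Pr x y) = c (bwd ?T (Pr x y) - 1) * ba ?T v (Pr x y)"
    proof -
      have eX: "mca X x = 0 \<or> mwd X (mpa X x) + mwd Y y = mwd X x + mwd Y y - 1"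
        and eY: "mca Y y = 0 \<or> mwd X x + mwd Y (mpa Y y) = mwd X x + mwd Y y - 1"
        using dX(2)[of x] dY(2)[of y] by auto
      have cX: "mca X x * (c (mwd X (mpa X x) + mwd Y y) * t) = mca X x * (c (mwd X x + mwd Y y - 1) * t)" for t
        using eX by (elim disjE) (simp_all only: mult_zero_left)
      have cY: "mca Y y * (c (mwd X x + mwd Y (mpa Y y)) * t) = mca Y y * (c (mwd X x + mwd Y y - 1) * t)" for t
        using eY by (elim disjE) (simp_all only: mult_zero_left)
      show ?thesis
        unfolding tenb_simps cX cY by (simp add: distrib_left mult.left_commute)
    qed
  qed (simp_all add: tenb_simps)
  have wtd: "bd ?T (\<lambda>l. c (bwd ?T l) * v l) = (\<lambda>l. c (bwd ?T l) * bd ?T v l)" for c v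
  proof (rule lab_fun_eqI)
    fix x y
    show "bd ?T (\<lambda>l. c (bwd ?T l) * v l) (Pr x y) = c (bwd ?T (Pr x y)) * bd ?T v (Pr x y)"
      using dX(3)[of x] dY(3)[of y] unfolding tenb_simps
      by (cases "mcf X x = 0"; cases "mcf Y y = 0") (auto simp: algebra_simps)
  qed (simp_all add: tenb_simps)
  \<comment> \<open>The two mixed terms cancel because a changes the weight of the second factor by
    one, hence its sign. For \<open>dd\<close> the same happens with the degree of the first
    factor.\<close>
  have aa: "ba ?T (ba ?T v) = 0" for v
  proof (rule lab_fun_eqI)
    fix x y
    show "ba ?T (ba ?T v) (Pr x y) = 0 (Pr x y)"
      using dX(2)[of x] dY(2)[of y] sY(1)[of y] unfolding tenb_simps
      by (cases "mca X x = 0"; cases "mca Y y = 0") (auto simp: algebra_simps)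
  qed (simp_all add: tenb_simps)
  have dd: "bd ?T (bd ?T v) = 0" for v
  proof (rule lab_fun_eqI)
    fix x y
    show "bd ?T (bd ?T v) (Pr x y) = 0 (Pr x y)"
      using dX(3)[of x] dY(3)[of y] sX(4)[of x] unfolding tenb_simps
      by (cases "mcf X x = 0"; cases "mcf Y y = 0") (auto simp: algebra_simps)
  qed (simp_all add: tenb_simps)
  have ad: "ba ?T (bd ?T v) = bd ?T (ba ?T v)" for v
  proof (rule lab_fun_eqI)
    fix x y
    show "ba ?T (bd ?T v) (Pr x y) = bd ?T (ba ?T v) (Pr x y)"
      using dX(2)[of x] dX(3)[of x] dY(2)[of y] dY(3)[of y] sX(2)[of x] sY(3)[of y] unfolding tenb_simps
      by (cases "mca X x = 0"; cases "mca Y y = 0"; cases "mcf X x = 0"; cases "mcf Y y = 0")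
        (auto simp: algebra_simps)
  qed (simp_all add: tenb_simps)
  show ?thesis
    unfolding wf_bic_def using fin ba_add bd_add ba_scl bd_scl gra grd wta wtd aa dd ad by blast
qed

section \<open>Transport of complexes along linear bijections\<close>

lemma relabel_bij:
  assumes inj: "inj_on \<rho> S"
  shows "bij_betw (\<lambda>v l. if l \<in> S then v (\<rho> l) else 0) (sp (\<rho> ` S)) (sp S :: 'k::field fvec set)"
proof (rule bij_betw_byWitness[where f' = "\<lambda>w l. if l \<in> \<rho> ` S then w (inv_into S \<rho> l) else 0"])
  show "\<forall>v\<in>sp (\<rho> ` S). (\<lambda>l. if l \<in> \<rho> ` S then if inv_into S \<rho> l \<in> S then v (\<rho> (inv_into S \<rho> l)) else 0 else 0)
      = (v :: 'k fvec)"
  proof (intro ballI ext)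
    fix v :: "'k fvec" and l assume v: "v \<in> sp (\<rho> ` S)"
    show "(if l \<in> \<rho> ` S then if inv_into S \<rho> l \<in> S then v (\<rho> (inv_into S \<rho> l)) else 0 else 0) = v l"
      using v f_inv_into_f[of l \<rho> S] inv_into_into[of l \<rho> S] by (auto simp: sp_def)
  qed
  show "\<forall>w\<in>sp S. (\<lambda>l. if l \<in> S then if \<rho> l \<in> \<rho> ` S then w (inv_into S \<rho> (\<rho> l)) else 0 else 0) = (w :: 'k fvec)"
    using inv_into_f_f[OF inj] by (auto simp: sp_def fun_eq_iff)
qed (auto simp: sp_def)

text \<open>The algebraic axioms of a complex of modules are equations and can be checked after
  applying the injective maps \<open>\<Phi> m\<close>. Thus it also comes out that X is a complex of
  modules, in particular for tensor products of complexes.\<close>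

lemma bcomplex_transport:
  fixes X :: "'k::field cpx" and Y :: "'k bic"
  assumes n: "n > 0" and Y: "wf_bic Y"
    and S: "\<And>m. carr (ob X m) = sp (S m)" "\<And>m. finite (S m)"
    and act: "\<And>m h v. v \<in> carr (ob X m) \<Longrightarrow> act (ob X m) h v \<in> carr (ob X m)"
    and dif: "\<And>m v. v \<in> carr (ob X m) \<Longrightarrow> diff X m v \<in> carr (ob X (m + 1))"
    and bij: "\<And>m. bij_betw (\<Phi> m) (carr (ob X m)) (gr Y m)"
    and add: "\<And>m v w. \<Phi> m (v + w) = \<Phi> m v + \<Phi> m w"
    and scl: "\<And>m c v. \<Phi> m (scl c v) = scl c (\<Phi> m v)"
    and pact: "\<And>m h v. v \<in> carr (ob X m) \<Longrightarrow> \<Phi> m (act (ob X m) h v) = bact n Y h (\<Phi> m v)"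
    and pdif: "\<And>m v. v \<in> carr (ob X m) \<Longrightarrow> \<Phi> (m + 1) (diff X m v) = bd Y (\<Phi> m v)"
  shows "bcomplex n X" and "Db_iso n X (realize n Y)"
proof -
  have bY: "bcomplex n (realize n Y)"
    by (rule bcomplex_realize[OF n Y])
  have hY: "hmodule n \<lparr>carr = gr Y m, act = bact n Y\<rparr>" for m
    by (rule hmodule_realize[OF n Y])
  have inj: "v = w" if "v \<in> carr (ob X m)" "w \<in> carr (ob X m)" "\<Phi> m v = \<Phi> m w" for m v w
    using bij[of m] that unfolding bij_betw_def inj_on_def by blast
  have PG: "\<Phi> m v \<in> gr Y m" if "v \<in> carr (ob X m)" for m v
    using bij[of m] that unfolding bij_betw_def by blast
  have V: "fvec.subspace (carr (ob X m))" for m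
    unfolding S by (rule sp_subspace)
  have Yadd: "bact n Y h (v + w) = bact n Y h v + bact n Y h w"
    and Yscl: "bact n Y h (scl c v) = scl c (bact n Y h v)"
    if "h \<in> Hset n" "v \<in> gr Y m" "w \<in> gr Y m" for m h v w c
    using hY[of m] that unfolding hmodule_def linear_on_def by auto
  have Yadd': "bact n Y (h + h') v = bact n Y h v + bact n Y h' v"
    and Yscl': "bact n Y (scl c h) v = scl c (bact n Y h v)"
    if "h \<in> Hset n" "h' \<in> Hset n" "v \<in> gr Y m" for m h h' v c
    using hY[of m] that unfolding hmodule_def linear_on_def by auto
  have Yone: "bact n Y (oneH n) v = v" if "v \<in> gr Y m" for m v
    using hY[of m] that unfolding hmodule_def by auto
  have Ymul: "bact n Y (mulH n h h') v = bact n Y h (bact n Y h' v)"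
    if "h \<in> Hset n" "h' \<in> Hset n" "v \<in> gr Y m" for m v h h'
    using hY[of m] that unfolding hmodule_def by auto
  note Vadd = fvec.subspace_add[OF V] and Vscl = fvec.subspace_scale[OF V]
  have hX: "hmodule n (ob X m)" for m
    unfolding hmodule_def
  proof (intro conjI ballI)
    show "fvec.subspace (carr (ob X m))" by (rule V)
    fix h :: "'k fvec" assume h: "h \<in> Hset n"
    show "act (ob X m) h ` carr (ob X m) \<subseteq> carr (ob X m)"
      using act by blast
    show "linear_on (carr (ob X m)) (act (ob X m) h)"
      unfolding linear_on_def
    proof (intro conjI ballI allI)
      fix v w assume v: "v \<in> carr (ob X m)" and w: "w \<in> carr (ob X m)"
      show "act (ob X m) h (v + w) = act (ob X m) h v + act (ob X m) h w"
        by (rule inj[OF act[OF Vadd[OF v w]] Vadd[OF act[OF v] act[OF w]]])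
          (simp only: add pact[OF Vadd[OF v w]] pact[OF v] pact[OF w] Yadd[OF h PG[OF v] PG[OF w]])
    next
      fix c v assume v: "v \<in> carr (ob X m)"
      show "act (ob X m) h (scl c v) = scl c (act (ob X m) h v)"
        by (rule inj[OF act[OF Vscl[OF v]] Vscl[OF act[OF v]]])
          (simp only: scl pact[OF Vscl[OF v]] pact[OF v] Yscl[OF h PG[OF v] PG[OF v]])
    qed
    fix h' v :: "'k fvec" assume h': "h' \<in> Hset n" and v: "v \<in> carr (ob X m)"
    show "act (ob X m) (mulH n h h') v = act (ob X m) h (act (ob X m) h' v)"
      by (rule inj[OF act[OF v] act[OF act[OF v]]])
        (simp only: pact[OF v] pact[OF act[OF v]] Ymul[OF h h' PG[OF v]])
  next
    fix v assume v: "v \<in> carr (ob X m)"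
    show "linear_on (Hset n) (\<lambda>h. act (ob X m) h v)"
      unfolding linear_on_def
    proof (intro conjI ballI allI)
      fix h h' :: "'k fvec" assume h: "h \<in> Hset n" and h': "h' \<in> Hset n"
      show "act (ob X m) (h + h') v = act (ob X m) h v + act (ob X m) h' v"
        by (rule inj[OF act[OF v] Vadd[OF act[OF v] act[OF v]]])
          (simp only: add pact[OF v] Yadd'[OF h h' PG[OF v]])
    next
      fix c and h :: "'k fvec" assume h: "h \<in> Hset n"
      show "act (ob X m) (scl c h) v = scl c (act (ob X m) h v)"
        by (rule inj[OF act[OF v] Vscl[OF act[OF v]]])
          (simp only: scl pact[OF v] Yscl'[OF h h PG[OF v]])
    qed
    show "act (ob X m) (oneH n) v = v"
      by (rule inj[OF act[OF v] v]) (simp only: pact[OF v] Yone[OF PG[OF v]])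
  qed
  have homd: "hmod_hom n (ob X m) (ob X (m + 1)) (diff X m)" for m
    unfolding hmod_hom_def
  proof (intro conjI ballI)
    have "hmod_hom n \<lparr>carr = gr Y m, act = bact n Y\<rparr> \<lparr>carr = gr Y (m + 1), act = bact n Y\<rparr> (bd Y)"
      using bY unfolding bcomplex_def realize_def by simp
    note hom = this
    have badd: "bd Y (v + w) = bd Y v + bd Y w" if "v \<in> gr Y m" "w \<in> gr Y m" for v w
      using hom that unfolding hmod_hom_def by auto
    have bda: "bd Y (bact n Y h v) = bact n Y h (bd Y v)" if "h \<in> Hset n" "v \<in> gr Y m" for h v
      using hom that unfolding hmod_hom_def by auto
    show "diff X m ` carr (ob X m) \<subseteq> carr (ob X (m + 1))"
      using dif by blast
    fix v assume v: "v \<in> carr (ob X m)"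
    show "diff X m (v + w) = diff X m v + diff X m w" if w: "w \<in> carr (ob X m)" for w
      by (rule inj[OF dif[OF Vadd[OF v w]] Vadd[OF dif[OF v] dif[OF w]]])
        (simp only: add pdif[OF Vadd[OF v w]] pdif[OF v] pdif[OF w] badd[OF PG[OF v] PG[OF w]])
    show "diff X m (act (ob X m) h v) = act (ob X (m + 1)) h (diff X m v)" if h: "h \<in> Hset n" for h
      by (rule inj[OF dif[OF act[OF v]] act[OF dif[OF v]]])
        (simp only: pdif[OF act[OF v]] pact[OF v] pact[OF dif[OF v]] pdif[OF v] bda[OF h PG[OF v]])
  qed
  have P0: "\<Phi> m 0 = 0" for m
    using add[of m 0 0] by simp
  have dd: "diff X (m + 1) (diff X m v) = 0" if v: "v \<in> carr (ob X m)" for m v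
  proof (rule inj)
    show "diff X (m + 1) (diff X m v) \<in> carr (ob X (m + 1 + 1))" "0 \<in> carr (ob X (m + 1 + 1))"
      by (rule dif[OF dif[OF v]]) (rule fvec.subspace_0[OF V])
    show "\<Phi> (m + 1 + 1) (diff X (m + 1) (diff X m v)) = \<Phi> (m + 1 + 1) 0"
      using Y unfolding pdif[OF dif[OF v]] pdif[OF v] P0 by (simp add: wf_bic_def)
  qed
  obtain a b where ab: "\<And>m. m < a \<or> b < m \<Longrightarrow> gr Y m = {0}"
    using bY unfolding bcomplex_def realize_def cpx.simps hmod.simps by blast
  have X0: "carr (ob X m) = {0}" if m: "m < a \<or> b < m" for m
  proof -
    have "v = 0" if v: "v \<in> carr (ob X m)" for v
      by (rule inj[OF v fvec.subspace_0[OF V]]) (use PG[OF v] ab[OF m] P0[of m] in simp)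
    then show ?thesis using fvec.subspace_0[OF V, of m] by blast
  qed
  have fgX: "fin_gen n (ob X m)" for m
    by (rule fin_gen_sp[OF n hX S])
  have "\<exists>l u. \<forall>m. m < l \<or> u < m \<longrightarrow> carr (ob X m) = {0}"
    by (intro exI[of _ a] exI[of _ b] allI impI X0)
  then show bX: "bcomplex n X"
    unfolding bcomplex_def by (intro conjI allI ballI hX fgX homd dd)
  let ?g = "\<lambda>m. inv_into (carr (ob X m)) (\<Phi> m)"
  have g: "?g m v \<in> carr (ob X m)" "\<Phi> m (?g m v) = v" if "v \<in> gr Y m" for m v
    using bij_betw_inv_into_right[OF bij[of m] that] bij_betwE[OF bij_betw_inv_into[OF bij[of m]]] that
    by auto
  have gP: "?g m (\<Phi> m v) = v" if "v \<in> carr (ob X m)" for m v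
    by (rule bij_betw_inv_into_left[OF bij[of m] that])
  have bdg: "bd Y v \<in> gr Y (m + 1)" if "v \<in> gr Y m" for v m
    using Y that unfolding wf_bic_def by blast
  have "quasi_iso n X (realize n Y) \<Phi>"
  proof (rule quasi_isoI[OF bX bY, where g = ?g])
    show "chain_map n X (realize n Y) \<Phi>"
      unfolding chain_map_def hmod_hom_def using PG by (auto simp: realize_def add pact pdif)
    show "?g m v \<in> carr (ob X m)" if "v \<in> carr (ob (realize n Y) m)" for m v
      using that g by (simp add: realize_def)
    show "?g m 0 = 0" for m
      using gP[OF fvec.subspace_0[OF V], of m] by (simp add: P0)
    show "?g (m + 1) (diff (realize n Y) m v) = diff X m (?g m v)"
      if "v \<in> carr (ob (realize n Y) m)" for m v
    proof -
      have v: "v \<in> gr Y m" using that by (simp add: realize_def)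
      have "?g (m + 1) (bd Y v) = diff X m (?g m v)"
        by (rule inj[OF g(1)[OF bdg[OF v]] dif[OF g(1)[OF v]]])
          (simp only: g(2)[OF bdg[OF v]] pdif[OF g(1)[OF v]] g(2)[OF v])
      then show ?thesis by (simp add: realize_def)
    qed
    show "v - ?g m (\<Phi> m v) \<in> coboundaries X m" if "v \<in> cocycles X m" for m v
      using that gP coboundaries_closed(1)[OF bX] by (simp add: cocycles_def)
    show "v - \<Phi> m (?g m v) \<in> coboundaries (realize n Y) m" if "v \<in> cocycles (realize n Y) m" for m v
      using that g(2)[of v m] coboundaries_closed(1)[OF bY] by (simp add: cocycles_def realize_def)
  qed
  then show "Db_iso n X (realize n Y)"
    by (rule quasi_iso_Db_iso[OF bX bY])
qed

section \<open>Presentations of complexes by models\<close>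

definition hom_labs :: "'k::field mono \<Rightarrow> int \<Rightarrow> lab set" where
  "hom_labs X m = {l \<in> mB X. mcd X l = m}"

text \<open>The labels of the model are those of an abstract basis, and \<open>\<rho>\<close> names
  the vectors of X that realize them. It is injective only in each single degree: P_i and P_(i-n)
  are the same module, so different terms of M may use the same labels.\<close>

definition presents :: "nat \<Rightarrow> 'k::field cpx \<Rightarrow> 'k mono \<Rightarrow> (lab \<Rightarrow> lab) \<Rightarrow> bool" where
  "presents n X Y \<rho> \<longleftrightarrow> wf_mono Y \<and>
     (\<forall>m. inj_on \<rho> (hom_labs Y m) \<and> carr (ob X m) = sp (\<rho> ` hom_labs Y m)) \<and>
     (\<forall>m h. \<forall>v\<in>carr (ob X m). act (ob X m) h v \<in> carr (ob X m)) \<and>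
     (\<forall>m. \<forall>v\<in>carr (ob X m). diff X m v \<in> carr (ob X (m + 1))) \<and>
     (\<forall>m h. \<forall>v\<in>carr (ob X m). \<forall>l\<in>hom_labs Y m. act (ob X m) h v (\<rho> l) =
        h (Gx (mwd Y l mod int n) 0) * v (\<rho> l) + h (Gx ((mwd Y l - 1) mod int n) 1) * (mca Y l * v (\<rho> (mpa Y l)))) \<and>
     (\<forall>m. \<forall>v\<in>carr (ob X m). \<forall>l\<in>hom_labs Y (m + 1). diff X m v (\<rho> l) = mcf Y l * v (\<rho> (mpd Y l)))"

lemma presentsD:
  assumes "presents n X Y \<rho>"
  shows "wf_mono Y"
    and "inj_on \<rho> (hom_labs Y m)" and "carr (ob X m) = sp (\<rho> ` hom_labs Y m)"
    and "v \<in> carr (ob X m) \<Longrightarrow> act (ob X m) h v \<in> carr (ob X m)"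
    and "v \<in> carr (ob X m) \<Longrightarrow> diff X m v \<in> carr (ob X (m + 1))"
    and "v \<in> carr (ob X m) \<Longrightarrow> l \<in> hom_labs Y m \<Longrightarrow> act (ob X m) h v (\<rho> l) =
        h (Gx (mwd Y l mod int n) 0) * v (\<rho> l) + h (Gx ((mwd Y l - 1) mod int n) 1) * (mca Y l * v (\<rho> (mpa Y l)))"
    and "v \<in> carr (ob X m) \<Longrightarrow> l \<in> hom_labs Y (m + 1) \<Longrightarrow> diff X m v (\<rho> l) = mcf Y l * v (\<rho> (mpd Y l))"
  using assms unfolding presents_def by blast+

text \<open>\<open>tmap\<close> applies actions and differentials to the slices of a tensor, many of
  which are zero.\<close>

lemma presents_zero:
  assumes "presents n X Y \<rho>"
  shows "act (ob X m) h 0 = 0" and "diff X m 0 = 0"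
proof -
  note d = presentsD[OF assms]
  have 0: "0 \<in> carr (ob X m)"
    unfolding d(3) by (rule fvec.subspace_0[OF sp_subspace])
  show "act (ob X m) h 0 = 0"
  proof
    fix l
    show "act (ob X m) h 0 l = 0 l"
      using d(4)[OF 0, of h] d(6)[OF 0, of _ h] unfolding d(3) by (cases "l \<in> \<rho> ` hom_labs Y m") (auto simp: sp_def)
  qed
  show "diff X m 0 = 0"
  proof
    fix l
    show "diff X m 0 l = 0 l"
      using d(5)[OF 0] d(7)[OF 0] unfolding d(3) by (cases "l \<in> \<rho> ` hom_labs Y (m + 1)") (auto simp: sp_def)
  qed
qed

lemma finite_hom_labs: "wf_mono Y \<Longrightarrow> finite (hom_labs Y m)"
  using wf_monoD(1)[of Y] by (simp add: hom_labs_def)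

lemma presents_Db_iso:
  fixes X :: "'k::field cpx"
  assumes n: "n > 0" and p: "presents n X Y \<rho>"
  shows "Db_iso n X (realize n (of_mono Y))"
proof (rule bcomplex_transport(2)[OF n wf_of_mono[OF presentsD(1)[OF p]],
      where S = "\<lambda>m. \<rho> ` hom_labs Y m"
        and \<Phi> = "\<lambda>m v l. if l \<in> hom_labs Y m then v (\<rho> l) else 0"])
  note d = presentsD[OF p] and w = wf_monoD[OF presentsD(1)[OF p]]
  show "carr (ob X m) = sp (\<rho> ` hom_labs Y m)" for m by (rule d)
  show "finite (\<rho> ` hom_labs Y m)" for m using finite_hom_labs[OF d(1)] by simp
  show "v \<in> carr (ob X m) \<Longrightarrow> act (ob X m) h v \<in> carr (ob X m)" for m h v by (rule d)
  show "v \<in> carr (ob X m) \<Longrightarrow> diff X m v \<in> carr (ob X (m + 1))" for m v by (rule d)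
  have grY: "gr (of_mono Y) m = sp (hom_labs Y m)" for m
    by (simp add: gr_def of_mono_def hom_labs_def)
  show "bij_betw (\<lambda>v l. if l \<in> hom_labs Y m then v (\<rho> l) else 0) (carr (ob X m)) (gr (of_mono Y) m)" for m
    unfolding grY d(3) by (rule relabel_bij[OF d(2)])
  show "(\<lambda>l. if l \<in> hom_labs Y m then act (ob X m) h v (\<rho> l) else 0) =
      bact n (of_mono Y) h (\<lambda>l. if l \<in> hom_labs Y m then v (\<rho> l) else 0)"
    if v: "v \<in> carr (ob X m)" for m h v
  proof
    fix l
    show "(if l \<in> hom_labs Y m then act (ob X m) h v (\<rho> l) else 0) =
      bact n (of_mono Y) h (\<lambda>l. if l \<in> hom_labs Y m then v (\<rho> l) else 0) l"
      using d(6)[OF v, of l h] w(2)[of l]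
      by (cases "mca Y l = 0") (auto simp: bact_def of_mono_def hom_labs_def)
  qed
  show "(\<lambda>l. if l \<in> hom_labs Y (m + 1) then diff X m v (\<rho> l) else 0) =
      bd (of_mono Y) (\<lambda>l. if l \<in> hom_labs Y m then v (\<rho> l) else 0)"
    if v: "v \<in> carr (ob X m)" for m v
  proof
    fix l
    show "(if l \<in> hom_labs Y (m + 1) then diff X m v (\<rho> l) else 0) =
      bd (of_mono Y) (\<lambda>l. if l \<in> hom_labs Y m then v (\<rho> l) else 0) l"
      using d(7)[OF v, of l] w(3)[of l]
      by (cases "mcf Y l = 0") (auto simp: of_mono_def hom_labs_def)
  qed
qed (auto simp: fun_eq_iff scl_def)

section \<open>Tensor products of presented complexes\<close>

definition prs :: "lab set \<Rightarrow> lab set \<Rightarrow> lab set" where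
  "prs S S' = {Pr a b |a b. a \<in> S \<and> b \<in> S'}"

lemma prs_slice:
  assumes "z \<in> sp (prs S S')"
  shows "(\<lambda>b. z (Pr a b)) \<in> sp S'" and "(\<lambda>a. z (Pr a b)) \<in> sp S"
    and "a \<notin> S \<Longrightarrow> (\<lambda>b. z (Pr a b)) = 0" 
  using assms by (auto simp: sp_def prs_def fun_eq_iff)

lemma tmap_closed:
  fixes f g :: "'k::field fvec \<Rightarrow> 'k fvec"
  assumes f: "\<And>v. v \<in> sp S \<Longrightarrow> f v \<in> sp S1" "f 0 = 0"
    and g: "\<And>v. v \<in> sp S' \<Longrightarrow> g v \<in> sp S1'" "g 0 = 0"
    and z: "z \<in> sp (prs S S')"
  shows "tmap f g z \<in> sp (prs S1 S1')"
proof -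
  have "f (\<lambda>a'. g (\<lambda>b'. z (Pr a' b')) b) a = 0" if "a \<notin> S1 \<or> b \<notin> S1'" for a b
  proof (cases "b \<in> S1'")
    case True
    have "(\<lambda>a'. g (\<lambda>b'. z (Pr a' b')) b) \<in> sp S"
      using prs_slice(3)[OF z] g(2) by (auto simp: sp_def)
    then show ?thesis
      using f(1) True that by (auto simp: sp_def)
  next
    case False
    then have "(\<lambda>a'. g (\<lambda>b'. z (Pr a' b')) b) = 0"
      using g(1)[OF prs_slice(1)[OF z]] by (auto simp: sp_def fun_eq_iff)
    then show ?thesis using f(2) by simp
  qed
  then show ?thesis
    by (auto simp: sp_def tmap_def prs_def split: lab.splits)
qed

lemma dsum_carr:
  fixes M :: "int \<Rightarrow> 'k::field hmod"
  assumes M: "\<And>r. r \<in> I \<Longrightarrow> carr (M r) = sp (S r)" and fin: "finite {r \<in> I. S r \<noteq> {}}"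
  shows "carr (dsum I M) = sp {Tag r l |r l. r \<in> I \<and> l \<in> S r}"
proof
  show "carr (dsum I M) \<subseteq> sp {Tag r l |r l. r \<in> I \<and> l \<in> S r}"
    using M by (force simp: dsum_def sp_def glue_def split: lab.splits)
  show "sp {Tag r l |r l. r \<in> I \<and> l \<in> S r} \<subseteq> carr (dsum I M)"
  proof
    fix z :: "'k fvec" assume z: "z \<in> sp {Tag r l |r l. r \<in> I \<and> l \<in> S r}"
    have "z = glue (\<lambda>r. cmp r z)"
      using z by (auto simp: glue_def cmp_def sp_def fun_eq_iff split: lab.splits)
    moreover have "cmp r z \<in> carr (M r)" if "r \<in> I" for r
      using z M[OF that] that by (auto simp: cmp_def sp_def)
    moreover have "cmp r z = 0" if "r \<notin> {r \<in> I. S r \<noteq> {}}" for r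
      using z that by (auto simp: cmp_def sp_def fun_eq_iff)
    moreover from this have "finite {r. cmp r z \<noteq> 0}"
      by (rule_tac finite_subset[OF _ fin]) blast
    ultimately show "z \<in> carr (dsum I M)"
      unfolding dsum_def by auto
  qed
qed

text \<open>These are the values of h at the products of two basis elements of A: moving x past g^j
  gives \<open>sg j\<close>, and x^2 gives the difference in the last formula.\<close>

lemma mulb_dual:
  assumes n: "even n" "n > 0"
  shows "comulH n \<mu> h (Gx (i mod int n) 0) (Gx (j mod int n) 0) = h (Gx ((i + j) mod int n) 0)"
    and "comulH n \<mu> h (Gx (i mod int n) 0) (Gx (j mod int n) 1) = h (Gx ((i + j) mod int n) 1)"
    and "comulH n \<mu> h (Gx (i mod int n) 1) (Gx (j mod int n) 0) = sg j * h (Gx ((i + j) mod int n) 1)"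
    and "comulH n \<mu> h (Gx (i mod int n) 1) (Gx (j mod int n) 1) =
      sg j * \<mu> * (h (Gx ((i + j) mod int n) 0) - h (Gx ((i + j + 2) mod int n) 0))"
proof -
  have m: "0 \<le> z mod int n" "z mod int n < int n" for z
    using n by auto
  have pick: "(\<Sum>c\<in>basis n. bv l c * h c) = h l" if "l \<in> basis n" for l
    using that sum_basis_pick[of l n "\<lambda>c. bv l c * h c"] by (auto simp: bv_def)
  have P: "(\<Sum>c\<in>basis n. bv (Gx (z mod int n) s) c * h c) = h (Gx (z mod int n) s)" if "s < 2" for z s
    using that m by (intro pick) auto
  have assoc: "(\<Sum>c\<in>basis n. k * f c * h c) = k * (\<Sum>c\<in>basis n. f c * h c)" for k f
    by (simp add: sum_distrib_left mult.assoc)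
  show "comulH n \<mu> h (Gx (i mod int n) 0) (Gx (j mod int n) 0) = h (Gx ((i + j) mod int n) 0)"
    and "comulH n \<mu> h (Gx (i mod int n) 0) (Gx (j mod int n) 1) = h (Gx ((i + j) mod int n) 1)"
    using P[of 0 "i + j"] P[of 1 "i + j"]
    by (simp_all add: comulH_def scl_def mod_simps)
  show "comulH n \<mu> h (Gx (i mod int n) 1) (Gx (j mod int n) 0) = sg j * h (Gx ((i + j) mod int n) 1)"
    using P[of 1 "i + j"]
    by (simp add: comulH_def scl_def mod_simps assoc sg_mod[OF n])
  have "comulH n \<mu> h (Gx (i mod int n) 1) (Gx (j mod int n) 1) =
     (\<Sum>c\<in>basis n. sg j * \<mu> * (bv (Gx ((i + j) mod int n) 0) c - bv (Gx ((i + j + 2) mod int n) 0) c) * h c)"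
    using mod_add_cong[of "i mod int n + j mod int n" "int n" "i + j" 2 2]
    by (simp add: comulH_def scl_def mod_simps sg_mod[OF n])
  also have "\<dots> = sg j * \<mu> * ((\<Sum>c\<in>basis n. bv (Gx ((i + j) mod int n) 0) c * h c) -
      (\<Sum>c\<in>basis n. bv (Gx ((i + j + 2) mod int n) 0) c * h c))"
    unfolding assoc by (simp add: sum_subtractf left_diff_distrib)
  finally show "comulH n \<mu> h (Gx (i mod int n) 1) (Gx (j mod int n) 1) =
      sg j * \<mu> * (h (Gx ((i + j) mod int n) 0) - h (Gx ((i + j + 2) mod int n) 0))"
    by (simp add: P)
qed

lemma sum_bv_pair:
  assumes "l1 \<in> basis n" "l2 \<in> basis n"
  shows "(\<Sum>b\<in>basis n. \<Sum>b'\<in>basis n. C b b' * (bv b l1 * bv b' l2 * y)) = C l1 l2 * (y :: 'k::field)"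
proof -
  have "(\<Sum>b\<in>basis n. \<Sum>b'\<in>basis n. C b b' * (bv b l1 * bv b' l2 * y)) =
    (\<Sum>b'\<in>basis n. C l1 b' * (bv l1 l1 * bv b' l2 * y))"
    by (rule sum_basis_pick[OF assms(1)]) (auto simp: bv_def)
  also have "\<dots> = C l1 l2 * (bv l1 l1 * bv l2 l2 * y)"
    by (rule sum_basis_pick[OF assms(2)]) (auto simp: bv_def)
  finally show ?thesis by (simp add: bv_def)
qed

text \<open>Here i, j are the weights of the entries a, b, and a1, b1 are their predecessors under
  the arrows. The last line is \<open>\<mu>\<close> times the commutator of the weight part of h
  with D; the index i + j - 2 is the weight before D is applied.\<close>

lemma ten_mod_act:
  fixes V W :: "'k::field hmod"
  assumes n: "even n" "n > 0"
    and V: "\<And>h v. v \<in> sp S \<Longrightarrow> act V h v a = h (Gx (i mod int n) 0) * v a + h (Gx ((i - 1) mod int n) 1) * (\<alpha> * v a1)"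
    and W: "\<And>h v. v \<in> sp S' \<Longrightarrow> act W h v b = h (Gx (j mod int n) 0) * v b + h (Gx ((j - 1) mod int n) 1) * (\<beta> * v b1)"
    and W0: "\<And>h. act W h 0 = 0"
    and z: "z \<in> sp (prs S S')"
  shows "act (ten_mod n \<mu> V W) h z (Pr a b) =
      h (Gx ((i + j) mod int n) 0) * z (Pr a b) +
      h (Gx ((i + j - 1) mod int n) 1) * (\<beta> * z (Pr a b1) + sg j * (\<alpha> * z (Pr a1 b))) +
      sg j * \<mu> * (h (Gx ((i + j) mod int n) 0) - h (Gx ((i + j - 2) mod int n) 0)) * (\<alpha> * (\<beta> * z (Pr a1 b1)))"
proof -
  have bas: "Gx (z mod int n) 0 \<in> basis n" "Gx (z mod int n) 1 \<in> basis n" for z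
    using n by auto
  have inner: "act W h (\<lambda>b'. z (Pr a' b')) b =
      h (Gx (j mod int n) 0) * z (Pr a' b) + h (Gx ((j - 1) mod int n) 1) * (\<beta> * z (Pr a' b1))" for h a'
    using W[OF prs_slice(1)[OF z]] by simp
  have sp: "(\<lambda>a'. act W h (\<lambda>b'. z (Pr a' b')) b) \<in> sp S" for h
    using prs_slice(3)[OF z] W0 by (auto simp: sp_def)
  have "tmap (act V h) (act W h') z (Pr a b) =
      h (Gx (i mod int n) 0) * h' (Gx (j mod int n) 0) * z (Pr a b) +
      h (Gx (i mod int n) 0) * h' (Gx ((j - 1) mod int n) 1) * (\<beta> * z (Pr a b1)) +
      h (Gx ((i - 1) mod int n) 1) * h' (Gx (j mod int n) 0) * (\<alpha> * z (Pr a1 b)) +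
      h (Gx ((i - 1) mod int n) 1) * h' (Gx ((j - 1) mod int n) 1) * (\<alpha> * (\<beta> * z (Pr a1 b1)))" for h h'
    using V[OF sp[of h'], of h] by (simp add: tmap_def inner algebra_simps)
  then have "act (ten_mod n \<mu> V W) h z (Pr a b) =
      comulH n \<mu> h (Gx (i mod int n) 0) (Gx (j mod int n) 0) * z (Pr a b) +
      comulH n \<mu> h (Gx (i mod int n) 0) (Gx ((j - 1) mod int n) 1) * (\<beta> * z (Pr a b1)) +
      comulH n \<mu> h (Gx ((i - 1) mod int n) 1) (Gx (j mod int n) 0) * (\<alpha> * z (Pr a1 b)) +
      comulH n \<mu> h (Gx ((i - 1) mod int n) 1) (Gx ((j - 1) mod int n) 1) * (\<alpha> * (\<beta> * z (Pr a1 b1)))"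
    by (simp add: ten_mod_def sum_fun_apply scl_def distrib_left sum.distrib
        sum_bv_pair[OF bas(1) bas(1)] sum_bv_pair[OF bas(1) bas(2)]
        sum_bv_pair[OF bas(2) bas(1)] sum_bv_pair[OF bas(2) bas(2)] del: One_nat_def)
  moreover have eqs: "i + (j - 1) = i + j - 1" "i - 1 + j = i + j - 1" "i - 1 + (j - 1) = i + j - 2"
    "i + j - 2 + 2 = i + j"
    by auto
  ultimately show ?thesis
    unfolding mulb_dual[OF n] eqs
    by (simp add: sg_simps algebra_simps)
qed

text \<open>
  The map \<open>v \<otimes> w \<mapsto> v \<otimes> w \<plusminus> \<mu> a v \<otimes> a w\<close> identifies the tensor product with the one for \<open>\<mu> = 0\<close>.
\<close>

lemma ten_Db_iso:
  fixes X X' :: "'k::field cpx"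
  assumes n: "even n" "n > 0" and p: "presents n X Y \<rho>" and p': "presents n X' Y' \<rho>'"
  shows "Db_iso n (ten n \<mu> X X') (realize n (tenb Y Y'))"
proof -
  note d = presentsD[OF p] and d' = presentsD[OF p']
  note w = wf_monoD[OF d(1)] and w' = wf_monoD[OF d'(1)]
  note z = presents_zero[OF p] and z' = presents_zero[OF p']
  let ?Z = "ten n \<mu> X X'" and ?T = "tenb Y Y'"
  define P where "P m r = prs (\<rho> ` hom_labs Y r) (\<rho>' ` hom_labs Y' (m - r))" for m r
  \<comment> \<open>The tag is the index of the summand of the total complex. It separates the
    degrees of the first factor, which makes \<open>\<sigma>\<close> injective although
    \<open>\<rho>\<close> and \<open>\<rho>'\<close> are injective only degreewise.\<close>
  define \<sigma> where "\<sigma> l = (case l of Pr x y \<Rightarrow> Tag (mcd Y x) (Pr (\<rho> x) (\<rho>' y)) | _ \<Rightarrow> l)" for l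
  define B where "B m = {l \<in> bB ?T. bcd ?T l = m}" for m
  define U where "U \<mu>' z = (\<lambda>l. z l + (case l of Pr x y \<Rightarrow>
      \<mu>' * sg (mwd Y' y) * (mca Y x * (mca Y' y * z (Pr (mpa Y x) (mpa Y' y)))) | _ \<Rightarrow> 0))" for \<mu>' and z :: "'k fvec"
  define R where "R m z = (\<lambda>l. if l \<in> B m then z (\<sigma> l) else 0)" for m and z :: "'k fvec"
  define \<Phi> where "\<Phi> m z = U \<mu> (R m z)" for m z
  have mod_carr: "carr (ten_mod n \<mu> (ob X r) (ob X' (m - r))) = sp (P m r)" for m r
    unfolding ten_mod_def P_def prs_def hmod.simps d(3) d'(3)
    by (intro tspace_sp finite_imageI finite_hom_labs[OF d(1)] finite_hom_labs[OF d'(1)])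
  have fin: "finite {r \<in> UNIV. P m r \<noteq> {}}" for m
  proof (rule finite_subset)
    show "{r \<in> UNIV. P m r \<noteq> {}} \<subseteq> mcd Y ` mB Y"
      by (auto simp: P_def prs_def hom_labs_def)
    show "finite (mcd Y ` mB Y)" using w(1) by simp
  qed
  have B_Pr: "Pr x y \<in> B m \<longleftrightarrow> x \<in> mB Y \<and> y \<in> mB Y' \<and> mcd Y x + mcd Y' y = m" for x y m
    by (auto simp: B_def tenb_simps)
  have B_cases: "\<exists>x y. l = Pr x y \<and> x \<in> hom_labs Y (mcd Y x) \<and> y \<in> hom_labs Y' (m - mcd Y x)" if "l \<in> B m" for l m
    using that by (auto simp: B_def tenb_simps hom_labs_def)
  have carrZ': "carr (ob ?Z m) = sp {Tag r l |r l. r \<in> UNIV \<and> l \<in> P m r}" for m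
    unfolding ten_def cpx.simps by (rule dsum_carr[OF mod_carr fin])
  have carrZ: "carr (ob ?Z m) = sp (\<sigma> ` B m)" for m
  proof -
    have "{Tag r l |r l. r \<in> UNIV \<and> l \<in> P m r} = \<sigma> ` B m"
    proof
      show "{Tag r l |r l. r \<in> UNIV \<and> l \<in> P m r} \<subseteq> \<sigma> ` B m"
      proof clarify
        fix r l assume "l \<in> P m r"
        then obtain x y where "l = Pr (\<rho> x) (\<rho>' y)" "x \<in> hom_labs Y r" "y \<in> hom_labs Y' (m - r)"
          by (auto simp: P_def prs_def)
        then show "Tag r l \<in> \<sigma> ` B m"
          by (intro image_eqI[of _ _ "Pr x y"]) (auto simp: \<sigma>_def B_Pr hom_labs_def)
      qed
      show "\<sigma> ` B m \<subseteq> {Tag r l |r l. r \<in> UNIV \<and> l \<in> P m r}"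
        using B_cases by (fastforce simp: \<sigma>_def P_def prs_def)
    qed
    then show ?thesis by (simp only: carrZ')
  qed
  have \<sigma>inj: "inj_on \<sigma> (B m)" for m
  proof (rule inj_onI)
    fix l l' assume l: "l \<in> B m" "l' \<in> B m" "\<sigma> l = \<sigma> l'"
    obtain x y where x: "l = Pr x y" "x \<in> hom_labs Y (mcd Y x)" "y \<in> hom_labs Y' (m - mcd Y x)"
      using B_cases[OF l(1)] by blast
    obtain x' y' where x': "l' = Pr x' y'" "x' \<in> hom_labs Y (mcd Y x')" "y' \<in> hom_labs Y' (m - mcd Y x')"
      using B_cases[OF l(2)] by blast
    show "l = l'"
      using l(3) x x' inj_onD[OF d(2)[of "mcd Y x"], of x x'] inj_onD[OF d'(2)[of "m - mcd Y x"], of y y']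
      by (simp add: \<sigma>_def)
  qed
  have cmpP: "cmp r z \<in> sp (P m r)" if "z \<in> carr (ob ?Z m)" for m r and z :: "'k fvec"
    using that unfolding carrZ' by (auto simp: sp_def cmp_def)
  have Zact: "act (ob ?Z m) h z = glue (\<lambda>r. act (ten_mod n \<mu> (ob X r) (ob X' (m - r))) h (cmp r z))" for m h z
    by (simp add: ten_def dsum_def)
  have Zdiff: "diff ?Z m z = glue (\<lambda>r. tmap (diff X (r - 1)) id (cmp (r - 1) z)
                           + scl (sg r) (tmap id (diff X' (m - r)) (cmp r z)))" for m z
    by (simp add: ten_def powi_minus_one)
  have glueZ: "glue u \<in> carr (ob ?Z m)" if "\<And>r. u r \<in> sp (P m r)" for u m
    using that unfolding carrZ' by (auto simp: sp_def glue_def split: lab.splits)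
  have act_cl: "act (ob ?Z m) h z \<in> carr (ob ?Z m)" if "z \<in> carr (ob ?Z m)" for m h z
    unfolding Zact
  proof (rule glueZ)
    fix r
    have "tmap (act (ob X r) g) (act (ob X' (m - r)) g') (cmp r z) \<in> sp (P m r)" for g g'
      unfolding P_def
      by (rule tmap_closed[OF _ _ _ _ cmpP[OF that, unfolded P_def]])
        (use d(4)[where m = r] d'(4)[where m = "m - r"] in \<open>simp_all add: d(3) d'(3) z z'\<close>)
    then show "act (ten_mod n \<mu> (ob X r) (ob X' (m - r))) h (cmp r z) \<in> sp (P m r)"
      unfolding ten_mod_def hmod.simps
      by (intro fvec.subspace_sum[OF sp_subspace] fvec.subspace_scale[OF sp_subspace])
  qed
  have diff_cl: "diff ?Z m z \<in> carr (ob ?Z (m + 1))" if "z \<in> carr (ob ?Z m)" for m z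
    unfolding Zdiff
  proof (rule glueZ)
    fix r
    have eq: "m - (r - 1) = m + 1 - r" "m - r + 1 = m + 1 - r" by auto
    have "tmap (diff X (r - 1)) id (cmp (r - 1) z) \<in> sp (P (m + 1) r)"
      unfolding P_def
      by (rule tmap_closed[OF _ _ _ _ cmpP[OF that, unfolded P_def, where r = "r - 1", unfolded eq]])
        (use d(5)[where m = "r - 1"] in \<open>simp_all add: d(3) z\<close>)
    moreover have "tmap id (diff X' (m - r)) (cmp r z) \<in> sp (P (m + 1) r)"
      unfolding P_def
      by (rule tmap_closed[OF _ _ _ _ cmpP[OF that, unfolded P_def]])
        (use d'(5)[where m = "m - r"] in \<open>simp_all add: d'(3) z' eq\<close>)
    ultimately show "tmap (diff X (r - 1)) id (cmp (r - 1) z)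
                           + scl (sg r) (tmap id (diff X' (m - r)) (cmp r z)) \<in> sp (P (m + 1) r)"
      by (intro fvec.subspace_add[OF sp_subspace] fvec.subspace_scale[OF sp_subspace])
  qed
  have grT: "gr ?T m = sp (B m)" for m
    by (simp add: gr_def B_def)
  \<comment> \<open>\<open>U \<mu>'\<close> is 1 + \<open>\<mu>'\<close> D, and D squares to zero
    since \<open>mca\<close> vanishes at \<open>mpa Y x\<close>.\<close>
  have U_inv: "U (- \<mu>') (U \<mu>' z) = z" for \<mu>' z
  proof
    fix l
    show "U (- \<mu>') (U \<mu>' z) l = z l"
    proof (cases l)
      case (Pr x y)
      then show ?thesis
        using w(2)[of x] by (cases "mca Y x = 0") (auto simp: U_def algebra_simps)
    qed (auto simp: U_def)
  qed
  have U_sp: "U \<mu>' z \<in> sp (B m)" if "z \<in> sp (B m)" for m \<mu>' z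
    unfolding sp_def
  proof (intro CollectI allI impI)
    fix l assume l: "l \<notin> B m"
    then have zl: "z l = 0" using that by (simp add: sp_def)
    show "U \<mu>' z l = 0"
    proof (cases l)
      case (Pr x y)
      have "mca Y x = 0 \<or> mca Y' y = 0 \<or> Pr (mpa Y x) (mpa Y' y) \<notin> B m"
        using w(2)[of x] w'(2)[of y] l Pr by (auto simp: B_Pr)
      then show ?thesis
        using zl that Pr by (auto simp: U_def sp_def)
    qed (use zl in \<open>auto simp: U_def\<close>)
  qed
  have bijU: "bij_betw (U \<mu>) (sp (B m)) (sp (B m))" for m
    using U_inv[of "- \<mu>"] U_inv[of \<mu>] U_sp
    by (intro bij_betw_byWitness[where f' = "U (- \<mu>)"]) auto
  have bij: "bij_betw (\<Phi> m) (carr (ob ?Z m)) (gr ?T m)" for m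
    using bij_betw_trans[OF relabel_bij[OF \<sigma>inj] bijU]
    unfolding grT carrZ \<Phi>_def R_def comp_def .
  have RPr: "R m z (Pr x y) = (if x \<in> mB Y \<and> y \<in> mB Y' \<and> mcd Y x + mcd Y' y = m
      then cmp (mcd Y x) z (Pr (\<rho> x) (\<rho>' y)) else 0)" for m z x y
    by (simp add: R_def B_Pr \<sigma>_def cmp_def)
  have Rother: "R m z (Gx i j) = 0" "R m z (Tag r l) = 0" for m z i j r l
    by (auto simp: R_def B_def tenb_simps)
  have Ract: "R m (act (ob ?Z m) h z) (Pr x y) =
      h (Gx ((mwd Y x + mwd Y' y) mod int n) 0) * R m z (Pr x y) +
      h (Gx ((mwd Y x + mwd Y' y - 1) mod int n) 1) *
        (mca Y' y * R m z (Pr x (mpa Y' y)) + sg (mwd Y' y) * (mca Y x * R m z (Pr (mpa Y x) y))) +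
      sg (mwd Y' y) * \<mu> * (h (Gx ((mwd Y x + mwd Y' y) mod int n) 0) - h (Gx ((mwd Y x + mwd Y' y - 2) mod int n) 0)) *
        (mca Y x * (mca Y' y * R m z (Pr (mpa Y x) (mpa Y' y))))"
    if zc: "z \<in> carr (ob ?Z m)" for m h z x y
  proof (cases "x \<in> mB Y \<and> y \<in> mB Y' \<and> mcd Y x + mcd Y' y = m")
    case True
    define r where "r = mcd Y x"
    have xy: "x \<in> hom_labs Y r" "y \<in> hom_labs Y' (m - r)"
      using True by (auto simp: hom_labs_def r_def)
    have "R m (act (ob ?Z m) h z) (Pr x y) = act (ten_mod n \<mu> (ob X r) (ob X' (m - r))) h (cmp r z) (Pr (\<rho> x) (\<rho>' y))"
      using True by (simp add: RPr Zact cmp_def glue_def r_def)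
    also have "\<dots> = h (Gx ((mwd Y x + mwd Y' y) mod int n) 0) * cmp r z (Pr (\<rho> x) (\<rho>' y)) +
      h (Gx ((mwd Y x + mwd Y' y - 1) mod int n) 1) *
        (mca Y' y * cmp r z (Pr (\<rho> x) (\<rho>' (mpa Y' y))) + sg (mwd Y' y) * (mca Y x * cmp r z (Pr (\<rho> (mpa Y x)) (\<rho>' y)))) +
      sg (mwd Y' y) * \<mu> * (h (Gx ((mwd Y x + mwd Y' y) mod int n) 0) - h (Gx ((mwd Y x + mwd Y' y - 2) mod int n) 0)) *
        (mca Y x * (mca Y' y * cmp r z (Pr (\<rho> (mpa Y x)) (\<rho>' (mpa Y' y)))))"
      by (rule ten_mod_act[OF n _ _ z'(1) cmpP[OF zc, of r, unfolded P_def]])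
        (use d(6)[OF _ xy(1)] d'(6)[OF _ xy(2)] in \<open>simp_all add: d(3) d'(3)\<close>)
    finally show ?thesis
      using True w(2)[of x] w'(2)[of y]
      by (cases "mca Y x = 0"; cases "mca Y' y = 0") (simp_all add: RPr r_def)
  next
    case False
    then show ?thesis
      using w(2)[of x] w'(2)[of y]
      by (cases "mca Y x = 0"; cases "mca Y' y = 0") (auto simp: RPr)
  qed
  have \<Phi>_act: "\<Phi> m (act (ob ?Z m) h z) = bact n ?T h (\<Phi> m z)" if zc: "z \<in> carr (ob ?Z m)" for m h z
  proof (rule lab_fun_eqI)
    fix x y
    let ?W = "mwd Y x + mwd Y' y"
    have W2: "mwd Y (mpa Y x) + mwd Y' (mpa Y' y) = ?W - 2" if "mca Y x \<noteq> 0" "mca Y' y \<noteq> 0"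
      using that w(2)[of x] w'(2)[of y] by simp
    \<comment> \<open>D annihilates the image of a and of D, so under D only the weight part of the
      action survives, taken at weight W - 2. It cancels the second half of the commutator in
      \<open>Ract\<close>.\<close>
    have r1: "mca Y x * (mca Y' y * R m (act (ob ?Z m) h z) (Pr (mpa Y x) (mpa Y' y))) =
        mca Y x * (mca Y' y * (h (Gx ((?W - 2) mod int n) 0) * R m z (Pr (mpa Y x) (mpa Y' y))))"
    proof (cases "mca Y x = 0 \<or> mca Y' y = 0")
      case False
      then have c: "mca Y x \<noteq> 0" "mca Y' y \<noteq> 0" by auto
      then have c0: "mca Y (mpa Y x) = 0" "mca Y' (mpa Y' y) = 0"
        using w(2)[of x] w'(2)[of y] by auto
      show ?thesis
        unfolding Ract[OF zc] W2[OF c] c0 by simp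
    qed auto
    have b1: "ba ?T (\<Phi> m z) (Pr x y) =
        mca Y' y * R m z (Pr x (mpa Y' y)) + sg (mwd Y' y) * (mca Y x * R m z (Pr (mpa Y x) y))"
      using w(2)[of x] w'(2)[of y]
      by (cases "mca Y x = 0"; cases "mca Y' y = 0") (simp_all add: \<Phi>_def U_def tenb_simps)
    have P1: "\<Phi> m v (Pr x y) = R m v (Pr x y) + \<mu> * sg (mwd Y' y) * (mca Y x * (mca Y' y * R m v (Pr (mpa Y x) (mpa Y' y))))" for v
      by (simp add: \<Phi>_def U_def)
    show "\<Phi> m (act (ob ?Z m) h z) (Pr x y) = bact n ?T h (\<Phi> m z) (Pr x y)"
      unfolding bact_def b1
      unfolding tenb_simps P1[of z] P1[of "act (ob ?Z m) h z"] r1 Ract[OF zc, of h x y]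
      by (simp add: algebra_simps)
  qed (auto simp: \<Phi>_def U_def Rother bact_def tenb_simps)
  have Rdiff: "R (m + 1) (diff ?Z m z) (Pr x y) =
      mcf Y x * R m z (Pr (mpd Y x) y) + sg (mcd Y x) * (mcf Y' y * R m z (Pr x (mpd Y' y)))"
    if zc: "z \<in> carr (ob ?Z m)" for m z x y
  proof (cases "x \<in> mB Y \<and> y \<in> mB Y' \<and> mcd Y x + mcd Y' y = m + 1")
    case True
    define r where "r = mcd Y x"
    have xy: "x \<in> hom_labs Y (r - 1 + 1)" "y \<in> hom_labs Y' (m - r + 1)"
      using True by (auto simp: hom_labs_def r_def)
    have 1: "(\<lambda>a. cmp (r - 1) z (Pr a (\<rho>' y))) \<in> carr (ob X (r - 1))"
      using prs_slice(2)[OF cmpP[OF zc, of "r - 1", unfolded P_def]] by (simp add: d(3))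
    have 2: "(\<lambda>b. cmp r z (Pr (\<rho> x) b)) \<in> carr (ob X' (m - r))"
      using prs_slice(1)[OF cmpP[OF zc, of r, unfolded P_def]] by (simp add: d'(3))
    have "R (m + 1) (diff ?Z m z) (Pr x y) =
        diff X (r - 1) (\<lambda>a. cmp (r - 1) z (Pr a (\<rho>' y))) (\<rho> x) + sg r * diff X' (m - r) (\<lambda>b. cmp r z (Pr (\<rho> x) b)) (\<rho>' y)"
      using True by (simp add: RPr Zdiff cmp_def glue_def r_def tmap_def scl_def)
    also have "\<dots> = mcf Y x * cmp (r - 1) z (Pr (\<rho> (mpd Y x)) (\<rho>' y)) + sg r * (mcf Y' y * cmp r z (Pr (\<rho> x) (\<rho>' (mpd Y' y))))"
      unfolding d(7)[OF 1 xy(1)] d'(7)[OF 2 xy(2)] ..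
    finally show ?thesis
      using True w(3)[of x] w'(3)[of y]
      by (cases "mcf Y x = 0"; cases "mcf Y' y = 0") (simp_all add: RPr r_def)
  next
    case False
    then show ?thesis
      using w(3)[of x] w'(3)[of y]
      by (cases "mcf Y x = 0"; cases "mcf Y' y = 0") (auto simp: RPr)
  qed
  \<comment> \<open>The composites of D with the differential vanish in both orders, because no two
    steps of the models can be composed.\<close>
  have \<Phi>_diff: "\<Phi> (m + 1) (diff ?Z m z) = bd ?T (\<Phi> m z)" if zc: "z \<in> carr (ob ?Z m)" for m z
  proof (rule lab_fun_eqI)
    fix x y
    show "\<Phi> (m + 1) (diff ?Z m z) (Pr x y) = bd ?T (\<Phi> m z) (Pr x y)"
      using w(2)[of x] w'(2)[of y] w(3)[of x] w'(3)[of y]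
      by (cases "mca Y x = 0"; cases "mca Y' y = 0"; cases "mcf Y x = 0"; cases "mcf Y' y = 0")
        (simp_all add: \<Phi>_def U_def Rdiff[OF zc] tenb_simps)
  qed (auto simp: \<Phi>_def U_def Rother tenb_simps)
  show ?thesis
  proof (rule bcomplex_transport(2)[OF n(2) wf_tenb[OF d(1) d'(1)], where S = "\<lambda>m. \<sigma> ` B m" and \<Phi> = \<Phi>])
    show "finite (\<sigma> ` B m)" for m
      using wf_tenb[OF d(1) d'(1)] by (simp add: B_def wf_bic_def)
    show "\<Phi> m (v + w) = \<Phi> m v + \<Phi> m w" for m v w
      by (auto simp: \<Phi>_def U_def R_def fun_eq_iff algebra_simps split: lab.splits)
    show "\<Phi> m (scl c v) = scl c (\<Phi> m v)" for m c v
      by (auto simp: \<Phi>_def U_def R_def fun_eq_iff scl_def algebra_simps split: lab.splits)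
  qed (fact carrZ act_cl diff_cl bij \<Phi>_act \<Phi>_diff)+
qed

section \<open>Models of the complexes \<open>M\<close>, \<open>N\<close> and of direct sums\<close>

text \<open>\<open>Gx m 0\<close> and \<open>Gx m 1\<close> stand for e_(i-m) and a_(i-m) in
  P_(i-m). The latter has weight i - m + 1, being the arrow that ends there. Multiplication by
  a_(i-m) on the right takes \<open>Gx (m - 1) 0\<close> to \<open>Gx m 1\<close>, and
  \<open>sg p\<close> is the sign of the shift.\<close>

definition M_mono :: "int \<Rightarrow> nat \<Rightarrow> int \<Rightarrow> 'k::field mono" where
  "M_mono i k p = \<lparr>mB = {Gx m s |m s. 0 \<le> m \<and> m \<le> int k \<and> s < 2},
     mcd = (\<lambda>l. case l of Gx m s \<Rightarrow> m - p | _ \<Rightarrow> 0),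
     mwd = (\<lambda>l. case l of Gx m s \<Rightarrow> i - m + int s | _ \<Rightarrow> 0),
     mca = (\<lambda>l. case l of Gx m s \<Rightarrow> if s = 1 \<and> 0 \<le> m \<and> m \<le> int k then 1 else 0 | _ \<Rightarrow> 0),
     mpa = (\<lambda>l. case l of Gx m s \<Rightarrow> Gx m 0 | _ \<Rightarrow> l),
     mcf = (\<lambda>l. case l of Gx m s \<Rightarrow> if s = 1 \<and> 1 \<le> m \<and> m \<le> int k then sg p else 0 | _ \<Rightarrow> 0),
     mpd = (\<lambda>l. case l of Gx m s \<Rightarrow> Gx (m - 1) 0 | _ \<Rightarrow> l)\<rparr>"

text \<open>\<open>Gx 0 1\<close> spans the kernel term of \<open>N\<^sub>i\<close>; \<open>Gx 1 s\<close> and \<open>Gx 2 s\<close> span \<open>P\<^sub>i\<^sub>+\<^sub>1\<close> and \<open>P\<^sub>i\<close>.\<close>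

definition N_mono :: "int \<Rightarrow> int \<Rightarrow> 'k::field mono" where
  "N_mono i p = \<lparr>mB = {Gx 0 1, Gx 1 0, Gx 1 1, Gx 2 0, Gx 2 1},
     mcd = (\<lambda>l. case l of Gx m s \<Rightarrow> m - p | _ \<Rightarrow> 0),
     mwd = (\<lambda>l. case l of Gx m s \<Rightarrow> (if m = 2 then i else i + 1) + int s | _ \<Rightarrow> 0),
     mca = (\<lambda>l. case l of Gx m s \<Rightarrow> if s = 1 \<and> (m = 1 \<or> m = 2) then 1 else 0 | _ \<Rightarrow> 0),
     mpa = (\<lambda>l. case l of Gx m s \<Rightarrow> Gx m 0 | _ \<Rightarrow> l),
     mcf = (\<lambda>l. case l of Gx m s \<Rightarrow> if s = 1 \<and> (m = 1 \<or> m = 2) then sg p else 0 | _ \<Rightarrow> 0),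
     mpd = (\<lambda>l. case l of Gx m s \<Rightarrow> if m = 1 then Gx 0 1 else Gx 1 0 | _ \<Rightarrow> l)\<rparr>"

definition dsum_mono :: "'k::field mono \<Rightarrow> 'k mono \<Rightarrow> 'k mono" where
  "dsum_mono Y Y' = \<lparr>mB = Tag 0 ` mB Y \<union> Tag 1 ` mB Y',
     mcd = (\<lambda>l. case l of Tag r x \<Rightarrow> if r = 0 then mcd Y x else mcd Y' x | _ \<Rightarrow> 0),
     mwd = (\<lambda>l. case l of Tag r x \<Rightarrow> if r = 0 then mwd Y x else mwd Y' x | _ \<Rightarrow> 0),
     mca = (\<lambda>l. case l of Tag r x \<Rightarrow> if r = 0 then mca Y x else if r = 1 then mca Y' x else 0 | _ \<Rightarrow> 0),
     mpa = (\<lambda>l. case l of Tag r x \<Rightarrow> Tag r (if r = 0 then mpa Y x else mpa Y' x) | _ \<Rightarrow> l),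
     mcf = (\<lambda>l. case l of Tag r x \<Rightarrow> if r = 0 then mcf Y x else if r = 1 then mcf Y' x else 0 | _ \<Rightarrow> 0),
     mpd = (\<lambda>l. case l of Tag r x \<Rightarrow> Tag r (if r = 0 then mpd Y x else mpd Y' x) | _ \<Rightarrow> l)\<rparr>"

lemma M_mono_simps:
  "Gx m s \<in> mB (M_mono i k p) \<longleftrightarrow> 0 \<le> m \<and> m \<le> int k \<and> s < 2"
  "mcd (M_mono i k p) (Gx m s) = m - p"
  "mwd (M_mono i k p) (Gx m s) = i - m + int s"
  "mca (M_mono i k p) (Gx m s) = (if s = 1 \<and> 0 \<le> m \<and> m \<le> int k then 1 else 0)"
  "mpa (M_mono i k p) (Gx m s) = Gx m 0"
  "mcf (M_mono i k p) (Gx m s) = (if s = 1 \<and> 1 \<le> m \<and> m \<le> int k then sg p else 0)"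
  "mpd (M_mono i k p) (Gx m s) = Gx (m - 1) 0"
  by (simp_all add: M_mono_def)

lemma N_mono_simps:
  "mB (N_mono i p) = {Gx 0 1, Gx 1 0, Gx 1 1, Gx 2 0, Gx 2 1}"
  "mcd (N_mono i p) (Gx m s) = m - p"
  "mwd (N_mono i p) (Gx m s) = (if m = 2 then i else i + 1) + int s"
  "mca (N_mono i p) (Gx m s) = (if s = 1 \<and> (m = 1 \<or> m = 2) then 1 else 0)"
  "mpa (N_mono i p) (Gx m s) = Gx m 0"
  "mcf (N_mono i p) (Gx m s) = (if s = 1 \<and> (m = 1 \<or> m = 2) then sg p else 0)"
  "mpd (N_mono i p) (Gx m s) = (if m = 1 then Gx 0 1 else Gx 1 0)"
  by (simp_all add: N_mono_def)

lemma dsum_mono_simps: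
  "mB (dsum_mono Y Y') = Tag 0 ` mB Y \<union> Tag 1 ` mB Y'"
  "mcd (dsum_mono Y Y') (Tag r x) = (if r = 0 then mcd Y x else mcd Y' x)"
  "mwd (dsum_mono Y Y') (Tag r x) = (if r = 0 then mwd Y x else mwd Y' x)"
  "mca (dsum_mono Y Y') (Tag r x) = (if r = 0 then mca Y x else if r = 1 then mca Y' x else 0)"
  "mpa (dsum_mono Y Y') (Tag r x) = Tag r (if r = 0 then mpa Y x else mpa Y' x)"
  "mcf (dsum_mono Y Y') (Tag r x) = (if r = 0 then mcf Y x else if r = 1 then mcf Y' x else 0)"
  "mpd (dsum_mono Y Y') (Tag r x) = Tag r (if r = 0 then mpd Y x else mpd Y' x)"
  by (simp_all add: dsum_mono_def)

lemma wf_M_mono: "wf_mono (M_mono i k p :: 'k::field mono)"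
proof -
  have "{Gx m s |m s. 0 \<le> m \<and> m \<le> int k \<and> s < 2} = (\<lambda>(m, s). Gx m s) ` ({0..int k} \<times> {..<2})"
    by auto
  then show ?thesis
    by (auto simp: wf_mono_def M_mono_def split: lab.splits if_splits)
qed

lemma wf_N_mono: "wf_mono (N_mono i p :: 'k::field mono)"
  by (auto simp: wf_mono_def N_mono_def split: lab.splits if_splits)

lemma wf_dsum_mono:
  assumes "wf_mono Y" "wf_mono Y'"
  shows "wf_mono (dsum_mono Y Y')"
  using assms by (auto simp: wf_mono_def dsum_mono_def split: lab.splits if_splits)

section \<open>Coordinates of the projective modules, presentations of \<open>M\<close>,
  \<open>N\<close> and direct sums\<close>

lemma basis_cases:
  assumes "l \<in> basis n"
  obtains c where "l = Gx (c mod int n) 0" | c where "l = Gx (c mod int n) 1"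
proof -
  obtain c s where cs: "l = Gx c s" "0 \<le> c" "c < int n" "s = 0 \<or> s = 1"
    using assms by (auto simp: basis_def less_2_cases_iff)
  then have "l = Gx (c mod int n) s" by simp
  with cs that show ?thesis by blast
qed

lemma sp_remove:
  assumes "a \<notin> S"
  shows "v \<in> sp (insert a S) \<and> v a = 0 \<longleftrightarrow> v \<in> sp S"
proof
  assume v: "v \<in> sp (insert a S) \<and> v a = 0"
  have "v l = 0" if "l \<notin> S" for l
    using v that by (cases "l = a") (auto simp: sp_def)
  then show "v \<in> sp S" by (simp add: sp_def)
qed (use assms in \<open>auto simp: sp_def\<close>)

lemma mod_basis: "n > 0 \<Longrightarrow> Gx (c mod int n) 0 \<in> basis n" "n > 0 \<Longrightarrow> Gx (c mod int n) 1 \<in> basis n"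
  by auto

lemma mulH_idem:
  assumes "n > 0" 
  shows "mulH n h (idem n i) l = (if l = Gx (i mod int n) 0 \<or> l = Gx (i mod int n) 1 then h l else 0)"
proof (cases "l \<in> basis n")
  case True
  then show ?thesis
    by (cases rule: basis_cases)
      (auto simp: mulH_coord(1)[OF assms] mulH_coord(2)[OF assms] idem_def bv_def simp del: One_nat_def)
next
  case False
  then show ?thesis
    using mulH_coord(3)[OF assms False, of h "idem n i"] mod_basis[OF assms, of i] by metis
qed

lemma carr_Pmod:
  fixes i :: int
  assumes n: "n > 0"
  shows "carr (Pmod n i) = (sp {Gx (i mod int n) 0, Gx (i mod int n) 1} :: 'k::field fvec set)"
proof
  show "carr (Pmod n i) \<subseteq> (sp {Gx (i mod int n) 0, Gx (i mod int n) 1} :: 'k fvec set)"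
    by (auto simp: Pmod_def sp_def mulH_idem[OF n])
  show "(sp {Gx (i mod int n) 0, Gx (i mod int n) 1} :: 'k fvec set) \<subseteq> carr (Pmod n i)"
  proof
    fix v :: "'k fvec" assume v: "v \<in> sp {Gx (i mod int n) 0, Gx (i mod int n) 1}"
    have "v = mulH n v (idem n i)"
      using v by (auto simp: fun_eq_iff mulH_idem[OF n] sp_def)
    moreover have "v \<in> Hset n"
      unfolding Hset_def
    proof (intro CollectI allI impI)
      fix l assume "l \<notin> basis n"
      then have "l \<noteq> Gx (i mod int n) 0 \<and> l \<noteq> Gx (i mod int n) 1"
        using mod_basis[OF n, of i] by blast
      then show "v l = 0" using v by (simp add: sp_def)
    qed
    ultimately show "v \<in> carr (Pmod n i)"
      unfolding Pmod_def hmod.simps by blast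
  qed
qed

lemma amap_coord:
  assumes n: "n > 0"
  shows "amap n i u l = (if l = Gx (i mod int n) 1 then u (Gx ((i + 1) mod int n) 0) else 0)"
proof (cases "l \<in> basis n")
  case True
  then show ?thesis
  proof (cases rule: basis_cases)
    case (1 c)
    then show ?thesis by (simp add: amap_def mulH_coord(1)[OF n] arrow_def bv_def)
  next
    case (2 c)
    have "(c + 1) mod int n = (i + 1) mod int n" if "c mod int n = i mod int n"
      using that by (rule mod_add_cong) simp
    then show ?thesis
      using 2 by (auto simp: amap_def mulH_coord(2)[OF n] arrow_def bv_def simp del: One_nat_def)
  qed
next
  case False
  then show ?thesis
    using mulH_coord(3)[OF n False, of u "arrow n i"] mod_basis[OF n, of i] unfolding amap_def by metis
qed

lemma carr_kera:
  assumes n: "n > 0"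
  shows "carr (kera n i) = (sp {Gx ((i + 1) mod int n) 1} :: 'k::field fvec set)"
proof -
  have "amap n i u = 0 \<longleftrightarrow> u (Gx ((i + 1) mod int n) 0) = 0" for u :: "'k fvec"
    by (auto simp: fun_eq_iff amap_coord[OF n])
  then show ?thesis
    using sp_remove[of "Gx ((i + 1) mod int n) 0" "{Gx ((i + 1) mod int n) 1}"]
    unfolding kera_def hmod.simps carr_Pmod[OF n] by auto
qed

lemma mulH_sp:
  assumes n: "n > 0" and v: "v \<in> sp {Gx (c mod int n) 0, Gx (c mod int n) 1}"
  shows "mulH n h v \<in> sp {Gx (c mod int n) 0, Gx (c mod int n) 1}"
    and "v (Gx (c mod int n) 0) = 0 \<Longrightarrow> mulH n h v \<in> sp {Gx (c mod int n) 1}"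
proof -
  have *: "mulH n h v l = 0" if "l \<noteq> Gx (c mod int n) 0" "l \<noteq> Gx (c mod int n) 1" for l
  proof (cases "l \<in> basis n")
    case True
    then show ?thesis
      using that v by (cases rule: basis_cases)
        (auto simp: mulH_coord(1)[OF n] mulH_coord(2)[OF n] sp_def simp del: One_nat_def)
  next
    case False
    then show ?thesis by (rule mulH_coord(3)[OF n])
  qed
  then show "mulH n h v \<in> sp {Gx (c mod int n) 0, Gx (c mod int n) 1}"
    by (simp add: sp_def)
  show "mulH n h v \<in> sp {Gx (c mod int n) 1}" if "v (Gx (c mod int n) 0) = 0"
  proof -
    have "mulH n h v (Gx (c mod int n) 0) = 0"
      using that by (simp add: mulH_coord(1)[OF n])
    then show ?thesis
      using sp_remove[of "Gx (c mod int n) 0" "{Gx (c mod int n) 1}" "mulH n h v"]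
        \<open>mulH n h v \<in> sp {Gx (c mod int n) 0, Gx (c mod int n) 1}\<close> by simp
  qed
qed

lemma act_Pmod: "act (Pmod n i) = mulH n" "act (kera n i) = mulH n"
  by (simp_all add: Pmod_def kera_def)

lemma presents_M:
  assumes n: "n > 0"
  shows "presents n (shift p (Mcpx n i (i - int k)) :: 'k::field cpx) (M_mono i k p)
    (\<lambda>l. case l of Gx m s \<Rightarrow> Gx ((i - m) mod int n) s | _ \<Rightarrow> l)"
    (is "presents n ?X ?Y ?\<rho>")
proof -
  have labs: "hom_labs ?Y m = (if 0 \<le> m + p \<and> m + p \<le> int k then {Gx (m + p) 0, Gx (m + p) 1} else {})" for m
    by (auto simp: hom_labs_def M_mono_def less_2_cases_iff)
  have obX: "ob ?X m = (if 0 \<le> m + p \<and> m + p \<le> int k then Pmod n (i - (m + p)) else zero_mod)" for m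
    by (simp add: shift_def Mcpx_def)
  have dX: "diff ?X m v = (if 0 \<le> m + p \<and> m + p < int k then scl (sg p) (amap n (i - (m + p) - 1) v) else 0)" for m v
    by (simp add: shift_def Mcpx_def powi_minus_one scl_def fun_eq_iff)
  have carr: "carr (ob ?X m) = (if 0 \<le> m + p \<and> m + p \<le> int k
      then sp {Gx ((i - (m + p)) mod int n) 0, Gx ((i - (m + p)) mod int n) 1} else {0})" for m
    by (simp add: obX carr_Pmod[OF n] zero_mod_def)
  have sp_empty: "sp {} = ({0} :: 'k fvec set)"
    by (auto simp: sp_def)
  show ?thesis
    unfolding presents_def
  proof (intro conjI allI ballI)
    fix m
    show "wf_mono ?Y" by (rule wf_M_mono)
    show "inj_on ?\<rho> (hom_labs ?Y m)"
      by (auto simp: labs inj_on_def)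
    show "carr (ob ?X m) = sp (?\<rho> ` hom_labs ?Y m)"
      by (simp add: carr labs sp_empty)
    fix v assume v: "v \<in> carr (ob ?X m)"
    show "act (ob ?X m) h v \<in> carr (ob ?X m)" for h
      using v mulH_sp(1)[OF n, of v "i - (m + p)" h]
      unfolding carr unfolding obX by (auto simp: act_Pmod zero_mod_def split: if_splits)
    show "diff ?X m v \<in> carr (ob ?X (m + 1))"
      unfolding dX carr using n
      by (auto simp: sp_def amap_coord[OF n] scl_def fun_eq_iff algebra_simps)
    show "act (ob ?X m) h v (?\<rho> l) = h (Gx (mwd ?Y l mod int n) 0) * v (?\<rho> l) +
        h (Gx ((mwd ?Y l - 1) mod int n) 1) * (mca ?Y l * v (?\<rho> (mpa ?Y l)))"
      if l: "l \<in> hom_labs ?Y m" for l h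
    proof -
      have r: "0 \<le> m + p \<and> m + p \<le> int k" and "l = Gx (m + p) 0 \<or> l = Gx (m + p) 1"
        using l by (auto simp: labs split: if_splits)
      then show ?thesis
        using mulH_coord(1)[OF n, of h v "i - (m + p)"] mulH_coord(2)[OF n, of h v "i - (m + p)"]
        by (elim disjE) (simp_all add: obX act_Pmod M_mono_simps)
    qed
    show "diff ?X m v (?\<rho> l) = mcf ?Y l * v (?\<rho> (mpd ?Y l))"
      if l: "l \<in> hom_labs ?Y (m + 1)" for l
    proof -
      have r: "0 \<le> m + p + 1 \<and> m + p + 1 \<le> int k" and l: "l = Gx (m + p + 1) 0 \<or> l = Gx (m + p + 1) 1"
        using l by (auto simp: labs ac_simps split: if_splits)
      have eq: "i - (m + p + 1) = i - (m + p) - 1" "m + p + 1 - 1 = m + p" by auto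
      have "v = 0" if "m + p < 0" using that v by (simp add: carr)
      then show ?thesis
        using l r by (elim disjE) (auto simp: dX M_mono_simps amap_coord[OF n] scl_def eq)
    qed
  qed
qed

lemma presents_N:
  assumes n: "n > 0"
  shows "presents n (shift p (Ncpx n i) :: 'k::field cpx) (N_mono i p)
    (\<lambda>l. case l of Gx m s \<Rightarrow> Gx ((if m = 2 then i else i + 1) mod int n) s | _ \<Rightarrow> l)"
    (is "presents n ?X ?Y ?\<rho>")
proof -
  have labs: "hom_labs ?Y m = (if m + p = 0 then {Gx 0 1} else if m + p = 1 then {Gx 1 0, Gx 1 1}
      else if m + p = 2 then {Gx 2 0, Gx 2 1} else {})" for m
    by (auto simp: hom_labs_def N_mono_def)
  have obX: "ob ?X m = (if m + p = 0 then kera n i else if m + p = 1 then Pmod n (i + 1)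
                         else if m + p = 2 then Pmod n i else zero_mod)" for m
    by (simp add: shift_def Ncpx_def)
  have dX: "diff ?X m v = (if m + p = 0 then scl (sg p) v else if m + p = 1 then scl (sg p) (amap n i v) else 0)" for m v
    by (simp add: shift_def Ncpx_def powi_minus_one scl_def fun_eq_iff)
  have carr: "carr (ob ?X m) = (if m + p = 0 then sp {Gx ((i + 1) mod int n) 1}
      else if m + p = 1 then sp {Gx ((i + 1) mod int n) 0, Gx ((i + 1) mod int n) 1}
      else if m + p = 2 then sp {Gx (i mod int n) 0, Gx (i mod int n) 1} else {0})" for m
    by (simp add: obX carr_Pmod[OF n] carr_kera[OF n] zero_mod_def)
  have sp_empty: "sp {} = ({0} :: 'k fvec set)"
    by (auto simp: sp_def)
  show ?thesis
    unfolding presents_def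
  proof (intro conjI allI ballI)
    fix m
    show "wf_mono ?Y" by (rule wf_N_mono)
    show "inj_on ?\<rho> (hom_labs ?Y m)"
      by (auto simp: labs inj_on_def)
    show "carr (ob ?X m) = sp (?\<rho> ` hom_labs ?Y m)"
      by (simp add: carr labs sp_empty)
    fix v assume v: "v \<in> carr (ob ?X m)"
    consider (0) "m + p = 0" | (1) "m + p = 1" | (2) "m + p = 2" | (3) "m + p \<noteq> 0" "m + p \<noteq> 1" "m + p \<noteq> 2"
      by blast
    note deg = this
    show "act (ob ?X m) h v \<in> carr (ob ?X m)" for h
    proof (cases rule: deg)
      case 0
      then have "v \<in> sp {Gx ((i + 1) mod int n) 0, Gx ((i + 1) mod int n) 1}" "v (Gx ((i + 1) mod int n) 0) = 0"
        using v by (auto simp: carr sp_def)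
      from mulH_sp(2)[OF n this] 0 show ?thesis unfolding carr unfolding obX by (simp add: act_Pmod)
    qed (use v mulH_sp(1)[OF n, of v "i + 1" h] mulH_sp(1)[OF n, of v i h] in
        \<open>unfold carr, unfold obX, auto simp: act_Pmod zero_mod_def\<close>)
    show "diff ?X m v \<in> carr (ob ?X (m + 1))"
      using v unfolding dX carr using n
      by (auto simp: sp_def amap_coord[OF n] scl_def fun_eq_iff split: if_splits)
    show "act (ob ?X m) h v (?\<rho> l) = h (Gx (mwd ?Y l mod int n) 0) * v (?\<rho> l) +
        h (Gx ((mwd ?Y l - 1) mod int n) 1) * (mca ?Y l * v (?\<rho> (mpa ?Y l)))"
      if l: "l \<in> hom_labs ?Y m" for l h
      using l v[unfolded carr] mulH_coord(1)[OF n, of h v "i + 1"] mulH_coord(2)[OF n, of h v "i + 1"]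
        mulH_coord(1)[OF n, of h v i] mulH_coord(2)[OF n, of h v i]
      by (cases rule: deg)
        (auto simp: labs sp_def obX act_Pmod N_mono_simps add.commute[of 1 i])
    show "diff ?X m v (?\<rho> l) = mcf ?Y l * v (?\<rho> (mpd ?Y l))"
      if l: "l \<in> hom_labs ?Y (m + 1)" for l
    proof -
      have v0: "v = 0" if "m + p = - 1" using v that by (simp add: carr)
      have "(m + p = - 1 \<and> l = Gx 0 1) \<or> (m + p = 0 \<and> (l = Gx 1 0 \<or> l = Gx 1 1)) \<or>
          (m + p = 1 \<and> (l = Gx 2 0 \<or> l = Gx 2 1))"
        using l unfolding labs by (simp split: if_splits; linarith)
      then consider "m + p = - 1" "l = Gx 0 1" | "m + p = 0" "l = Gx 1 0 \<or> l = Gx 1 1"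
        | "m + p = 1" "l = Gx 2 0 \<or> l = Gx 2 1"
        by blast
      then show ?thesis
      proof cases
        case 1
        then show ?thesis using v0 by (simp add: dX N_mono_simps)
      next
        case 2
        then show ?thesis using v[unfolded carr] by (auto simp: dX sp_def N_mono_simps scl_def)
      next
        case 3
        then show ?thesis by (auto simp: dX N_mono_simps amap_coord[OF n] scl_def)
      qed
    qed
  qed
qed

lemma presents_oplus:
  fixes X X' :: "'k::field cpx"
  assumes p: "presents n X Y \<rho>" and p': "presents n X' Y' \<rho>'"
  shows "presents n (oplus X X') (dsum_mono Y Y')
    (\<lambda>l. case l of Tag r x \<Rightarrow> Tag r (if r = 0 then \<rho> x else \<rho>' x) | _ \<Rightarrow> l)"
    (is "presents n ?Z ?T ?\<sigma>")
proof -
  note d = presentsD[OF p] and d' = presentsD[OF p']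
  have labs: "hom_labs ?T m = Tag 0 ` hom_labs Y m \<union> Tag 1 ` hom_labs Y' m" for m
    by (auto simp: hom_labs_def dsum_mono_def)
  define S where "S m r = (if r = 0 then \<rho> ` hom_labs Y m else \<rho>' ` hom_labs Y' m)" for m r :: int
  have carr: "carr (ob ?Z m) = sp {Tag r l |r l. r \<in> {0, 1} \<and> l \<in> S m r}" for m
    unfolding oplus_def cpx.simps
    by (rule dsum_carr) (auto simp: S_def d(3) d'(3))
  have img: "{Tag r l |r l. r \<in> {0, 1} \<and> l \<in> S m r} = ?\<sigma> ` hom_labs ?T m" for m
  proof -
    have "{Tag r l |r l. r \<in> {0, 1} \<and> l \<in> S m r} = Tag 0 ` S m 0 \<union> Tag 1 ` S m 1"
      by auto
    then show ?thesis
      by (simp add: labs S_def image_Un image_image)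
  qed
  have cmp0: "cmp 0 z \<in> carr (ob X m)" and cmp1: "cmp 1 z \<in> carr (ob X' m)" if "z \<in> carr (ob ?Z m)" for m z
    using that unfolding carr d(3) d'(3) by (auto simp: sp_def cmp_def S_def)
  have glueZ: "glue u \<in> carr (ob ?Z m)"
    if "u 0 \<in> carr (ob X m)" "u 1 \<in> carr (ob X' m)" "\<And>r. r \<noteq> 0 \<Longrightarrow> r \<noteq> 1 \<Longrightarrow> u r = 0" for u m
  proof -
    have "u r x = 0" if "\<not> (r \<in> {0, 1} \<and> x \<in> S m r)" for r x
      using that \<open>u 0 \<in> carr (ob X m)\<close> \<open>u 1 \<in> carr (ob X' m)\<close>
        \<open>\<And>r. r \<noteq> 0 \<Longrightarrow> r \<noteq> 1 \<Longrightarrow> u r = 0\<close>[of r]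
      unfolding d(3) d'(3) by (cases "r = 0"; cases "r = 1") (simp_all add: sp_def S_def)
    then show ?thesis
      unfolding carr sp_def by (auto simp: glue_def split: lab.splits)
  qed
  show ?thesis
    unfolding presents_def
  proof (intro conjI allI ballI)
    fix m
    show "wf_mono ?T" using d(1) d'(1) by (rule wf_dsum_mono)
    show "inj_on ?\<sigma> (hom_labs ?T m)"
      unfolding labs
    proof (rule inj_onI)
      fix a b assume "a \<in> Tag 0 ` hom_labs Y m \<union> Tag 1 ` hom_labs Y' m"
        "b \<in> Tag 0 ` hom_labs Y m \<union> Tag 1 ` hom_labs Y' m" "?\<sigma> a = ?\<sigma> b"
      then show "a = b"
        by (elim UnE imageE) (simp_all add: inj_on_eq_iff[OF d(2)] inj_on_eq_iff[OF d'(2)])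
    qed
    show "carr (ob ?Z m) = sp (?\<sigma> ` hom_labs ?T m)"
      unfolding carr img ..
    fix v assume v: "v \<in> carr (ob ?Z m)"
    have Zact: "act (ob ?Z m) h v =
        glue (\<lambda>r. if r \<in> {0, 1} then act (ob (if r = 0 then X else X') m) h (cmp r v) else 0)" for h
      by (simp add: oplus_def dsum_def)
    have Zdiff: "diff ?Z m v = glue (\<lambda>r. if r = 0 then diff X m (cmp 0 v)
                             else if r = 1 then diff X' m (cmp 1 v) else 0)"
      by (simp add: oplus_def)
    show "act (ob ?Z m) h v \<in> carr (ob ?Z m)" for h
      unfolding Zact by (rule glueZ) (simp_all add: d(4) d'(4) cmp0 cmp1 v)
    show "diff ?Z m v \<in> carr (ob ?Z (m + 1))"
      unfolding Zdiff by (rule glueZ) (simp_all add: d(5) d'(5) cmp0 cmp1 v)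
    show "act (ob ?Z m) h v (?\<sigma> l) = h (Gx (mwd ?T l mod int n) 0) * v (?\<sigma> l) +
        h (Gx ((mwd ?T l - 1) mod int n) 1) * (mca ?T l * v (?\<sigma> (mpa ?T l)))"
      if l: "l \<in> hom_labs ?T m" for l h
      using l d(6)[OF cmp0[OF v]] d'(6)[OF cmp1[OF v]]
      by (auto simp: labs Zact glue_def dsum_mono_simps) (auto simp: cmp_def)
    show "diff ?Z m v (?\<sigma> l) = mcf ?T l * v (?\<sigma> (mpd ?T l))"
      if l: "l \<in> hom_labs ?T (m + 1)" for l
      using l d(7)[OF cmp0[OF v]] d'(7)[OF cmp1[OF v]]
      by (auto simp: labs Zdiff glue_def dsum_mono_simps) (auto simp: cmp_def)
  qed
qed

section \<open>Quasi-isomorphisms between tensor products\<close>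

lemma gr_supp: "v \<in> gr X m \<Longrightarrow> v l \<noteq> 0 \<Longrightarrow> l \<in> bB X \<and> bcd X l = m"
  by (auto simp: gr_def sp_def)

lemma grI: "(\<And>l. v l \<noteq> 0 \<Longrightarrow> l \<in> bB X \<and> bcd X l = m) \<Longrightarrow> v \<in> gr X m"
  by (auto simp: gr_def sp_def)

lemma gr_eqI:
  assumes "v \<in> gr X m" "w \<in> gr X m" "\<And>l. l \<in> bB X \<Longrightarrow> bcd X l = m \<Longrightarrow> v l = w l"
  shows "v = w"
proof
  fix l show "v l = w l"
    using gr_supp[OF assms(1), of l] gr_supp[OF assms(2), of l] assms(3)[of l] by metis
qed

lemma wf_bicD:
  assumes "wf_bic X"
  shows "v \<in> gr X m \<Longrightarrow> ba X v \<in> gr X m" "v \<in> gr X m \<Longrightarrow> bd X v \<in> gr X (m + 1)"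
    and "bd X (v + w) = bd X v + bd X w" "bd X (scl c v) = scl c (bd X v)"
    and "bd X (bd X v) = 0"
  using assms unfolding wf_bic_def by blast+

lemma bd_zero: "wf_bic X \<Longrightarrow> bd X 0 = 0"
  using wf_bicD(4)[of X 0 0] by simp

lemma Db_iso_realize_iso:
  fixes X Y :: "'k::field bic"
  assumes n: "n > 0" and X: "wf_bic X" and Y: "wf_bic Y"
    and f: "\<And>m v. v \<in> gr X m \<Longrightarrow> f v \<in> gr Y m"
    and fadd: "\<And>v w. f (v + w) = f v + f w"
    and fwt: "\<And>m c v. v \<in> gr X m \<Longrightarrow> f (\<lambda>l. c (bwd X l) * v l) = (\<lambda>l. c (bwd Y l) * f v l)"
    and fa: "\<And>m v. v \<in> gr X m \<Longrightarrow> f (ba X v) = ba Y (f v)"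
    and fd: "\<And>m v. v \<in> gr X m \<Longrightarrow> f (bd X v) = bd Y (f v)"
    and g: "\<And>m v. v \<in> gr Y m \<Longrightarrow> g v \<in> gr X m"
    and gf: "\<And>m v. v \<in> gr X m \<Longrightarrow> g (f v) = v"
    and fg: "\<And>m v. v \<in> gr Y m \<Longrightarrow> f (g v) = v"
  shows "Db_iso n (realize n X) (realize n Y)"
proof (rule Db_iso_realizeI[OF n X Y f fadd fwt fa fd g])
  have 0: "0 \<in> gr X m" for X :: "'k bic" and m
    by (rule fvec.subspace_0[OF gr_subspace])
  have "f 0 = 0" using fadd[of 0 0] by simp
  then show "g 0 = 0" using gf[OF 0] by metis
  show "g (bd Y v) = bd X (g v)" if v: "v \<in> gr Y m" for m v
    using fd[OF g[OF v]] gf[OF wf_bicD(2)[OF X g[OF v]]] fg[OF v] by metis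
  show "\<exists>w\<in>gr X (m - 1). v - g (f v) = bd X w" if "v \<in> gr X m" for m v
    using gf[OF that] by (intro bexI[OF _ 0]) (simp add: bd_zero[OF X])
  show "\<exists>w\<in>gr Y (m - 1). v - f (g v) = bd Y w" if "v \<in> gr Y m" for m v
    using fg[OF that] by (intro bexI[OF _ 0]) (simp add: bd_zero[OF Y])
qed

section \<open>Symmetry of the tensor product of models\<close>

lemma sg_pred:
  "sg ((a - 1) * b) = (sg (a * b) * sg b :: 'k::field)" "sg (a * (b - 1)) = (sg (a * b) * sg a :: 'k::field)"
  by (auto simp: sg_def)

text \<open>The flip with Koszul signs for both gradings: the product of the weights moves the sign
  in the arrow part from one factor to the other, the product of the degrees does so for the
  differential.\<close>

definition braid :: "'k::field mono \<Rightarrow> 'k mono \<Rightarrow> 'k fvec \<Rightarrow> 'k fvec" where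
  "braid X Y z = (\<lambda>l. case l of Pr y x \<Rightarrow>
     sg (mwd X x * mwd Y y) * (sg (mcd X x * mcd Y y) * z (Pr x y)) | _ \<Rightarrow> 0)"

lemma tenb_commute:
  fixes X Y :: "'k::field mono"
  assumes n: "n > 0" and X: "wf_mono X" and Y: "wf_mono Y"
  shows "Db_iso n (realize n (tenb X Y)) (realize n (tenb Y X))"
proof (rule Db_iso_realize_iso[OF n wf_tenb[OF X Y] wf_tenb[OF Y X], where f = "braid X Y" and g = "braid Y X"])
  note dX = wf_monoD[OF X] and dY = wf_monoD[OF Y]
  note sX = wf_mono_sg[OF X] and sY = wf_mono_sg[OF Y]
  have gr: "braid X Y v \<in> gr (tenb Y X) m" if "v \<in> gr (tenb X Y) m" for X Y :: "'k mono" and v m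
    using that unfolding gr_tenb braid_def by (auto simp: add.commute)
  show "v \<in> gr (tenb X Y) m \<Longrightarrow> braid X Y v \<in> gr (tenb Y X) m" for m v by (rule gr)
  show "v \<in> gr (tenb Y X) m \<Longrightarrow> braid Y X v \<in> gr (tenb X Y) m" for m v by (rule gr)
  show "braid X Y (v + w) = braid X Y v + braid X Y w" for v w
    by (rule lab_fun_eqI) (simp_all add: braid_def algebra_simps)
  show "braid X Y (\<lambda>l. c (bwd (tenb X Y) l) * v l) = (\<lambda>l. c (bwd (tenb Y X) l) * braid X Y v l)" for c v
    by (rule lab_fun_eqI) (simp_all add: braid_def tenb_simps add.commute mult.left_commute)
  have inv: "braid Y X (braid X Y v) = v" if "v \<in> gr (tenb X Y) m" for X Y :: "'k mono" and v m
    using that by (intro lab_fun_eqI) (auto simp: braid_def gr_tenb mult.commute sg_simps)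
  show "v \<in> gr (tenb X Y) m \<Longrightarrow> braid Y X (braid X Y v) = v" for m v by (rule inv)
  show "v \<in> gr (tenb Y X) m \<Longrightarrow> braid X Y (braid Y X v) = v" for m v by (rule inv)
  show "braid X Y (ba (tenb X Y) v) = ba (tenb Y X) (braid X Y v)" for v
  proof (rule lab_fun_eqI)
    fix y x
    have "mca X x = 0 \<or> (mwd X (mpa X x) = mwd X x - 1 \<and> mcd X (mpa X x) = mcd X x)"
      "mca Y y = 0 \<or> (mwd Y (mpa Y y) = mwd Y y - 1 \<and> mcd Y (mpa Y y) = mcd Y y)"
      using dX(2)[of x] dY(2)[of y] by auto
    then show "braid X Y (ba (tenb X Y) v) (Pr y x) = ba (tenb Y X) (braid X Y v) (Pr y x)"
      by (elim disjE) (simp_all add: braid_def tenb_simps sg_pred sg_simps(4,5) distrib_left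
        mult.left_commute mult.commute mult.assoc)
  qed (simp_all add: braid_def tenb_simps)
  show "braid X Y (bd (tenb X Y) v) = bd (tenb Y X) (braid X Y v)" for v
  proof (rule lab_fun_eqI)
    fix y x
    have "mcf X x = 0 \<or> (mwd X (mpd X x) = mwd X x \<and> mcd X (mpd X x) = mcd X x - 1)"
      "mcf Y y = 0 \<or> (mwd Y (mpd Y y) = mwd Y y \<and> mcd Y (mpd Y y) = mcd Y y - 1)"
      using dX(3)[of x] dY(3)[of y] by auto
    then show "braid X Y (bd (tenb X Y) v) (Pr y x) = bd (tenb Y X) (braid X Y v) (Pr y x)"
      by (elim disjE) (simp_all add: braid_def tenb_simps sg_pred sg_simps(4,5) distrib_left
        mult.left_commute mult.commute mult.assoc)
  qed (simp_all add: braid_def tenb_simps)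
qed

section \<open>Tensor products with \<open>N\<close>\<close>

lemma sign_iso:
  fixes X Y :: "'k::field mono"
  assumes n: "n > 0" and X: "wf_mono X" and Y: "wf_mono Y"
    and B: "mB X = mB Y" and pa: "mpa X = mpa Y" and pd: "mpd X = mpd Y"
    and deg: "\<And>l. l \<in> mB Y \<Longrightarrow> mcd X l = mcd Y l \<and> mwd X l = mwd Y l"
    and e: "\<And>l. e l * e l = (1 :: 'k)"
    and a: "\<And>l. e l * mca X l = mca Y l * e (mpa Y l)"
    and d: "\<And>l. e l * mcf X l = mcf Y l * e (mpd Y l)"
  shows "Db_iso n (realize n (of_mono X)) (realize n (of_mono Y))"
proof (rule Db_iso_realize_iso[OF n wf_of_mono[OF X] wf_of_mono[OF Y],
      where f = "\<lambda>v l. e l * v l" and g = "\<lambda>v l. e l * v l"])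
  have e': "e l * (e l * c) = c" for l c
    using e[of l] by (simp flip: mult.assoc)
  show "v \<in> gr (of_mono X) m \<Longrightarrow> (\<lambda>l. e l * v l) \<in> gr (of_mono Y) m"
    "v \<in> gr (of_mono Y) m \<Longrightarrow> (\<lambda>l. e l * v l) \<in> gr (of_mono X) m" for v m
    unfolding gr_of_mono B using deg by auto
  show "(\<lambda>l. e l * (e l * v l)) = v" "(\<lambda>l. e l * (e l * v l)) = v" for v
    by (simp_all add: e')
  show "(\<lambda>l. e l * ba (of_mono X) v l) = ba (of_mono Y) (\<lambda>l. e l * v l)" for v
    using a by (simp add: of_mono_def pa fun_eq_iff flip: mult.assoc)
  show "(\<lambda>l. e l * bd (of_mono X) v l) = bd (of_mono Y) (\<lambda>l. e l * v l)" for v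
    using d by (simp add: of_mono_def pd fun_eq_iff flip: mult.assoc)
  show "(\<lambda>l. e l * (c (bwd (of_mono X) l) * v l)) = (\<lambda>l. c (bwd (of_mono Y) l) * (e l * v l))"
    if v: "v \<in> gr (of_mono X) m" for m c v
  proof
    fix l
    show "e l * (c (bwd (of_mono X) l) * v l) = c (bwd (of_mono Y) l) * (e l * v l)"
      using v deg[of l] unfolding gr_of_mono B by (cases "v l = 0") (auto simp: of_mono_def)
  qed
qed (simp add: fun_eq_iff algebra_simps)

text \<open>The tensor product with the simple module \<open>S\<^sub>j\<close> in degree \<open>2 - q\<close>, which \<open>N\<^sub>j[q]\<close> resolves.\<close>

definition twist :: "'k::field mono \<Rightarrow> int \<Rightarrow> int \<Rightarrow> 'k mono" where
  "twist X j q = X\<lparr>mcd := (\<lambda>l. mcd X l + (2 - q)), mwd := (\<lambda>l. mwd X l + j), mca := (\<lambda>l. sg j * mca X l)\<rparr>"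

lemma wf_twist: "wf_mono X \<Longrightarrow> wf_mono (twist X j q)"
  unfolding wf_mono_def twist_def by simp

text \<open>In N_j the differential matches \<open>Gx 0 1\<close> with \<open>Gx 1 1\<close> and
  \<open>Gx 1 0\<close> with \<open>Gx 2 1\<close>; only \<open>Gx 2 0\<close>, the generator e_j,
  is left over and spans the cohomology. \<open>f\<close> takes the coefficient of e_j, and
  \<open>g\<close> inserts e_j.\<close>

lemma tenb_N:
  fixes X :: "'k::field mono"
  assumes n: "n > 0" and X: "wf_mono X"
  shows "Db_iso n (realize n (tenb X (N_mono j q))) (realize n (of_mono (twist X j q)))"
proof -
  let ?T = "tenb X (N_mono j q)" and ?S = "of_mono (twist X j q)"
  note dX = wf_monoD[OF X] and sX = wf_mono_sg[OF X]
  note wT = wf_tenb[OF X wf_N_mono[of j q]]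
  define f :: "'k fvec \<Rightarrow> 'k fvec" where "f z = (\<lambda>l. z (Pr l (Gx 2 0)))" for z
  define g :: "'k fvec \<Rightarrow> 'k fvec" where
    "g v = (\<lambda>l. case l of Pr x y \<Rightarrow> if y = Gx 2 0 then v x else 0 | _ \<Rightarrow> 0)" for v
  \<comment> \<open>The inverse of the differential of N_j on the matched pairs. The factors are the
    Koszul sign and the sign of the shift by q.\<close>
  define h :: "'k fvec \<Rightarrow> 'k fvec" where
    "h z = (\<lambda>l. case l of Pr x y \<Rightarrow> sg (mcd X x) * (sg q *
       (if y = Gx 1 0 then z (Pr x (Gx 2 1)) else if y = Gx 0 1 then z (Pr x (Gx 1 1)) else 0)) | _ \<Rightarrow> 0)" for z
  have grS: "v \<in> gr ?S m \<longleftrightarrow> (\<forall>l. v l \<noteq> 0 \<longrightarrow> l \<in> mB X \<and> mcd X l + (2 - q) = m)" for v m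
    by (simp add: gr_of_mono twist_def)
  have f: "f v \<in> gr ?S m" if "v \<in> gr ?T m" for v m
    using that unfolding gr_tenb grS f_def by (fastforce simp: N_mono_simps)
  have g: "g v \<in> gr ?T m" if "v \<in> gr ?S m" for v m
    using that unfolding gr_tenb grS g_def by (auto simp: N_mono_simps)
  have h: "h v \<in> gr ?T (m - 1)" if v: "v \<in> gr ?T m" for v m
  proof -
    have "x \<in> mB X \<and> mcd X x + (2 - q) = m" if "v (Pr x (Gx 2 1)) \<noteq> 0" for x
      using that v unfolding gr_tenb by (fastforce simp: N_mono_simps)
    moreover have "x \<in> mB X \<and> mcd X x + (1 - q) = m" if "v (Pr x (Gx 1 1)) \<noteq> 0" for x
      using that v unfolding gr_tenb by (fastforce simp: N_mono_simps)
    ultimately show ?thesis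
      unfolding gr_tenb h_def by (fastforce simp: N_mono_simps split: if_splits)
  qed
  have fd: "f (bd ?T v) = bd ?S (f v)" for v
    by (simp add: f_def tenb_simps N_mono_simps of_mono_def twist_def)
  have gd: "g (bd ?S v) = bd ?T (g v)" for v
    by (rule lab_fun_eqI) (auto simp: g_def tenb_simps of_mono_def twist_def N_mono_def split: lab.splits)
  \<comment> \<open>A cocycle is determined by its entries at the targets of the matched pairs and
    at e_j: the equations \<open>d2\<close> and \<open>d1\<close> express the entries at the sources
    through them.\<close>
  have contract: "u = bd ?T (h u)"
    if u: "u \<in> gr ?T m" and du: "bd ?T u = 0" and fu: "f u = 0" for u m
  proof (rule gr_eqI[OF u])
    show "bd ?T (h u) \<in> gr ?T m"
      using wf_bicD(2)[OF wT h[OF u]] by simp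
    fix l assume "l \<in> bB ?T"
    then obtain x y where l: "l = Pr x y" "x \<in> mB X" and y: "y \<in> mB (N_mono j q :: 'k mono)"
      by (auto simp: tenb_simps)
    have d2: "mcf X x * u (Pr (mpd X x) (Gx 2 1)) + sg (mcd X x) * (sg q * u (Pr x (Gx 1 0))) = 0"
      using fun_cong[OF du, of "Pr x (Gx 2 1)"] by (simp add: tenb_simps N_mono_simps)
    have d1: "mcf X x * u (Pr (mpd X x) (Gx 1 1)) + sg (mcd X x) * (sg q * u (Pr x (Gx 0 1))) = 0"
      using fun_cong[OF du, of "Pr x (Gx 1 1)"] by (simp add: tenb_simps N_mono_simps)
    have sq: "sg (mcd X x) * (sg q * (sg (mcd X x) * (sg q * c))) = (c :: 'k)" for c
      by (simp add: sg_def)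
    have sq1: "sg (mcd X x) * (sg q * (sg (mcd X x) * sg q)) = (1 :: 'k)"
      by (simp add: sg_def)
    have u2: "u (Pr x (Gx 1 0)) = - (sg (mcd X x) * (sg q * (mcf X x * u (Pr (mpd X x) (Gx 2 1)))))"
      using d2 by (auto simp: sg_def add_eq_0_iff2 split: if_splits)
    have u1: "u (Pr x (Gx 0 1)) = - (sg (mcd X x) * (sg q * (mcf X x * u (Pr (mpd X x) (Gx 1 1)))))"
      using d1 by (auto simp: sg_def add_eq_0_iff2 split: if_splits)
    have u0: "u (Pr x (Gx 2 0)) = 0"
      using fun_cong[OF fu, of x] by (simp add: f_def)
    show "u l = bd ?T (h u) l"
      using y sX(4)[of x] unfolding l
      by (cases "mcf X x = 0") (auto simp: N_mono_simps tenb_simps h_def u0 u1[unfolded One_nat_def] u2 sq sq1)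
  qed
  show ?thesis
  proof (rule Db_iso_realizeI[OF n wT wf_of_mono[OF wf_twist[OF X]], where f = f and g = g])
    show "f (v + w) = f v + f w" for v w by (simp add: f_def fun_eq_iff)
    show "f (\<lambda>l. c (bwd ?T l) * v l) = (\<lambda>l. c (bwd ?S l) * f v l)" for c v
      by (simp add: f_def tenb_simps N_mono_simps of_mono_def twist_def)
    show "f (ba ?T v) = ba ?S (f v)" for v
      by (simp add: f_def tenb_simps N_mono_simps of_mono_def twist_def mult.assoc)
    show "g 0 = 0" by (rule lab_fun_eqI) (simp_all add: g_def)
    show "\<exists>w\<in>gr ?T (m - 1). v - g (f v) = bd ?T w" if v: "v \<in> gr ?T m" and dv: "bd ?T v = 0" for m v
    proof -
      have u: "v - g (f v) \<in> gr ?T m"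
        using fvec.subspace_diff[OF gr_subspace v g[OF f[OF v]]] .
      have "bd ?T (v - g (f v)) = bd ?T v - bd ?T (g (f v))"
        using wf_bicD(3)[OF wT, of "v - g (f v)" "g (f v)"] by simp
      then have "bd ?T (v - g (f v)) = - g (f (bd ?T v))"
        by (simp add: dv flip: fd gd)
      then have "bd ?T (v - g (f v)) = 0"
        by (simp add: dv fun_eq_iff f_def g_def split: lab.splits)
      moreover have "f (v - g (f v)) = 0"
        by (simp add: f_def g_def fun_eq_iff)
      ultimately show ?thesis
        using contract[OF u] h[OF u] by blast
    qed
    show "\<exists>w\<in>gr ?S (m - 1). v - f (g v) = bd ?S w" if "v \<in> gr ?S m" for m v
      by (rule bexI[of _ 0])
        (auto simp: f_def g_def fun_eq_iff of_mono_def intro: fvec.subspace_0[OF gr_subspace])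
  qed (auto intro: f g simp: fd gd)
qed

text \<open>The rescaling has to compensate (-1)^j along each arrow from \<open>Gx m 0\<close> to
  \<open>Gx m 1\<close> and (-1)^q along each differential from \<open>Gx (m - 1) 0\<close> to
  \<open>Gx m 1\<close>. Passing from e_(m-1) to e_m thus costs (-1)^(j+q), which starting from 1
  gives the exponents.\<close>

lemma twist_M:
  assumes n: "n > 0"
  shows "Db_iso n (realize n (of_mono (twist (M_mono i k p) j q :: 'k::field mono)))
    (realize n (of_mono (M_mono (i + j) k (p + q - 2))))"
proof (rule sign_iso[OF n wf_twist[OF wf_M_mono] wf_M_mono,
      where e = "\<lambda>l. case l of Gx m s \<Rightarrow> sg (m * (j + q)) * sg (j * int s) | _ \<Rightarrow> 1"])
  fix l
  show "l \<in> mB (M_mono (i + j) k (p + q - 2) :: 'k mono) \<Longrightarrow>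
      mcd (twist (M_mono i k p) j q :: 'k mono) l = mcd (M_mono (i + j) k (p + q - 2) :: 'k mono) l \<and>
      mwd (twist (M_mono i k p) j q :: 'k mono) l = mwd (M_mono (i + j) k (p + q - 2) :: 'k mono) l"
    by (auto simp: twist_def M_mono_def)
qed (auto simp: twist_def M_mono_def sg_def split: lab.splits)

text \<open>The same zigzag as for M, but it starts at \<open>Gx 0 1\<close>, from which the
  differential leads to \<open>Gx 1 1\<close>. This label therefore gets the value 1, which
  \<open>Gx 0 0\<close> has in M.\<close>

lemma twist_N:
  assumes n: "n > 0"
  shows "Db_iso n (realize n (of_mono (twist (N_mono i p) j q :: 'k::field mono)))
    (realize n (of_mono (N_mono (i + j) (p + q - 2))))"
proof (rule sign_iso[OF n wf_twist[OF wf_N_mono] wf_N_mono,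
      where e = "\<lambda>l. case l of Gx m s \<Rightarrow> if m = 0 then 1 else sg (m * (j + q)) * sg (j * int s) | _ \<Rightarrow> 1"])
  fix l
  show "l \<in> mB (N_mono (i + j) (p + q - 2) :: 'k mono) \<Longrightarrow>
      mcd (twist (N_mono i p) j q :: 'k mono) l = mcd (N_mono (i + j) (p + q - 2) :: 'k mono) l \<and>
      mwd (twist (N_mono i p) j q :: 'k mono) l = mwd (N_mono (i + j) (p + q - 2) :: 'k mono) l"
    by (auto simp: twist_def N_mono_def)
qed (auto simp: twist_def N_mono_def sg_def split: lab.splits)

section \<open>Tensor products of two complexes \<open>M\<close>\<close>

text \<open>As a complex of vector spaces M consists of the matched pairs e_m, a_(m+1) and of the
  two unmatched vectors a_0 and e_k. The homotopy \<open>h\<close> inverts the differential on the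
  pairs, so a cocycle without entries at a_0 and e_k is a coboundary.\<close>

lemma tenb_M_contract:
  fixes Y :: "'k::field mono"
  defines "T \<equiv> \<lambda>i k p. tenb (M_mono i k p) Y"
  assumes Y: "wf_mono Y" and u: "u \<in> gr (T i k p) m" and du: "bd (T i k p) u = 0"
    and u0: "\<And>y. u (Pr (Gx 0 1) y) = 0" and uk: "\<And>y. u (Pr (Gx (int k) 0) y) = 0"
  shows "\<exists>w\<in>gr (T i k p) (m - 1). u = bd (T i k p) w"
proof (rule bexI)
  let ?T = "T i k p"
  define h :: "'k fvec \<Rightarrow> 'k fvec" where
    "h z = (\<lambda>l. case l of Pr x y \<Rightarrow> (case x of
       Gx m s \<Rightarrow> if s = 0 \<and> 0 \<le> m \<and> m < int k then sg p * z (Pr (Gx (m + 1) 1) y) else 0 | _ \<Rightarrow> 0) | _ \<Rightarrow> 0)" for z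
  have hs: "h z (Pr (Gx m s) y) = (if s = 0 \<and> 0 \<le> m \<and> m < int k then sg p * z (Pr (Gx (m + 1) 1) y) else 0)" for z m s y
    by (simp add: h_def)
  have wT: "wf_bic ?T" unfolding T_def by (rule wf_tenb[OF wf_M_mono Y])
  have supp: "x \<in> mB (M_mono i k p :: 'k mono) \<and> y \<in> mB Y \<and> mcd (M_mono i k p :: 'k mono) x + mcd Y y = m" if "u (Pr x y) \<noteq> 0" for x y
    using u that unfolding T_def gr_tenb by blast
  show hu: "h u \<in> gr ?T (m - 1)"
    unfolding T_def gr_tenb
  proof (intro conjI allI impI)
    fix x y assume nz: "h u (Pr x y) \<noteq> 0"
    then obtain a where a: "x = Gx a 0" "0 \<le> a" "a < int k" "u (Pr (Gx (a + 1) 1) y) \<noteq> 0"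
      by (cases x) (auto simp: h_def split: if_splits)
    from supp[OF a(4)] show "x \<in> mB (M_mono i k p :: 'k mono)" "y \<in> mB Y" "mcd (M_mono i k p :: 'k mono) x + mcd Y y = m - 1"
      using a(1-3) by (auto simp: M_mono_simps)
  qed (simp_all add: h_def)
  show "u = bd ?T (h u)"
  proof (rule gr_eqI[OF u])
    show "bd ?T (h u) \<in> gr ?T m"
      using wf_bicD(2)[OF wT hu] by simp
    fix l assume "l \<in> bB ?T"
    then obtain x y where xy: "l = Pr x y" "x \<in> mB (M_mono i k p :: 'k mono)"
      by (auto simp: T_def tenb_simps)
    then obtain a s where x: "x = Gx a s" "0 \<le> a" "a \<le> int k" "s = 0 \<or> s = 1"
      by (cases x) (auto simp: M_mono_def less_2_cases_iff)
    \<comment> \<open>The cocycle condition, read at a_(a+1) in the first factor, determines the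
      entries at e_a for a < k.\<close>
    have d: "sg p * u (Pr (Gx a 0) y) = - (sg (a + 1 - p) * (mcf Y y * u (Pr (Gx (a + 1) 1) (mpd Y y))))" if "a < int k"
      using fun_cong[OF du, of "Pr (Gx (a + 1) 1) y"] that x(2)
      by (simp add: T_def tenb_simps M_mono_simps add_eq_0_iff2)
    have d': "u (Pr (Gx a 0) y) = sg (a - p) * (mcf Y y * (sg p * u (Pr (Gx (a + 1) 1) (mpd Y y))))" if "a < int k"
      using arg_cong[OF d[OF that], of "\<lambda>c. sg p * c"] by (simp add: sg_simps mult_ac)
    show "u l = bd ?T (h u) l"
    proof (cases "s = 0")
      case True
      then show ?thesis
        using d' uk[of y] x by (cases "a = int k") (simp_all add: xy T_def tenb_simps M_mono_simps hs)
    next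
      case False
      then show ?thesis
        using u0[of y] x by (cases "a = 0") (simp_all add: xy T_def tenb_simps M_mono_simps hs sg_simps)
    qed
  qed
qed

text \<open>\<open>g\<close> takes the entries along the unmatched vectors a_0 and e_k of the first
  factor, up to a correction, and \<open>f\<close> is an H-linear map with
  \<open>g (f v) = v\<close>. On cocycles the defect z - f (g z) is contracted by
  \<open>tenb_M_contract\<close>.\<close>

lemma tenb_M:
  fixes i j p q :: int
  assumes n: "n > 0" and tk: "t \<le> k"
  shows "Db_iso n (realize n (of_mono (dsum_mono (M_mono (i + j + 1) t (p + q)) (M_mono (i + j - int k) t (p + q - int k)))))
    (realize n (tenb (M_mono i k p) (M_mono j t q) :: 'k::field bic))"
proof -
  define R :: "'k bic" where "R = of_mono (dsum_mono (M_mono (i + j + 1) t (p + q)) (M_mono (i + j - int k) t (p + q - int k)))"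
  define T :: "'k bic" where "T = tenb (M_mono i k p) (M_mono j t q)"
  \<comment> \<open>Normalized to 1 at m = k. Compatibility with the differentials prescribes the
    change (-1)^(m+k) when s grows by one and (-1)^(s+j+q+k) when m does; this product realizes
    both.\<close>
  define \<beta> :: "int \<Rightarrow> int \<Rightarrow> 'k" where "\<beta> m s = sg ((m + int k) * (s + j + q + int k))" for m s
  have wR: "wf_bic R"
    unfolding R_def by (intro wf_of_mono wf_dsum_mono wf_M_mono)
  have wT: "wf_bic T"
    unfolding T_def by (intro wf_tenb wf_M_mono)
  txt \<open>
    The first summand is \<open>a\<^sub>0 \<otimes> M\<close>. A vector \<open>y\<^sub>s\<close> of the second one goes to the lift
    \<open>\<Sum>\<^sub>u \<plusminus> e\<^sub>k\<^sub>-\<^sub>u \<otimes> y\<^sub>s\<^sub>+\<^sub>u\<close> of \<open>e\<^sub>k \<otimes> y\<^sub>s\<close>, which exists since \<open>t \<le> k\<close>; the signs \<open>\<beta>\<close> make it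
    compatible with the differentials.
  \<close>
  define f :: "'k fvec \<Rightarrow> 'k fvec" where
    "f v = (\<lambda>l. case l of Pr (Gx m r') (Gx s r) \<Rightarrow>
       if 0 \<le> m \<and> m \<le> int k \<and> 0 \<le> s \<and> s \<le> int t \<and> r < 2 then
         if r' = 0 then \<beta> m s * v (Tag 1 (Gx (s + m - int k) r))
         else if r' = 1 then
           (if m = 0 then v (Tag 0 (Gx s r)) else 0) +
           (if r = 0 then sg (j - s) * (\<beta> m s * v (Tag 1 (Gx (s + m - int k) 1))) else 0)
         else 0
       else 0 | _ \<Rightarrow> 0)" for v
  txt \<open>The correction term of \<open>g\<close> is needed for \<open>g \<circ> f = id\<close> only if \<open>k = t\<close>.\<close>
  define g :: "'k fvec \<Rightarrow> 'k fvec" where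
    "g z = (\<lambda>l. case l of Tag e (Gx s r) \<Rightarrow>
       if e = 0 then z (Pr (Gx 0 1) (Gx s r)) -
         (if r = 0 \<and> s = int k \<and> s \<le> int t then sg (j - s) * (\<beta> 0 s * z (Pr (Gx (int k) 0) (Gx 0 1))) else 0)
       else if e = 1 then z (Pr (Gx (int k) 0) (Gx s r))
       else 0 | _ \<Rightarrow> 0)" for z
  have fs: "f v (Pr (Gx m r') (Gx s r)) =
      (if 0 \<le> m \<and> m \<le> int k \<and> 0 \<le> s \<and> s \<le> int t \<and> r < 2 then
         if r' = 0 then \<beta> m s * v (Tag 1 (Gx (s + m - int k) r))
         else if r' = 1 then
           (if m = 0 then v (Tag 0 (Gx s r)) else 0) +
           (if r = 0 then sg (j - s) * (\<beta> m s * v (Tag 1 (Gx (s + m - int k) 1))) else 0)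
         else 0
       else 0)" for v m r' s r
    by (simp add: f_def)
  have gs: "g z (Tag 0 (Gx s r)) = z (Pr (Gx 0 1) (Gx s r)) -
         (if r = 0 \<and> s = int k \<and> s \<le> int t then sg (j - s) * (\<beta> 0 s * z (Pr (Gx (int k) 0) (Gx 0 1))) else 0)"
    "g z (Tag 1 (Gx s r)) = z (Pr (Gx (int k) 0) (Gx s r))" for z s r
    by (simp_all add: g_def)
  have BR: "l \<in> bB R \<longleftrightarrow> (\<exists>e s r. l = Tag e (Gx s r) \<and> (e = 0 \<or> e = 1) \<and> 0 \<le> s \<and> s \<le> int t \<and> (r = 0 \<or> r = 1))" for l
    by (auto simp: R_def of_mono_def dsum_mono_def M_mono_def image_iff less_2_cases_iff)
  have BT: "l \<in> bB T \<longleftrightarrow> (\<exists>m r' s r. l = Pr (Gx m r') (Gx s r) \<and> 0 \<le> m \<and> m \<le> int k \<and> 0 \<le> s \<and> s \<le> int t \<and>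
      (r' = 0 \<or> r' = 1) \<and> (r = 0 \<or> r = 1))" for l
    by (auto simp: T_def tenb_simps M_mono_def less_2_cases_iff)
  have Rs: "bcd R (Tag 0 (Gx s r)) = s - (p + q)" "bcd R (Tag 1 (Gx s r)) = s - (p + q - int k)"
    "bwd R (Tag 0 (Gx s r)) = i + j + 1 - s + int r" "bwd R (Tag 1 (Gx s r)) = i + j - int k - s + int r"
    "ba R v (Tag 0 (Gx s r)) = (if r = 1 \<and> 0 \<le> s \<and> s \<le> int t then v (Tag 0 (Gx s 0)) else 0)"
    "ba R v (Tag 1 (Gx s r)) = (if r = 1 \<and> 0 \<le> s \<and> s \<le> int t then v (Tag 1 (Gx s 0)) else 0)"
    "bd R v (Tag 0 (Gx s r)) = (if r = 1 \<and> 1 \<le> s \<and> s \<le> int t then sg (p + q) * v (Tag 0 (Gx (s - 1) 0)) else 0)"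
    "bd R v (Tag 1 (Gx s r)) = (if r = 1 \<and> 1 \<le> s \<and> s \<le> int t then sg (p + q - int k) * v (Tag 1 (Gx (s - 1) 0)) else 0)"
    for v s r
    by (simp_all add: R_def of_mono_def dsum_mono_simps M_mono_simps)
  have Ts: "bcd T (Pr (Gx m r') (Gx s r)) = m - p + (s - q)"
    "bwd T (Pr (Gx m r') (Gx s r)) = i - m + int r' + (j - s + int r)"
    "ba T z (Pr (Gx m r') (Gx s r)) = (if r = 1 \<and> 0 \<le> s \<and> s \<le> int t then z (Pr (Gx m r') (Gx s 0)) else 0) +
      (if r' = 1 \<and> 0 \<le> m \<and> m \<le> int k then sg (j - s + int r) * z (Pr (Gx m 0) (Gx s r)) else 0)"
    "bd T z (Pr (Gx m r') (Gx s r)) = (if r' = 1 \<and> 1 \<le> m \<and> m \<le> int k then sg p * z (Pr (Gx (m - 1) 0) (Gx s r)) else 0) +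
      (if r = 1 \<and> 1 \<le> s \<and> s \<le> int t then sg (m - p) * (sg q * z (Pr (Gx m r') (Gx (s - 1) 0))) else 0)"
    for z m r' s r
    by (simp_all add: T_def tenb_simps M_mono_simps)
  have suppR: "0 \<le> s \<and> s \<le> int t \<and> (r = 0 \<or> r = 1) \<and> bcd R (Tag e (Gx s r)) = m"
    if "v \<in> gr R m" "v (Tag e (Gx s r)) \<noteq> 0" for v m e s r
    using gr_supp[OF that] by (auto simp: BR)
  have suppT: "0 \<le> a \<and> a \<le> int k \<and> 0 \<le> s \<and> s \<le> int t \<and> (r' = 0 \<or> r' = 1) \<and> (r = 0 \<or> r = 1) \<and>
      bcd T (Pr (Gx a r') (Gx s r)) = m"
    if "v \<in> gr T m" "v (Pr (Gx a r') (Gx s r)) \<noteq> 0" for v m a r' s r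
    using gr_supp[OF that] by (auto simp: BT)
  have f_gr: "f v \<in> gr T m" if v: "v \<in> gr R m" for v m
  proof (rule grI)
    fix l assume nz: "f v l \<noteq> 0"
    then obtain a r' s r where l: "l = Pr (Gx a r') (Gx s r)" "0 \<le> a" "a \<le> int k" "0 \<le> s" "s \<le> int t" "r < 2"
      and r': "r' = 0 \<or> r' = 1"
      by (auto simp: f_def split: lab.splits if_splits)
    then have r: "r = 0 \<or> r = 1" by auto
    have "v (Tag 1 (Gx (s + a - int k) r)) \<noteq> 0 \<or> v (Tag 1 (Gx (s + a - int k) 1)) \<noteq> 0 \<or>
        a = 0 \<and> v (Tag 0 (Gx s r)) \<noteq> 0"
      using nz r' unfolding l(1) by (auto simp: fs split: if_splits)
    then have "bcd T l = m"
      using suppR[OF v, of 1 "s + a - int k"] suppR[OF v, of 0 s r]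
      unfolding l(1) Rs Ts by fastforce
    then show "l \<in> bB T \<and> bcd T l = m"
      using l r r' by (auto simp: BT)
  qed
  have g_gr: "g z \<in> gr R m" if z: "z \<in> gr T m" for z m
  proof (rule grI)
    fix l assume nz: "g z l \<noteq> 0"
    then obtain e s r where l: "l = Tag e (Gx s r)" "e = 0 \<or> e = 1"
      by (auto simp: g_def split: lab.splits if_splits)
    have "e = 1 \<and> z (Pr (Gx (int k) 0) (Gx s r)) \<noteq> 0 \<or> e = 0 \<and> z (Pr (Gx 0 1) (Gx s r)) \<noteq> 0 \<or>
        e = 0 \<and> r = 0 \<and> s = int k \<and> s \<le> int t \<and> z (Pr (Gx (int k) 0) (Gx 0 1)) \<noteq> 0"
      using nz l(2) unfolding l(1) by (auto simp: gs split: if_splits)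
    then show "l \<in> bB R \<and> bcd R l = m"
    proof (elim disjE conjE)
      assume e: "e = 1" and "z (Pr (Gx (int k) 0) (Gx s r)) \<noteq> 0"
      from suppT[OF z this(2)] show ?thesis by (auto simp: l(1) e BR Rs Ts)
    next
      assume e: "e = 0" and "z (Pr (Gx 0 1) (Gx s r)) \<noteq> 0"
      from suppT[OF z this(2)] show ?thesis by (auto simp: l(1) e BR Rs Ts)
    next
      assume e: "e = 0" "r = 0" "s = int k" "s \<le> int t" and "z (Pr (Gx (int k) 0) (Gx 0 1)) \<noteq> 0"
      from suppT[OF z this(5)] e show ?thesis by (auto simp: l(1) BR Rs Ts)
    qed
  qed
  have fadd: "f (v + w) = f v + f w" for v w
    by (auto simp: f_def fun_eq_iff algebra_simps split: lab.splits)
  have fwt: "f (\<lambda>l. c (bwd R l) * v l) = (\<lambda>l. c (bwd T l) * f v l)" if v: "v \<in> gr R m" for m c v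
  proof -
    have e: "i + j - int k - (s + a - int k) + int r = i - a + (j - s + int r)"
      "i + j - int k - (s + a - int k) + 1 = i - a + 1 + (j - s)" for a s r
      by auto
    show ?thesis
      by (rule gr_eqI[OF f_gr[OF gr_mult[OF v]] gr_mult[OF f_gr[OF v]]])
        (auto simp: BT fs Rs Ts e algebra_simps)
  qed
  \<comment> \<open>The index s + m - k in \<open>f\<close> may become negative; v then has the
    value 0, so \<open>f\<close> needs no further case distinction.\<close>
  have V0: "v (Tag e (Gx s r)) = 0" if "v \<in> gr R m" "s < 0 \<or> s > int t" for v m e s r
    using suppR[OF that(1), of e s r] that(2) by (cases "v (Tag e (Gx s r)) = 0") auto
  \<comment> \<open>The arrow sends e_m tensor e_s to e_m tensor a_s plus (-1)^(j-s) a_m tensor e_s.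
    The second term is the reason for the entries of \<open>f\<close> at r' = 1, r = 0.\<close>
  have fa: "f (ba R v) = ba T (f v)" if v: "v \<in> gr R m" for m v
  proof (rule gr_eqI[OF f_gr[OF wf_bicD(1)[OF wR v]] wf_bicD(1)[OF wT f_gr[OF v]]])
    fix l assume "l \<in> bB T"
    then obtain a r' s r where l: "l = Pr (Gx a r') (Gx s r)" "0 \<le> a" "a \<le> int k" "0 \<le> s" "s \<le> int t"
      and r: "r' = 0 \<or> r' = 1" "r = 0 \<or> r = 1"
      unfolding BT by blast
    show "f (ba R v) l = ba T (f v) l"
      using r l(2-) V0[OF v] unfolding l(1)
      by (elim disjE) (auto simp: fs Rs Ts sg_simps)
  qed
  \<comment> \<open>The conditions at the entries e_a tensor a_s, a_a tensor e_s and a_a tensor a_s,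
    in this order; in the last one the two parts of the differential cancel. \<open>c4\<close>
    concerns the summand along a_0.\<close>
  have c1: "sg (a - p) * (sg q * (\<beta> a (s - 1) * x)) = \<beta> a s * (sg (p + q - int k) * x)"
    and c2: "sg p * (\<beta> (a - 1) s * x) = sg (j - s) * (\<beta> a s * (sg (p + q - int k) * x))"
    and c3: "sg p * (\<beta> (a - 1) s * x) + sg (a - p) * (sg q * (sg (j - (s - 1)) * (\<beta> a (s - 1) * x))) = 0"
    and c4: "sg (- p) * (sg q * x) = sg (p + q) * x"
    for a s x
    by (auto simp: \<beta>_def sg_def)
  have fd: "f (bd R v) = bd T (f v)" if v: "v \<in> gr R m" for m v
  proof (rule gr_eqI[OF f_gr[OF wf_bicD(2)[OF wR v]] wf_bicD(2)[OF wT f_gr[OF v]]])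
    fix l assume "l \<in> bB T"
    then obtain a r' s r where l: "l = Pr (Gx a r') (Gx s r)" "0 \<le> a" "a \<le> int k" "0 \<le> s" "s \<le> int t"
      and r: "r' = 0 \<or> r' = 1" "r = 0 \<or> r = 1"
      unfolding BT by blast
    have idx: "s - 1 + a - int k = s + a - int k - 1" "s + (a - 1) - int k = s + a - int k - 1"
      "s - 1 - int k = s - int k - 1"
      by auto
    show "f (bd R v) l = bd T (f v) l"
    proof (cases "s + a - int k < 1")
      case True
      then have "v (Tag 1 (Gx (s + a - int k - 1) r)) = 0" for r
        by (intro V0[OF v]) auto
      then show ?thesis
        using r l(2-) True unfolding l(1)
        by (elim disjE) (auto simp: fs Rs Ts idx c4 simp flip: One_nat_def)
    next
      case False
      \<comment> \<open>Since s is at most t and t at most k, a is positive: the lift has left the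
        second factor before it could need a term e_(-1) of the first.\<close>
      then have "1 \<le> s" "1 \<le> a" "s + a - int k \<le> int t"
        using l(2-) tk by auto
      then show ?thesis
        using r l(2-) False c1[of a s 1] c2[of a s 1] c3[of a s] unfolding l(1)
        by (elim disjE) (auto simp: fs Rs Ts idx simp flip: One_nat_def)
    qed
  qed
  have \<beta>k: "\<beta> (int k) s = 1" for s
    by (simp add: \<beta>_def sg_def)
  have gf: "g (f v) = v" if v: "v \<in> gr R m" for m v
  proof (rule gr_eqI[OF g_gr[OF f_gr[OF v]] v])
    fix l assume "l \<in> bB R"
    then obtain e s r where l: "l = Tag e (Gx s r)" and esr: "e = 0 \<or> e = 1" "0 \<le> s" "s \<le> int t" "r = 0 \<or> r = 1"
      unfolding BR by blast
    \<comment> \<open>The second summand contributes to a_0 tensor e_s with index s - k, which is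
      negative unless s = k = t. In that case the correction in \<open>g\<close> removes the
      contribution.\<close>
    have "v (Tag 1 (Gx (s - int k) 1)) = 0" if "s \<noteq> int k"
      using that esr tk by (intro V0[OF v]) auto
    then show "g (f v) l = v l"
      using esr tk unfolding l by (elim disjE) (auto simp: gs fs \<beta>k simp flip: One_nat_def)
  qed
  have gd: "g (bd T z) = bd R (g z)" if z: "z \<in> gr T m" for m z
  proof (rule gr_eqI[OF g_gr[OF wf_bicD(2)[OF wT z]] wf_bicD(2)[OF wR g_gr[OF z]]])
    fix l assume "l \<in> bB R"
    then obtain e s r where l: "l = Tag e (Gx s r)" and esr: "e = 0 \<or> e = 1" "0 \<le> s" "s \<le> int t" "r = 0 \<or> r = 1"
      unfolding BR by blast
    have "sg (int k - p) * (sg q * x) = sg (p + q - int k) * x" for x :: 'k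
      by (auto simp: sg_def)
    then show "g (bd T z) l = bd R (g z) l"
      using esr tk unfolding l by (elim disjE) (auto simp: gs Rs Ts c4 simp flip: One_nat_def)
  qed
  have gadd: "g (v - w) = g v - g w" for v w
    by (auto simp: g_def fun_eq_iff algebra_simps split: lab.splits)
  show ?thesis
    unfolding R_def[symmetric] T_def[symmetric]
  proof (rule Db_iso_realizeI[where f = f and g = g, OF n wR wT f_gr fadd fwt fa fd g_gr _ gd])
    show "g 0 = 0" using gadd[of 0 0] by simp
    show "\<exists>w\<in>gr R (m - 1). v - g (f v) = bd R w" if "v \<in> gr R m" for m v
      using gf[OF that] by (intro bexI[of _ 0]) (auto simp: bd_zero[OF wR] intro: fvec.subspace_0[OF gr_subspace])
    show "\<exists>w\<in>gr T (m - 1). z - f (g z) = bd T w" if z: "z \<in> gr T m" and dz: "bd T z = 0" for m z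
    proof -
      define u where "u = z - f (g z)"
      have u: "u \<in> gr T m"
        unfolding u_def by (rule fvec.subspace_diff[OF gr_subspace z f_gr[OF g_gr[OF z]]])
      have "g 0 = 0" "f 0 = 0" using gadd[of 0 0] fadd[of 0 0] by simp_all
      then have "bd T (f (g z)) = 0"
        using fd[OF g_gr[OF z]] gd[OF z] by (simp add: dz)
      then have du: "bd T u = 0"
        using wf_bicD(3)[OF wT, of u "f (g z)"] dz by (simp add: u_def)
      have gu: "g u = 0"
        unfolding u_def gadd gf[OF g_gr[OF z]] by simp
      \<comment> \<open>The entries along e_k come before those along a_0, because the correction in
        \<open>g\<close> is itself an entry along e_k.\<close>
      have uk: "u (Pr (Gx (int k) 0) y) = 0" for y
      proof (cases y)
        case (Gx s r)
        then show ?thesis using fun_cong[OF gu, of "Tag 1 (Gx s r)"] by (simp add: gs)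
      qed (use gr_supp[OF u] BT in blast)+
      have u0: "u (Pr (Gx 0 1) y) = 0" for y
      proof (cases y)
        case (Gx s r)
        then show ?thesis using fun_cong[OF gu, of "Tag 0 (Gx s r)"] uk by (simp add: gs)
      qed (use gr_supp[OF u] BT in blast)+
      show ?thesis
        using tenb_M_contract[OF wf_M_mono u[unfolded T_def] du[unfolded T_def] u0 uk]
        unfolding u_def T_def .
    qed
  qed
qed

section \<open>Return from the models to the complexes\<close>

text \<open>\<open>tenb_M\<close> wants the longer complex on the left. The opposite order is
  reduced to it by the symmetry of the models, after the parameter \<open>\<mu>\<close> has been
  removed.\<close>

lemma ten_M_M_Db_iso:
  fixes i j p q :: int and \<mu> :: "'k::field"
  assumes n: "even n" "n > 0" and tk: "t \<le> k"
  defines "R \<equiv> oplus (shift (p + q) (Mcpx n (i + j + 1) (i + j + 1 - int t)))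
    (shift (p + q - int k) (Mcpx n (i + j - int k) (i + j - int k - int t)))"
  shows "Db_iso n (ten n \<mu> (shift p (Mcpx n i (i - int k))) (shift q (Mcpx n j (j - int t)))) R"
    and "Db_iso n (ten n \<mu> (shift q (Mcpx n j (j - int t))) (shift p (Mcpx n i (i - int k)))) R"
proof -
  note M = presents_M[OF n(2)]
  have T: "Db_iso n (realize n (tenb (M_mono i k p) (M_mono j t q) :: 'k bic)) R"
    using Db_iso_trans[OF presents_Db_iso[OF n(2) presents_oplus[OF M M]] tenb_M[OF n(2) tk]]
    unfolding R_def by (rule Db_iso_sym)
  show "Db_iso n (ten n \<mu> (shift p (Mcpx n i (i - int k))) (shift q (Mcpx n j (j - int t)))) R"
    by (rule Db_iso_trans[OF ten_Db_iso[OF n M M] T])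
  show "Db_iso n (ten n \<mu> (shift q (Mcpx n j (j - int t))) (shift p (Mcpx n i (i - int k)))) R"
    by (rule Db_iso_trans[OF ten_Db_iso[OF n M M] Db_iso_trans[OF tenb_commute[OF n(2) wf_M_mono wf_M_mono] T]])
qed

theorem proposition4p2:
  fixes \<mu> :: "'k::{alg_closed_field, field_char_0}" and n :: nat
    and i j p q :: int and k t :: nat
  assumes "even n" and "n > 0"
  shows
   "(\<comment> \<open>(1)\<close>
     Db_iso n (ten n \<mu> (shift p (Ncpx n i)) (shift q (Ncpx n j)))
       (shift (p + q - 2) (Ncpx n (i + j)) :: 'k cpx)) \<and>
    (\<comment> \<open>(2)\<close>
     Db_iso n (ten n \<mu> (shift p (Mcpx n i (i - int k))) (shift q (Ncpx n j)))
       (ten n \<mu> (shift q (Ncpx n j)) (shift p (Mcpx n i (i - int k)))) \<and>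
     Db_iso n (ten n \<mu> (shift q (Ncpx n j)) (shift p (Mcpx n i (i - int k))))
       (shift (p + q - 2) (Mcpx n (i + j) (i - int k + j)))) \<and>
    (\<comment> \<open>(3)\<close>
     Db_iso n (ten n \<mu> (shift p (Mcpx n i (i - int k))) (shift q (Mcpx n j (j - int t))))
       (oplus
         (shift (p + q) (Mcpx n (i + j + 1) (i + j + 1 - int (min k t))))
         (shift (p + q - int (max k t))
           (Mcpx n (i + j - int (max k t)) (i + j - int k - int t)))))"
proof (intro conjI)
  note M = presents_M[OF assms(2)] and N = presents_N[OF assms(2)]
  note T = ten_Db_iso[OF assms] and iso = presents_Db_iso[OF assms(2)]
  show "Db_iso n (ten n \<mu> (shift p (Ncpx n i)) (shift q (Ncpx n j))) (shift (p + q - 2) (Ncpx n (i + j)))"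
    by (rule Db_iso_trans[OF T[OF N N] Db_iso_trans[OF tenb_N[OF assms(2) wf_N_mono]
          Db_iso_trans[OF twist_N[OF assms(2)] Db_iso_sym[OF iso[OF N]]]]])
  note commute = tenb_commute[OF assms(2) wf_M_mono wf_N_mono]
  show "Db_iso n (ten n \<mu> (shift p (Mcpx n i (i - int k))) (shift q (Ncpx n j)))
      (ten n \<mu> (shift q (Ncpx n j)) (shift p (Mcpx n i (i - int k))))"
    by (rule Db_iso_trans[OF T[OF M N] Db_iso_trans[OF commute Db_iso_sym[OF T[OF N M]]]])
  \<comment> \<open>\<open>tenb_N\<close> has N_j as the second factor, so the factors are exchanged
    at the level of models.\<close>
  have "Db_iso n (ten n \<mu> (shift q (Ncpx n j)) (shift p (Mcpx n i (i - int k))))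
      (shift (p + q - 2) (Mcpx n (i + j) (i + j - int k)))"
    by (rule Db_iso_trans[OF T[OF N M] Db_iso_trans[OF Db_iso_sym[OF commute]
          Db_iso_trans[OF tenb_N[OF assms(2) wf_M_mono] Db_iso_trans[OF twist_M[OF assms(2)] Db_iso_sym[OF iso[OF M]]]]]])
  then show "Db_iso n (ten n \<mu> (shift q (Ncpx n j)) (shift p (Mcpx n i (i - int k))))
      (shift (p + q - 2) (Mcpx n (i + j) (i - int k + j)))"
    by (simp add: algebra_simps)
  show "Db_iso n (ten n \<mu> (shift p (Mcpx n i (i - int k))) (shift q (Mcpx n j (j - int t))))
       (oplus
         (shift (p + q) (Mcpx n (i + j + 1) (i + j + 1 - int (min k t))))
         (shift (p + q - int (max k t))
           (Mcpx n (i + j - int (max k t)) (i + j - int k - int t))))"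
  proof (cases "t \<le> k")
    case True
    then show ?thesis
      using ten_M_M_Db_iso(1)[OF assms True, of \<mu> p i q j] by (simp add: min_absorb2 max_absorb1)
  next
    case False
    \<comment> \<open>The roles of the two factors are exchanged, and the second order of factors in
      \<open>ten_M_M_Db_iso\<close> applies.\<close>
    then have "k \<le> t" by simp
    have eq: "i + j - int t - int k = i + j - int k - int t" by simp
    then show ?thesis
      using ten_M_M_Db_iso(2)[OF assms \<open>k \<le> t\<close>, of \<mu> p i q j]
      by (simp add: min_absorb1 max_absorb2 add.commute eq \<open>k \<le> t\<close>)
  qed
qed

end
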